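(* Let $c$ satisfy the Lipschitz cost assumption and let $\mu,\nu$ satisfy the ball-mass assumption (both stated in the context). Let $N\in\mathbb{N}$, $\varepsilon\in(0,\min\{\delta_\mu,\delta_\nu,1\}]$, and $\tau<1$ such that $$\tau\ \ge\ 2N\exp\left(-\frac N2\min\left\{\left(C_\mu\varepsilon^{\mathcal{D}_\mu}\right)^2,\left(C_\nu\varepsilon^{\mathcal{D}_\nu}\right)^2\right\}\right).$$ Then with probability at least $1-\tau$, $$\|T^{A,\varepsilon}_N-T^{B,\varepsilon}_N\|_{\mathrm{HS}}=\|t^{A,\varepsilon}_N-t^{\varepsilon}_N\|_{L^2(\mu\otimes\nu)}\ \le\ M\,\varepsilon^{-1-\max\{\mathcal{D}_\mu,\mathcal{D}_\nu\}}\sqrt{W_2^2(\mu_N,\mu)+W_2^2(\nu_N,\nu)},$$ where $M>0$ is a constant that does not depend on $N$, $\varepsilon$, $\tau$.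
   Context: $(\mathcal{X},d)$ is a compact metric space, $\mathcal{P}(\mathcal{X})$ the set of Borel probability measures, $\mathrm{spt}$ denotes support, $B(x,r)=\{x':d(x,x')<r\}$. $\|\cdot\|_{\mathrm{HS}}$ is the Hilbert--Schmidt norm, $W_2$ the 2-Wasserstein distance for $d$. Lipschitz cost assumption: $c:\mathcal{X}\times\mathcal{X}\to\mathbb{R}$ is continuous and symmetric, $c\ge0$, $c(x,x)=0$, and there is $\mathrm{Lip}(c)>0$ with $|c(x,y)-c(x',y)|\le\mathrm{Lip}(c)\,d(x,x')$ for all $x,x',y$. Ball-mass assumption: there are constants $C_\mu,\mathcal{D}_\mu,\delta_\mu>0$ with $\mu(B(x,\delta))\ge C_\mu\delta^{\mathcal{D}_\mu}$ for all $\delta\in(0,\delta_\mu]$, $x\in\mathrm{spt}(\mu)$; moreover $C_\mu\le1$ (and $\mathcal{D}_\mu$ is at most the dimension of the ambient space when $\mathcal{X}$ is a subset of a Euclidean space). Analogous constants $C_\nu,\mathcal{D}_\nu,\delta_\nu$ exist for $\nu$. Entropic transport kernel: for $\rho,\sigma\in\mathcal{P}(\mathcal{X})$ and $\varepsilon>0$, $k^\varepsilon_{\rho\sigma}(x,y)=\exp([\alpha(x)+\beta(y)-c(x,y)]/\varepsilon)$ on $\mathcal{X}\times\mathcal{X}$, where $\alpha,\beta\in C(\mathcal{X})$ maximize $\int\alpha\,d\rho+\int\beta\,d\sigma-\varepsilon\int[\exp((\alpha(x)+\beta(y)-c(x,y))/\varepsilon)-1]\,d(\rho\otimes\sigma)(x,y)$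 and satisfy, for all $x,y\in\mathcal{X}$, $\alpha(x)=-\varepsilon\log\int\exp([\beta(y')-c(x,y')]/\varepsilon)\,d\sigma(y')$ and $\beta(y)=-\varepsilon\log\int\exp([\alpha(x')-c(x',y)]/\varepsilon)\,d\rho(x')$. Such pairs exist and $\alpha(x)+\beta(y)$ does not depend on the choice, so $k^\varepsilon_{\rho\sigma}\in C(\mathcal{X}\times\mathcal{X})$ is well defined. Data: $\mu,\nu\in\mathcal{P}(\mathcal{X})$, $\pi$ is a probability measure on $\mathcal{X}\times\mathcal{X}$ with first marginal $\mu$ and second marginal $\nu$; $(x_i,y_i)_{i=1}^N$ are i.i.d. with law $\pi$; $\pi_N=\frac1N\sum_i\delta_{(x_i,y_i)}$, with first and second marginals $\mu_N,\nu_N$. Operators: $t^\varepsilon_N(x,y)=\int k^\varepsilon_{\mu_N\mu_N}(x,x')\,k^\varepsilon_{\nu_N\nu_N}(y',y)\,d\pi_N(x',y')$, a continuous function on $\mathcal{X}\times\mathcal{X}$; $T^\varepsilon_N:L^2(\mu_N)\to L^2(\nu_N)$, $u\mapsto\int u(x)t^\varepsilon_N(x,\cdot)\,d\mu_N(x)$. Let $\gamma^\mu_N$ (resp. $\gamma^\nu_N$) be an unregularized optimal transport plan for cost $d^2$ from $\mu$ to $\mu_N$ (resp. from $\nu$ to $\nu_N$), and $\gamma^\mu_N(\cdot|x)$, $\gamma^\nu_N(\cdot|y)$ its disintegration with respect to the $\mu$- (resp. $\nu$-) marginal. The operator $T^\mu_N:L^2(\mu)\to L^2(\mu_N)$ is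 characterized by $\int (T^\mu_Nu)v\,d\mu_N=\int u(x)v(x')\,d\gamma^\mu_N(x,x')$, and similarly $T^\nu_N:L^2(\nu)\to L^2(\nu_N)$. Then $T^{A,\varepsilon}_N=(T^\nu_N)^*\circ T^\varepsilon_N\circ T^\mu_N:L^2(\mu)\to L^2(\nu)$, which has integration kernel $t^{A,\varepsilon}_N(x,y)=\int t^\varepsilon_N(x',y')\,d\gamma^\mu_N(x'|x)\,d\gamma^\nu_N(y'|y)$, i.e. $T^{A,\varepsilon}_Nu=\int u(x)t^{A,\varepsilon}_N(x,\cdot)\,d\mu(x)$. $T^{B,\varepsilon}_N:L^2(\mu)\to L^2(\nu)$, $u\mapsto\int u(x)t^\varepsilon_N(x,\cdot)\,d\mu(x)$. *)

theory Defs
  imports "HOL-Probability.Probability"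
begin

definition borel_prob :: "'b::topological_space measure \<Rightarrow> bool" where
  "borel_prob \<rho> \<longleftrightarrow> prob_space \<rho> \<and> sets \<rho> = sets borel"

definition spt :: "'b::topological_space measure \<Rightarrow> 'b set" where
  "spt \<rho> = {x. \<forall>U. open U \<and> x \<in> U \<longrightarrow> emeasure \<rho> U > 0}"

definition couplings ::
  "'a::topological_space measure \<Rightarrow> 'b::topological_space measure \<Rightarrow> ('a \<times> 'b) measure set" where
  "couplings \<rho> \<sigma> = {\<gamma>. borel_prob \<gamma> \<and> distr \<gamma> borel fst = \<rho> \<and> distr \<gamma> borel snd = \<sigma>}"

definition sq_cost :: "('a::metric_space \<times> 'a) measure \<Rightarrow> real" where
  "sq_cost \<gamma> = (\<integral>p. (dist (fst p) (snd p))\<^sup>2 \<partial>\<gamma>)"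

definition W2 :: "'a::metric_space measure \<Rightarrow> 'a measure \<Rightarrow> real" where
  "W2 \<rho> \<sigma> = sqrt (INF \<gamma>\<in>couplings \<rho> \<sigma>. sq_cost \<gamma>)"

definition optimal_plan ::
  "'a::metric_space measure \<Rightarrow> 'a measure \<Rightarrow> ('a \<times> 'a) measure \<Rightarrow> bool" where
  "optimal_plan \<rho> \<sigma> \<gamma> \<longleftrightarrow>
     \<gamma> \<in> couplings \<rho> \<sigma> \<and> (\<forall>\<gamma>'\<in>couplings \<rho> \<sigma>. sq_cost \<gamma> \<le> sq_cost \<gamma>')"

text \<open>\<^term>\<open>\<kappa> x\<close> is the conditional law \<open>\<gamma>(\<cdot>|x)\<close> of the second coordinate given the first.\<close>

definition disintegration ::
  "('a::topological_space \<times> 'b::topological_space) measure \<Rightarrow> 'a measure \<Rightarrow>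
   ('a \<Rightarrow> 'b measure) \<Rightarrow> bool" where
  "disintegration \<gamma> \<rho> \<kappa> \<longleftrightarrow>
     \<kappa> \<in> measurable \<rho> (prob_algebra borel) \<and>
     (\<forall>S\<in>sets \<gamma>. emeasure \<gamma> S = (\<integral>\<^sup>+x. emeasure (\<kappa> x) (Pair x -` S) \<partial>\<rho>))"

definition lipschitz_cost :: "('a::metric_space \<Rightarrow> 'a \<Rightarrow> real) \<Rightarrow> bool" where
  "lipschitz_cost c \<longleftrightarrow>
     continuous_on UNIV (\<lambda>(x, y). c x y) \<and>
     (\<forall>x y. c x y = c y x) \<and> (\<forall>x y. 0 \<le> c x y) \<and> (\<forall>x. c x x = 0) \<and>
     (\<exists>L>0. \<forall>x x' y. \<bar>c x y - c x' y\<bar> \<le> L * dist x x')"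

definition ball_mass :: "'a::metric_space measure \<Rightarrow> real \<Rightarrow> real \<Rightarrow> real \<Rightarrow> bool" where
  "ball_mass \<rho> C D \<delta>0 \<longleftrightarrow>
     0 < C \<and> C \<le> 1 \<and> 0 < D \<and> 0 < \<delta>0 \<and>
     (\<forall>\<delta>. 0 < \<delta> \<and> \<delta> \<le> \<delta>0 \<longrightarrow> (\<forall>x\<in>spt \<rho>. C * \<delta> powr D \<le> measure \<rho> (ball x \<delta>)))"

definition entropic_dual ::
  "('a::topological_space \<Rightarrow> 'a \<Rightarrow> real) \<Rightarrow> real \<Rightarrow> 'a measure \<Rightarrow> 'a measure \<Rightarrow>
   ('a \<Rightarrow> real) \<Rightarrow> ('a \<Rightarrow> real) \<Rightarrow> real" where
  "entropic_dual c \<epsilon> \<rho> \<sigma> \<alpha> \<beta> =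
     (\<integral>x. \<alpha> x \<partial>\<rho>) + (\<integral>y. \<beta> y \<partial>\<sigma>)
     - \<epsilon> * (\<integral>(x, y). exp ((\<alpha> x + \<beta> y - c x y) / \<epsilon>) - 1 \<partial>(\<rho> \<Otimes>\<^sub>M \<sigma>))"

definition entropic_potentials ::
  "('a::topological_space \<Rightarrow> 'a \<Rightarrow> real) \<Rightarrow> real \<Rightarrow> 'a measure \<Rightarrow> 'a measure \<Rightarrow>
   ('a \<Rightarrow> real) \<Rightarrow> ('a \<Rightarrow> real) \<Rightarrow> bool" where
  "entropic_potentials c \<epsilon> \<rho> \<sigma> \<alpha> \<beta> \<longleftrightarrow>
     continuous_on UNIV \<alpha> \<and> continuous_on UNIV \<beta> \<and>
     (\<forall>\<alpha>' \<beta>'. continuous_on UNIV \<alpha>' \<and> continuous_on UNIV \<beta>' \<longrightarrow>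
        entropic_dual c \<epsilon> \<rho> \<sigma> \<alpha>' \<beta>' \<le> entropic_dual c \<epsilon> \<rho> \<sigma> \<alpha> \<beta>) \<and>
     (\<forall>x. \<alpha> x = - \<epsilon> * ln (\<integral>y'. exp ((\<beta> y' - c x y') / \<epsilon>) \<partial>\<sigma>)) \<and>
     (\<forall>y. \<beta> y = - \<epsilon> * ln (\<integral>x'. exp ((\<alpha> x' - c x' y) / \<epsilon>) \<partial>\<rho>))"

text \<open>Potentials exist on a compact space and \<open>\<alpha>(x) + \<beta>(y)\<close> is unique, so this predicate
  determines the kernel.\<close>

definition entropic_kernel ::
  "('a::topological_space \<Rightarrow> 'a \<Rightarrow> real) \<Rightarrow> real \<Rightarrow> 'a measure \<Rightarrow> 'a measure \<Rightarrow>
   ('a \<Rightarrow> 'a \<Rightarrow> real) \<Rightarrow> bool" where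
  "entropic_kernel c \<epsilon> \<rho> \<sigma> k \<longleftrightarrow>
     (\<exists>\<alpha> \<beta>. entropic_potentials c \<epsilon> \<rho> \<sigma> \<alpha> \<beta> \<and>
            k = (\<lambda>x y. exp ((\<alpha> x + \<beta> y - c x y) / \<epsilon>)))"

text \<open>Elements of \<open>L\<^sup>2\<close> are handled through representatives: an operator acts on square integrable
  functions, and its values matter only up to almost everywhere equality.\<close>

definition L2_fun :: "'b measure \<Rightarrow> ('b \<Rightarrow> real) set" where
  "L2_fun M = {u \<in> borel_measurable M. integrable M (\<lambda>x. (u x)\<^sup>2)}"

definition L2_inner :: "'b measure \<Rightarrow> ('b \<Rightarrow> real) \<Rightarrow> ('b \<Rightarrow> real) \<Rightarrow> real" where
  "L2_inner M u v = (\<integral>x. u x * v x \<partial>M)"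

definition L2_norm :: "'b measure \<Rightarrow> ('b \<Rightarrow> real) \<Rightarrow> real" where
  "L2_norm M u = sqrt (\<integral>x. (u x)\<^sup>2 \<partial>M)"

definition L2_operator ::
  "'a measure \<Rightarrow> 'b measure \<Rightarrow> (('a \<Rightarrow> real) \<Rightarrow> 'b \<Rightarrow> real) \<Rightarrow> bool" where
  "L2_operator M K T \<longleftrightarrow>
     (\<forall>u\<in>L2_fun M. T u \<in> L2_fun K) \<and>
     (\<forall>u\<in>L2_fun M. \<forall>v\<in>L2_fun M. \<forall>a b.
        AE y in K. T (\<lambda>x. a * u x + b * v x) y = a * T u y + b * T v y) \<and>
     (\<exists>B. \<forall>u\<in>L2_fun M. L2_norm K (T u) \<le> B * L2_norm M u)"

definition L2_adjoint ::
  "'a measure \<Rightarrow> 'b measure \<Rightarrow> (('a \<Rightarrow> real) \<Rightarrow> 'b \<Rightarrow> real) \<Rightarrow>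
   (('b \<Rightarrow> real) \<Rightarrow> 'a \<Rightarrow> real) \<Rightarrow> bool" where
  "L2_adjoint M K T S \<longleftrightarrow>
     (\<forall>v\<in>L2_fun K. S v \<in> L2_fun M \<and>
        (\<forall>u\<in>L2_fun M. L2_inner M u (S v) = L2_inner K (T u) v))"

definition orthonormal_basis :: "'b measure \<Rightarrow> ('b \<Rightarrow> real) set \<Rightarrow> bool" where
  "orthonormal_basis M E \<longleftrightarrow>
     E \<subseteq> L2_fun M \<and>
     (\<forall>e\<in>E. \<forall>f\<in>E. L2_inner M e f = (if e = f then 1 else 0)) \<and>
     (\<forall>u\<in>L2_fun M. \<forall>r>0. \<exists>F a. finite F \<and> F \<subseteq> E \<and>
        L2_norm M (\<lambda>x. u x - (\<Sum>e\<in>F. a e * e x)) < r)"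

definition hilbert_schmidt ::
  "'a measure \<Rightarrow> 'b measure \<Rightarrow> (('a \<Rightarrow> real) \<Rightarrow> 'b \<Rightarrow> real) \<Rightarrow> bool" where
  "hilbert_schmidt M K T \<longleftrightarrow>
     L2_operator M K T \<and>
     (\<exists>E. orthonormal_basis M E \<and> (\<lambda>e. (L2_norm K (T e))\<^sup>2) summable_on E)"

text \<open>For a Hilbert--Schmidt operator the value does not depend on the chosen basis.\<close>

definition hs_norm ::
  "'a measure \<Rightarrow> 'b measure \<Rightarrow> (('a \<Rightarrow> real) \<Rightarrow> 'b \<Rightarrow> real) \<Rightarrow> real" where
  "hs_norm M K T =
     sqrt (\<Sum>\<^sub>\<infinity>e\<in>(SOME E. orthonormal_basis M E). (L2_norm K (T e))\<^sup>2)"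

definition integral_operator ::
  "'a measure \<Rightarrow> ('a \<Rightarrow> 'b \<Rightarrow> real) \<Rightarrow> ('a \<Rightarrow> real) \<Rightarrow> 'b \<Rightarrow> real" where
  "integral_operator M k u = (\<lambda>y. \<integral>x. u x * k x y \<partial>M)"

text \<open>The operator induced by a plan \<open>\<gamma>\<close> from \<open>\<rho>\<close> to \<open>\<sigma>\<close>; \<open>T u\<close> is determined up to \<open>\<sigma>\<close>-null sets.\<close>

definition plan_operator ::
  "'a measure \<Rightarrow> 'b measure \<Rightarrow> ('a \<times> 'b) measure \<Rightarrow>
   (('a \<Rightarrow> real) \<Rightarrow> 'b \<Rightarrow> real) \<Rightarrow> bool" where
  "plan_operator \<rho> \<sigma> \<gamma> T \<longleftrightarrow>
     (\<forall>u\<in>L2_fun \<rho>. T u \<in> L2_fun \<sigma> \<and>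
        (\<forall>v\<in>L2_fun \<sigma>. (\<integral>x'. T u x' * v x' \<partial>\<sigma>) = (\<integral>(x, x'). u x * v x' \<partial>\<gamma>)))"

definition iid_sample ::
  "'w measure \<Rightarrow> nat \<Rightarrow> (nat \<Rightarrow> 'w \<Rightarrow> 'b) \<Rightarrow> 'b::topological_space measure \<Rightarrow> bool" where
  "iid_sample P N Z \<rho> \<longleftrightarrow>
     prob_space P \<and> prob_space.indep_vars P (\<lambda>_. borel) Z {..<N} \<and>
     (\<forall>i<N. distr P borel (Z i) = \<rho>)"

definition empirical_measure :: "nat \<Rightarrow> (nat \<Rightarrow> 'b::topological_space) \<Rightarrow> 'b measure" where
  "empirical_measure N z = distr (uniform_count_measure {..<N}) borel z"

definition t_kernel ::
  "('a \<Rightarrow> 'a \<Rightarrow> real) \<Rightarrow> ('a \<Rightarrow> 'a \<Rightarrow> real) \<Rightarrow> ('a \<times> 'a) measure \<Rightarrow> 'a \<Rightarrow> 'a \<Rightarrow> real" where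
  "t_kernel k\<mu> k\<nu> \<pi>N x y = (\<integral>(x', y'). k\<mu> x x' * k\<nu> y' y \<partial>\<pi>N)"

definition tA_kernel ::
  "('a \<Rightarrow> 'a measure) \<Rightarrow> ('a \<Rightarrow> 'a measure) \<Rightarrow> ('a \<Rightarrow> 'a \<Rightarrow> real) \<Rightarrow> 'a \<Rightarrow> 'a \<Rightarrow> real" where
  "tA_kernel \<kappa>\<mu> \<kappa>\<nu> t x y = (\<integral>x'. (\<integral>y'. t x' y' \<partial>\<kappa>\<nu> y) \<partial>\<kappa>\<mu> x)"

end

theory Submission
  imports Defs
begin

text \<open>
  Write \<open>x\<^sub>i, y\<^sub>i\<close> for the coordinates of the sample, \<open>f\<^sub>i = k\<^sub>\<mu>(\<cdot>, x\<^sub>i)\<close> and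
  \<open>g\<^sub>i = k\<^sub>\<nu>(y\<^sub>i, \<cdot>)\<close>. Integration against \<open>\<pi>\<^sub>N\<close> is a finite average, so
  \<open>t(x, y) = (1/N) \<Sum> f\<^sub>i(x) g\<^sub>i(y)\<close> has finite rank. Passing to \<open>t\<^sup>A\<close> replaces \<open>f\<^sub>i\<close> and
  \<open>g\<^sub>i\<close> by their averages \<open>F\<^sub>i\<close>, \<open>G\<^sub>i\<close> over the conditional laws of the transport plans, and the
  composition of operators does the same (\<open>composed_operator_AE\<close>). Thus the operator difference is the finite
  rank operator with kernel \<open>t\<^sup>A - t\<close>, and Parseval's identity identifies its Hilbert--Schmidt norm with the
  \<open>L\<^sup>2\<close> norm of the kernel (\<open>finite_rank_hilbert_schmidt\<close>). This requires an orthonormal basis of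
  \<open>L\<^sup>2(\<mu>)\<close>, which Gram--Schmidt produces from the indicators of a countable generator of the Borel sets
  (\<open>orthonormal_basis_exists\<close>).

  The estimate rests on the ball masses of the empirical marginals. By the Schroedinger equations an entropic
  self-transport kernel averages to one in each variable, and its logarithm is Lipschitz with constant
  \<open>2 L / \<epsilon>\<close>. If every ball of radius \<open>\<epsilon>\<close> around a sample point has empirical mass at least
  \<open>m\<close>, then \<open>f\<^sub>i\<close> and \<open>g\<^sub>i\<close> are bounded by \<open>e\<^bsup>2L\<^esup> / m\<close> and are Lipschitz with constant
  \<open>A = 2 L e\<^bsup>2L\<^esup> / (\<epsilon> m)\<close> (\<open>schroedinger.k_bound\<close>, \<open>schroedinger.k_lipschitz\<close>). Hence
  \<open>\<bar>F\<^sub>i(x) - f\<^sub>i(x)\<bar>\<close> is at most \<open>A\<close> times the root mean square distance that the plan moves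
  \<open>x\<close>. Telescoping through \<open>(1/N) \<Sum> f\<^sub>i G\<^sub>i\<close>, with \<open>(1/N) \<Sum> f\<^sub>i = (1/N) \<Sum> G\<^sub>i = 1\<close>, bounds
  \<open>t\<^sup>A - t\<close> pointwise, and the squares of the displacements integrate to the squared Wasserstein distances
  (\<open>kernel_deviation\<close>, \<open>kernel_deviation_L2\<close>).

  With \<open>m = C \<epsilon>\<^sup>D / 2\<close> the mass condition holds with the required probability: conditionally on
  \<open>x\<^sub>i\<close>, the number of other sample points near \<open>x\<^sub>i\<close> is a sum of independent indicators, so
  Hoeffding's inequality applies, and a union bound over the \<open>2 N\<close> coordinates of the sample concludes
  (\<open>ball_count_lower_tail\<close>, \<open>ball_counts_lower_tail\<close>).
\<close>

section \<open>The inner product calculus of square integrable functions\<close>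

lemma L2_funD:
  assumes "u \<in> L2_fun M"
  shows "u \<in> borel_measurable M" "integrable M (\<lambda>x. (u x)\<^sup>2)"
  using assms by (auto simp: L2_fun_def)

lemma integrable_L2_mult:
  assumes "u \<in> L2_fun M" "v \<in> L2_fun M"
  shows "integrable M (\<lambda>x. u x * v x)"
proof (rule Bochner_Integration.integrable_bound[where f = "\<lambda>x. (u x)\<^sup>2 + (v x)\<^sup>2"])
  show "integrable M (\<lambda>x. (u x)\<^sup>2 + (v x)\<^sup>2)" "(\<lambda>x. u x * v x) \<in> borel_measurable M"
    using L2_funD[OF assms(1)] L2_funD[OF assms(2)] by auto
  have "\<bar>a * b\<bar> \<le> a\<^sup>2 + b\<^sup>2" for a b :: real
  proof -
    have "2 * \<bar>a\<bar> * \<bar>b\<bar> \<le> \<bar>a\<bar>\<^sup>2 + \<bar>b\<bar>\<^sup>2"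
      by (rule sum_squares_bound)
    moreover have "0 \<le> \<bar>a\<bar> * \<bar>b\<bar>"
      by simp
    ultimately show ?thesis
      unfolding abs_mult power2_abs by linarith
  qed
  then show "AE x in M. norm (u x * v x) \<le> norm ((u x)\<^sup>2 + (v x)\<^sup>2)"
    by simp
qed

lemma L2_fun_add:
  assumes "u \<in> L2_fun M" "v \<in> L2_fun M"
  shows "(\<lambda>x. u x + v x) \<in> L2_fun M"
  using L2_funD[OF assms(1)] L2_funD[OF assms(2)] integrable_L2_mult[OF assms]
  unfolding L2_fun_def by (auto simp: power2_sum mult.assoc)

lemma L2_fun_scale:
  assumes "u \<in> L2_fun M"
  shows "(\<lambda>x. a * u x) \<in> L2_fun M"
  using L2_funD[OF assms] unfolding L2_fun_def by (auto simp: power_mult_distrib)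

lemma L2_fun_diff:
  assumes "u \<in> L2_fun M" "v \<in> L2_fun M"
  shows "(\<lambda>x. u x - v x) \<in> L2_fun M"
  using L2_fun_add[OF assms(1) L2_fun_scale[OF assms(2), of "-1"]] by simp

lemma L2_fun_zero: "(\<lambda>x. 0) \<in> L2_fun M"
  by (simp add: L2_fun_def)

lemma L2_fun_sum:
  assumes "\<And>i. i \<in> I \<Longrightarrow> f i \<in> L2_fun M"
  shows "(\<lambda>x. \<Sum>i\<in>I. f i x) \<in> L2_fun M"
  using assms
  by (induction I rule: infinite_finite_induct) (auto intro: L2_fun_add L2_fun_zero)

lemma L2_fun_lincomb:
  assumes "\<And>i. i \<in> I \<Longrightarrow> f i \<in> L2_fun M"
  shows "(\<lambda>x. \<Sum>i\<in>I. a i * f i x) \<in> L2_fun M"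
  by (intro L2_fun_sum L2_fun_scale assms)

lemma L2_fun_bounded:
  assumes "finite_measure M" "u \<in> borel_measurable M" "\<And>x. \<bar>u x\<bar> \<le> B"
  shows "u \<in> L2_fun M"
proof -
  interpret finite_measure M by fact
  have "(u x)\<^sup>2 \<le> B\<^sup>2" for x
    using assms(3)[of x] by (metis abs_le_square_iff abs_of_nonneg abs_ge_zero order.trans)
  then have "integrable M (\<lambda>x. (u x)\<^sup>2)"
    using assms(2) by (intro integrable_const_bound[where B = "B\<^sup>2"]) auto
  with assms(2) show ?thesis by (simp add: L2_fun_def)
qed

lemma L2_inner_commute: "L2_inner M u v = L2_inner M v u"
  by (simp add: L2_inner_def mult.commute)

lemma L2_inner_add_left:
  assumes "u \<in> L2_fun M" "v \<in> L2_fun M" "w \<in> L2_fun M"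
  shows "L2_inner M (\<lambda>x. u x + v x) w = L2_inner M u w + L2_inner M v w"
  using assms by (simp add: L2_inner_def distrib_right integrable_L2_mult)

lemma L2_inner_scale_left: "L2_inner M (\<lambda>x. a * u x) w = a * L2_inner M u w"
  by (simp add: L2_inner_def mult.assoc)

lemma L2_inner_diff_left:
  assumes "u \<in> L2_fun M" "v \<in> L2_fun M" "w \<in> L2_fun M"
  shows "L2_inner M (\<lambda>x. u x - v x) w = L2_inner M u w - L2_inner M v w"
  using assms by (simp add: L2_inner_def left_diff_distrib integrable_L2_mult)

lemma L2_inner_lincomb_left:
  assumes "\<And>i. i \<in> I \<Longrightarrow> f i \<in> L2_fun M" "w \<in> L2_fun M"
  shows "L2_inner M (\<lambda>x. \<Sum>i\<in>I. a i * f i x) w = (\<Sum>i\<in>I. a i * L2_inner M (f i) w)"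
proof -
  have "integrable M (\<lambda>x. a i * (f i x * w x))" if "i \<in> I" for i
    using assms that by (intro integrable_mult_right integrable_L2_mult) auto
  then show ?thesis
    by (simp add: L2_inner_def sum_distrib_right mult.assoc Bochner_Integration.integral_sum)
qed

lemma L2_inner_lincomb_right:
  assumes "\<And>i. i \<in> I \<Longrightarrow> f i \<in> L2_fun M" "w \<in> L2_fun M"
  shows "L2_inner M w (\<lambda>x. \<Sum>i\<in>I. a i * f i x) = (\<Sum>i\<in>I. a i * L2_inner M w (f i))"
  using L2_inner_lincomb_left[OF assms] by (simp add: L2_inner_commute)

lemma L2_inner_add_right:
  assumes "u \<in> L2_fun M" "v \<in> L2_fun M" "w \<in> L2_fun M"
  shows "L2_inner M w (\<lambda>x. u x + v x) = L2_inner M w u + L2_inner M w v"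
  using L2_inner_add_left[OF assms] by (simp add: L2_inner_commute)

lemma L2_inner_diff_right:
  assumes "u \<in> L2_fun M" "v \<in> L2_fun M" "w \<in> L2_fun M"
  shows "L2_inner M w (\<lambda>x. u x - v x) = L2_inner M w u - L2_inner M w v"
  using L2_inner_diff_left[OF assms] by (simp add: L2_inner_commute)

lemma L2_inner_scale_right: "L2_inner M w (\<lambda>x. a * u x) = a * L2_inner M w u"
  by (simp add: L2_inner_def mult.left_commute)

lemma L2_norm_sq: "(L2_norm M u)\<^sup>2 = L2_inner M u u"
  by (simp add: L2_norm_def L2_inner_def power2_eq_square[symmetric])

lemma L2_norm_nonneg [simp]: "0 \<le> L2_norm M u"
  by (simp add: L2_norm_def)

lemma L2_norm_scale: "L2_norm M (\<lambda>x. a * u x) = \<bar>a\<bar> * L2_norm M u"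
  by (simp add: L2_norm_def power_mult_distrib real_sqrt_mult)

lemma L2_norm_add_sq:
  assumes "u \<in> L2_fun M" "v \<in> L2_fun M"
  shows "(L2_norm M (\<lambda>x. u x + v x))\<^sup>2 = (L2_norm M u)\<^sup>2 + 2 * L2_inner M u v + (L2_norm M v)\<^sup>2"
  using assms
  by (simp add: L2_norm_sq L2_inner_add_left L2_inner_add_right L2_fun_add L2_inner_commute[of M v u])

lemma L2_Cauchy_Schwarz:
  assumes u: "u \<in> L2_fun M" and v: "v \<in> L2_fun M"
  shows "\<bar>L2_inner M u v\<bar> \<le> L2_norm M u * L2_norm M v"
proof -
  define a b c where "a = L2_norm M u" and "b = L2_norm M v" and "c = L2_inner M u v"
  \<comment> \<open>Nonnegativity of the quadratic form \<open>\<parallel>s u + r v\<parallel>\<^sup>2\<close> in both \<open>s\<close> and \<open>r\<close> also covers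
    the case that \<open>v\<close> vanishes almost everywhere.\<close>
  have q: "0 \<le> s\<^sup>2 * a\<^sup>2 + 2 * s * r * c + r\<^sup>2 * b\<^sup>2" for s r
  proof -
    have "(L2_norm M (\<lambda>x. s * u x + r * v x))\<^sup>2 = s\<^sup>2 * a\<^sup>2 + 2 * s * r * c + r\<^sup>2 * b\<^sup>2"
      using L2_norm_add_sq[OF L2_fun_scale[OF u, of s] L2_fun_scale[OF v, of r]]
      by (simp add: L2_norm_scale L2_inner_scale_left L2_inner_scale_right power_mult_distrib
          a_def b_def c_def)
    then show ?thesis by (metis zero_le_power2)
  qed
  have "c\<^sup>2 \<le> a\<^sup>2 * b\<^sup>2"
  proof (cases "b = 0")
    case True
    show ?thesis
    proof (rule ccontr)
      assume "\<not> ?thesis"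
      then have c: "c \<noteq> 0" using True by auto
      have "0 \<le> a\<^sup>2 + 2 * (- (a\<^sup>2 + 1) / (2 * c)) * c"
        using q[of 1 "- (a\<^sup>2 + 1) / (2 * c)"] True by simp
      with c show False by (simp add: field_simps)
    qed
  next
    case False
    have "0 \<le> b\<^sup>2 * (a\<^sup>2 * b\<^sup>2 - c\<^sup>2)"
      using q[of "b\<^sup>2" "- c"] by (simp add: algebra_simps power2_eq_square)
    then show ?thesis using False by (simp add: zero_le_mult_iff)
  qed
  then have "\<bar>c\<bar> \<le> \<bar>a * b\<bar>"
    by (simp add: abs_le_square_iff power_mult_distrib)
  then show ?thesis
    by (simp add: a_def b_def c_def abs_mult)
qed

lemma L2_norm_triangle:
  assumes u: "u \<in> L2_fun M" and v: "v \<in> L2_fun M"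
  shows "L2_norm M (\<lambda>x. u x + v x) \<le> L2_norm M u + L2_norm M v"
proof (rule power2_le_imp_le)
  show "(L2_norm M (\<lambda>x. u x + v x))\<^sup>2 \<le> (L2_norm M u + L2_norm M v)\<^sup>2"
    using L2_Cauchy_Schwarz[OF u v] by (simp add: L2_norm_add_sq[OF u v] power2_sum)
qed simp

lemma L2_norm_lincomb_le:
  assumes "finite I" "\<And>i. i \<in> I \<Longrightarrow> f i \<in> L2_fun M"
  shows "L2_norm M (\<lambda>x. \<Sum>i\<in>I. a i * f i x) \<le> (\<Sum>i\<in>I. \<bar>a i\<bar> * L2_norm M (f i))"
  using assms
proof (induction I rule: finite_induct)
  case empty
  show ?case by (simp add: L2_norm_def)
next
  case (insert i I)
  have "L2_norm M (\<lambda>x. a i * f i x + (\<Sum>i\<in>I. a i * f i x))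
      \<le> L2_norm M (\<lambda>x. a i * f i x) + L2_norm M (\<lambda>x. \<Sum>i\<in>I. a i * f i x)"
    using insert.prems by (intro L2_norm_triangle L2_fun_scale L2_fun_lincomb) auto
  with insert show ?case
    by (simp add: L2_norm_scale)
qed

lemma L2_norm_cong_AE:
  assumes "AE x in M. u x = v x" "u \<in> borel_measurable M" "v \<in> borel_measurable M"
  shows "L2_norm M u = L2_norm M v"
  unfolding L2_norm_def using assms
  by (intro arg_cong[where f = sqrt] integral_cong_AE) auto

lemma L2_fun_cong_AE:
  assumes "AE x in M. u x = v x" "u \<in> L2_fun M" "v \<in> borel_measurable M"
  shows "v \<in> L2_fun M"
proof -
  have "integrable M (\<lambda>x. (v x)\<^sup>2) \<longleftrightarrow> integrable M (\<lambda>x. (u x)\<^sup>2)"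
    using assms L2_funD[OF assms(2)] by (intro integrable_cong_AE) auto
  with assms L2_funD[OF assms(2)] show ?thesis by (simp add: L2_fun_def)
qed

text \<open>Testing the difference of two functions against itself shows that a square integrable
  function is determined almost everywhere by its inner products.\<close>

lemma L2_eq_AE_if_inner_eq:
  assumes u: "u \<in> L2_fun M" and v: "v \<in> L2_fun M"
    and eq: "\<And>w. w \<in> L2_fun M \<Longrightarrow> L2_inner M w u = L2_inner M w v"
  shows "AE x in M. u x = v x"
proof -
  let ?d = "\<lambda>x. u x - v x"
  have d: "?d \<in> L2_fun M" by (rule L2_fun_diff[OF u v])
  have "L2_inner M ?d ?d = 0"
    using eq[OF d] L2_inner_diff_right[OF u v d] by simp
  then have "(\<integral>x. (?d x)\<^sup>2 \<partial>M) = 0"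
    by (simp add: L2_inner_def power2_eq_square)
  then have "AE x in M. (?d x)\<^sup>2 = 0"
    using L2_funD(2)[OF d] by (subst (asm) integral_nonneg_eq_0_iff_AE) auto
  then show ?thesis by auto
qed

lemma L2_norm_dominated_convergence:
  assumes w: "w \<in> L2_fun M"
    and s: "\<And>n. s n \<in> borel_measurable M" and u: "u \<in> borel_measurable M"
    and lim: "\<And>x. x \<in> space M \<Longrightarrow> (\<lambda>n. s n x) \<longlonglongrightarrow> u x"
    and bd: "\<And>n x. x \<in> space M \<Longrightarrow> \<bar>u x - s n x\<bar> \<le> w x"
  shows "(\<lambda>n. L2_norm M (\<lambda>x. u x - s n x)) \<longlonglongrightarrow> 0"
proof -
  have "(\<lambda>n. \<integral>x. (u x - s n x)\<^sup>2 \<partial>M) \<longlonglongrightarrow> (\<integral>x. 0 \<partial>M)"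
  proof (rule integral_dominated_convergence[where w = "\<lambda>x. (w x)\<^sup>2"])
    show "AE x in M. (\<lambda>n. (u x - s n x)\<^sup>2) \<longlonglongrightarrow> 0"
    proof (rule AE_I2)
      fix x assume "x \<in> space M"
      then have "(\<lambda>n. (u x - s n x)\<^sup>2) \<longlonglongrightarrow> (u x - u x)\<^sup>2"
        by (intro tendsto_intros lim)
      then show "(\<lambda>n. (u x - s n x)\<^sup>2) \<longlonglongrightarrow> 0" by simp
    qed
    show "AE x in M. norm ((u x - s n x)\<^sup>2) \<le> (w x)\<^sup>2" for n
    proof (rule AE_I2)
      fix x assume "x \<in> space M"
      then have "\<bar>u x - s n x\<bar>\<^sup>2 \<le> (w x)\<^sup>2"
        by (intro power_mono bd) auto
      then show "norm ((u x - s n x)\<^sup>2) \<le> (w x)\<^sup>2" by simp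
    qed
  qed (use s u L2_funD[OF w] in auto)
  then have "(\<lambda>n. sqrt (\<integral>x. (u x - s n x)\<^sup>2 \<partial>M)) \<longlonglongrightarrow> sqrt 0"
    by (intro tendsto_real_sqrt) simp
  then show ?thesis by (simp add: L2_norm_def)
qed

section \<open>Orthonormal systems, Bessel and Parseval\<close>

definition orthonormal :: "'b measure \<Rightarrow> ('b \<Rightarrow> real) set \<Rightarrow> bool" where
  "orthonormal M E \<longleftrightarrow>
     E \<subseteq> L2_fun M \<and> (\<forall>e\<in>E. \<forall>f\<in>E. L2_inner M e f = (if e = f then 1 else 0))"

definition residual :: "'b measure \<Rightarrow> ('b \<Rightarrow> real) set \<Rightarrow> ('b \<Rightarrow> real) \<Rightarrow> 'b \<Rightarrow> real" where
  "residual M F u = (\<lambda>x. u x - (\<Sum>e\<in>F. L2_inner M e u * e x))"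

lemma orthonormal_subset: "orthonormal M E \<Longrightarrow> F \<subseteq> E \<Longrightarrow> orthonormal M F"
  unfolding orthonormal_def by blast

lemma orthonormalD:
  assumes "orthonormal M E" "e \<in> E"
  shows "e \<in> L2_fun M"
  using assms by (auto simp: orthonormal_def)

lemma residual_L2:
  assumes "orthonormal M F" "u \<in> L2_fun M"
  shows "residual M F u \<in> L2_fun M"
  unfolding residual_def using assms
  by (intro L2_fun_diff L2_fun_lincomb) (auto dest: orthonormalD)

lemma residual_orthogonal:
  assumes F: "orthonormal M F" "finite F" and u: "u \<in> L2_fun M" and e: "e \<in> F"
  shows "L2_inner M e (residual M F u) = 0"
proof -
  have "L2_inner M e (residual M F u) = L2_inner M e u - (\<Sum>f\<in>F. L2_inner M f u * L2_inner M e f)"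
    unfolding residual_def using F e u
    by (subst L2_inner_diff_right)
       (auto dest: orthonormalD intro!: L2_fun_lincomb L2_inner_lincomb_right)
  also have "(\<Sum>f\<in>F. L2_inner M f u * L2_inner M e f) = (\<Sum>f\<in>F. if e = f then L2_inner M f u else 0)"
    using F e by (intro sum.cong) (auto simp: orthonormal_def)
  finally show ?thesis using F e by simp
qed

text \<open>The residual is orthogonal to the span of \<open>F\<close>, so by Pythagoras it realises the distance
  from \<open>u\<close> to that span.\<close>

lemma norm_lincomb_distance:
  assumes F: "orthonormal M F" "finite F" and u: "u \<in> L2_fun M"
  shows "(L2_norm M (\<lambda>x. u x - (\<Sum>e\<in>F. a e * e x)))\<^sup>2
    = (L2_norm M (residual M F u))\<^sup>2 + (\<Sum>e\<in>F. (L2_inner M e u - a e)\<^sup>2)"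
proof -
  define b where "b e = L2_inner M e u - a e" for e
  let ?q = "\<lambda>x. \<Sum>e\<in>F. b e * e x"
  have L: "e \<in> L2_fun M" if "e \<in> F" for e using F(1) that by (rule orthonormalD)
  have q: "?q \<in> L2_fun M" by (intro L2_fun_lincomb L)
  have r: "residual M F u \<in> L2_fun M" by (rule residual_L2[OF F(1) u])
  have "(\<lambda>x. u x - (\<Sum>e\<in>F. a e * e x)) = (\<lambda>x. residual M F u x + ?q x)"
    by (simp add: residual_def b_def left_diff_distrib sum_subtractf)
  moreover have "L2_inner M (residual M F u) ?q = 0"
    using residual_orthogonal[OF F u] L r
    by (subst L2_inner_commute, subst L2_inner_lincomb_left) auto
  moreover have "(L2_norm M ?q)\<^sup>2 = (\<Sum>e\<in>F. (b e)\<^sup>2)"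
  proof -
    have "L2_inner M ?q ?q = (\<Sum>e\<in>F. b e * (\<Sum>f\<in>F. b f * L2_inner M e f))"
      using L q by (simp add: L2_inner_lincomb_left L2_inner_lincomb_right)
    also have "\<dots> = (\<Sum>e\<in>F. b e * (\<Sum>f\<in>F. if e = f then b f else 0))"
      using F(1) by (intro sum.cong refl arg_cong2[where f = "(*)"]) (auto simp: orthonormal_def)
    finally show ?thesis using F(2) by (simp add: L2_norm_sq flip: power2_eq_square)
  qed
  ultimately show ?thesis
    using L2_norm_add_sq[OF r q] by (simp add: b_def)
qed

lemma residual_norm_sq:
  assumes F: "orthonormal M F" "finite F" and u: "u \<in> L2_fun M"
  shows "(L2_norm M (residual M F u))\<^sup>2 = (L2_norm M u)\<^sup>2 - (\<Sum>e\<in>F. (L2_inner M e u)\<^sup>2)"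
  using norm_lincomb_distance[OF F u, of "\<lambda>_. 0"] by simp

lemma residual_norm_le_distance:
  assumes F: "orthonormal M F" "finite F" and u: "u \<in> L2_fun M"
  shows "L2_norm M (residual M F u) \<le> L2_norm M (\<lambda>x. u x - (\<Sum>e\<in>F. a e * e x))"
  by (rule power2_le_imp_le) (auto simp: norm_lincomb_distance[OF F u] sum_nonneg)

lemma residual_norm_mono:
  assumes "orthonormal M F'" "finite F'" "F \<subseteq> F'" and u: "u \<in> L2_fun M"
  shows "L2_norm M (residual M F' u) \<le> L2_norm M (residual M F u)"
proof (rule power2_le_imp_le)
  have F: "orthonormal M F" "finite F"
    using assms orthonormal_subset finite_subset by auto
  have "(\<Sum>e\<in>F. (L2_inner M e u)\<^sup>2) \<le> (\<Sum>e\<in>F'. (L2_inner M e u)\<^sup>2)"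
    using assms by (intro sum_mono2) auto
  then show "(L2_norm M (residual M F' u))\<^sup>2 \<le> (L2_norm M (residual M F u))\<^sup>2"
    by (simp add: residual_norm_sq[OF assms(1,2) u] residual_norm_sq[OF F u])
qed simp

lemma residual_norm_le:
  assumes F: "orthonormal M F" "finite F" and u: "u \<in> L2_fun M"
  shows "L2_norm M (residual M F u) \<le> L2_norm M u"
  using residual_norm_le_distance[OF F u, of "\<lambda>_. 0"] by simp

lemma residual_add:
  assumes F: "orthonormal M F" and "u \<in> L2_fun M" "v \<in> L2_fun M"
  shows "residual M F (\<lambda>x. u x + v x) = (\<lambda>x. residual M F u x + residual M F v x)"
  using assms orthonormalD[OF F]
  by (auto simp: residual_def L2_inner_add_right distrib_right sum.distrib fun_eq_iff)

lemma residual_scale: "residual M F (\<lambda>x. a * u x) = (\<lambda>x. a * residual M F u x)"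
  by (simp add: residual_def L2_inner_scale_right right_diff_distrib sum_distrib_left mult.assoc)

text \<open>Membership in the closed span of an orthonormal system, expressed through residuals; in this
  form closure under sums only needs a common finite subsystem.\<close>

definition closed_span :: "'b measure \<Rightarrow> ('b \<Rightarrow> real) set \<Rightarrow> ('b \<Rightarrow> real) set" where
  "closed_span M E = {u \<in> L2_fun M. \<forall>r>0. \<exists>F. finite F \<and> F \<subseteq> E \<and> L2_norm M (residual M F u) < r}"

lemma closed_span_add:
  assumes E: "orthonormal M E" and u: "u \<in> closed_span M E" and v: "v \<in> closed_span M E"
  shows "(\<lambda>x. u x + v x) \<in> closed_span M E"
proof -
  have uL: "u \<in> L2_fun M" and vL: "v \<in> L2_fun M"
    using u v by (auto simp: closed_span_def)
  have "\<exists>F. finite F \<and> F \<subseteq> E \<and> L2_norm M (residual M F (\<lambda>x. u x + v x)) < r" if "r > 0" for r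
  proof -
    have "r / 2 > 0" using that by simp
    then obtain F G where F: "finite F" "F \<subseteq> E" "L2_norm M (residual M F u) < r / 2"
      and G: "finite G" "G \<subseteq> E" "L2_norm M (residual M G v) < r / 2"
      using u v unfolding closed_span_def by blast
    have FG: "orthonormal M (F \<union> G)" "finite (F \<union> G)"
      using F G E by (auto intro: orthonormal_subset)
    have "L2_norm M (residual M (F \<union> G) (\<lambda>x. u x + v x))
        \<le> L2_norm M (residual M (F \<union> G) u) + L2_norm M (residual M (F \<union> G) v)"
      unfolding residual_add[OF FG(1) uL vL]
      by (intro L2_norm_triangle residual_L2 FG uL vL)
    also have "\<dots> < r"
      using residual_norm_mono[OF FG, of F u] residual_norm_mono[OF FG, of G v] F(3) G(3) uL vL
      by auto
    finally show ?thesis using F G by (intro exI[of _ "F \<union> G"]) auto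
  qed
  then show ?thesis using uL vL by (auto simp: closed_span_def intro: L2_fun_add)
qed

lemma closed_span_scale:
  assumes u: "u \<in> closed_span M E"
  shows "(\<lambda>x. a * u x) \<in> closed_span M E"
proof -
  have "\<exists>F. finite F \<and> F \<subseteq> E \<and> L2_norm M (residual M F (\<lambda>x. a * u x)) < r" if "r > 0" for r
  proof -
    have "r / (\<bar>a\<bar> + 1) > 0" using that by simp
    then obtain F where F: "finite F" "F \<subseteq> E" "L2_norm M (residual M F u) < r / (\<bar>a\<bar> + 1)"
      using u unfolding closed_span_def by blast
    have "\<bar>a\<bar> * L2_norm M (residual M F u) \<le> (\<bar>a\<bar> + 1) * L2_norm M (residual M F u)"
      by (intro mult_right_mono) auto
    also have "\<dots> < r" using F(3) by (simp add: field_simps)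
    finally show ?thesis using F by (auto simp: residual_scale L2_norm_scale)
  qed
  then show ?thesis using u by (auto simp: closed_span_def intro: L2_fun_scale)
qed

lemma closed_span_zero: "(\<lambda>x. 0) \<in> closed_span M E"
  by (auto simp: closed_span_def L2_fun_zero residual_def L2_norm_def intro!: exI[of _ "{}"])

lemma closed_span_lincomb:
  assumes E: "orthonormal M E" and f: "\<And>i. i \<in> I \<Longrightarrow> f i \<in> closed_span M E"
  shows "(\<lambda>x. \<Sum>i\<in>I. a i * f i x) \<in> closed_span M E"
  using f
  by (induction I rule: infinite_finite_induct)
     (simp_all add: closed_span_zero closed_span_add[OF E] closed_span_scale)

text \<open>Residuals are 1-Lipschitz, so the closed span is closed under limits in the mean.\<close>

lemma closed_span_limit:
  assumes E: "orthonormal M E" and u: "u \<in> L2_fun M"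
    and s: "\<And>n. s n \<in> closed_span M E"
    and lim: "(\<lambda>n. L2_norm M (\<lambda>x. u x - s n x)) \<longlonglongrightarrow> 0"
  shows "u \<in> closed_span M E"
proof -
  have "\<exists>F. finite F \<and> F \<subseteq> E \<and> L2_norm M (residual M F u) < r" if r: "r > 0" for r
  proof -
    obtain n where n: "L2_norm M (\<lambda>x. u x - s n x) < r / 2"
      using order_tendstoD(2)[OF lim half_gt_zero[OF r]]
      unfolding eventually_sequentially by blast
    have sL: "s n \<in> L2_fun M" using s by (simp add: closed_span_def)
    have "r / 2 > 0" using r by simp
    then obtain F where F: "finite F" "F \<subseteq> E" "L2_norm M (residual M F (s n)) < r / 2"
      using s[of n] unfolding closed_span_def by blast
    have oF: "orthonormal M F" using E F(2) by (rule orthonormal_subset)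
    let ?d = "\<lambda>x. u x - s n x"
    have d: "?d \<in> L2_fun M" by (rule L2_fun_diff[OF u sL])
    have "residual M F u = (\<lambda>x. residual M F ?d x + residual M F (s n) x)"
      using residual_add[OF oF d sL] by simp
    then have "L2_norm M (residual M F u) \<le> L2_norm M (residual M F ?d) + L2_norm M (residual M F (s n))"
      by (auto intro: L2_norm_triangle residual_L2[OF oF] d sL)
    also have "\<dots> < r"
      using residual_norm_le[OF oF F(1) d] n F(3) by simp
    finally show ?thesis using F by blast
  qed
  then show ?thesis using u by (simp add: closed_span_def)
qed

text \<open>Approximability by arbitrary combinations is equivalent to approximability by orthogonal projections,
  since the projection is the best approximation from the span.\<close>

lemma orthonormal_basis_iff:
  "orthonormal_basis M E \<longleftrightarrow> orthonormal M E \<and> L2_fun M \<subseteq> closed_span M E"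
proof
  assume b: "orthonormal_basis M E"
  then have o: "orthonormal M E" unfolding orthonormal_basis_def orthonormal_def by blast
  moreover have "u \<in> closed_span M E" if u: "u \<in> L2_fun M" for u
  proof -
    have "\<exists>F. finite F \<and> F \<subseteq> E \<and> L2_norm M (residual M F u) < r" if r: "r > 0" for r
    proof -
      obtain F a where F: "finite F" "F \<subseteq> E" "L2_norm M (\<lambda>x. u x - (\<Sum>e\<in>F. a e * e x)) < r"
        using b u r unfolding orthonormal_basis_def by blast
      have "L2_norm M (residual M F u) < r"
        using residual_norm_le_distance[OF orthonormal_subset[OF o F(2)] F(1) u, of a] F(3)
        by (rule le_less_trans)
      then show ?thesis using F(1,2) by blast
    qed
    then show ?thesis using u by (simp add: closed_span_def)
  qed
  ultimately show "orthonormal M E \<and> L2_fun M \<subseteq> closed_span M E" by blast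
next
  assume a: "orthonormal M E \<and> L2_fun M \<subseteq> closed_span M E"
  have "\<exists>F a. finite F \<and> F \<subseteq> E \<and> L2_norm M (\<lambda>x. u x - (\<Sum>e\<in>F. a e * e x)) < r"
    if u: "u \<in> L2_fun M" and r: "r > 0" for u r
  proof -
    have "u \<in> closed_span M E" using a u by blast
    then obtain F where "finite F" "F \<subseteq> E" "L2_norm M (residual M F u) < r"
      using r unfolding closed_span_def by blast
    then show ?thesis
      unfolding residual_def by (intro exI[of _ F] exI[of _ "\<lambda>e. L2_inner M e u"] conjI)
  qed
  then show "orthonormal_basis M E"
    using a unfolding orthonormal_basis_def orthonormal_def by blast
qed

text \<open>By Pythagoras the partial sums differ from \<open>\<parallel>u\<parallel>\<^sup>2\<close> by the squared norm of a residual, which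
  decreases along the finite subsets of the basis and comes arbitrarily close to zero.\<close>

lemma Parseval_norm:
  assumes b: "orthonormal_basis M E" and u: "u \<in> L2_fun M"
  shows "((\<lambda>e. (L2_inner M e u)\<^sup>2) has_sum (L2_norm M u)\<^sup>2) E"
  unfolding has_sum_def tendsto_iff eventually_finite_subsets_at_top
proof (intro allI impI)
  fix r :: real assume r: "r > 0"
  from b have o: "orthonormal M E" and d: "u \<in> closed_span M E"
    using u by (auto simp: orthonormal_basis_iff)
  have "sqrt r > 0" using r by simp
  then obtain F where F: "finite F" "F \<subseteq> E" "L2_norm M (residual M F u) < sqrt r"
    using d unfolding closed_span_def by blast
  have "dist (\<Sum>e\<in>G. (L2_inner M e u)\<^sup>2) ((L2_norm M u)\<^sup>2) < r"
    if G: "finite G" "F \<subseteq> G" "G \<subseteq> E" for G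
  proof -
    have oG: "orthonormal M G" using o G(3) by (rule orthonormal_subset)
    have "L2_norm M (residual M G u) < sqrt r"
      using residual_norm_mono[OF oG G(1,2) u] F(3) by simp
    then have "(L2_norm M (residual M G u))\<^sup>2 < (sqrt r)\<^sup>2"
      by (intro power_strict_mono) auto
    moreover have "0 \<le> (L2_norm M (residual M G u))\<^sup>2" by simp
    ultimately show ?thesis
      using r by (simp add: residual_norm_sq[OF oG G(1) u] dist_real_def)
  qed
  then show "\<exists>X. finite X \<and> X \<subseteq> E \<and> (\<forall>Y. finite Y \<and> X \<subseteq> Y \<and> Y \<subseteq> E \<longrightarrow>
      dist (\<Sum>e\<in>Y. (L2_inner M e u)\<^sup>2) ((L2_norm M u)\<^sup>2) < r)"
    using F by (intro exI[of _ F]) simp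
qed

text \<open>By polarisation, since both sides are quadratic in the pair of functions.\<close>

lemma Parseval_inner:
  assumes b: "orthonormal_basis M E" and u: "u \<in> L2_fun M" and v: "v \<in> L2_fun M"
  shows "((\<lambda>e. L2_inner M e u * L2_inner M e v) has_sum L2_inner M u v) E"
proof -
  have eL: "e \<in> L2_fun M" if "e \<in> E" for e
    using b that by (auto simp: orthonormal_basis_def)
  define p where "p e = (L2_inner M e (\<lambda>x. u x + v x))\<^sup>2" for e
  define q where "q e = - ((L2_inner M e u)\<^sup>2 + (L2_inner M e v)\<^sup>2)" for e
  have "(p has_sum (L2_norm M (\<lambda>x. u x + v x))\<^sup>2) E"
    unfolding p_def by (rule Parseval_norm[OF b L2_fun_add[OF u v]])
  moreover have "(q has_sum - ((L2_norm M u)\<^sup>2 + (L2_norm M v)\<^sup>2)) E"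
    unfolding q_def
    by (rule has_sum_uminusI[OF has_sum_add[OF Parseval_norm[OF b u] Parseval_norm[OF b v]]])
  ultimately have "((\<lambda>e. (p e + q e) / 2) has_sum
      ((L2_norm M (\<lambda>x. u x + v x))\<^sup>2 + - ((L2_norm M u)\<^sup>2 + (L2_norm M v)\<^sup>2)) / 2) E"
    by (rule has_sum_divide_const[OF has_sum_add])
  also have "((L2_norm M (\<lambda>x. u x + v x))\<^sup>2 + - ((L2_norm M u)\<^sup>2 + (L2_norm M v)\<^sup>2)) / 2 = L2_inner M u v"
    by (simp add: L2_norm_add_sq[OF u v])
  also have "((\<lambda>e. (p e + q e) / 2) has_sum L2_inner M u v) E
      \<longleftrightarrow> ((\<lambda>e. L2_inner M e u * L2_inner M e v) has_sum L2_inner M u v) E"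
    by (intro has_sum_cong) (simp add: p_def q_def L2_inner_add_right[OF u v eL] power2_sum)
  finally show ?thesis .
qed

section \<open>Existence of orthonormal bases over Borel measures\<close>

text \<open>A vector whose residual has norm zero is skipped, so that the system stays orthonormal even if
  the given sequence is linearly dependent modulo null sets.\<close>

primrec gram_schmidt :: "'b measure \<Rightarrow> (nat \<Rightarrow> 'b \<Rightarrow> real) \<Rightarrow> nat \<Rightarrow> ('b \<Rightarrow> real) set" where
  "gram_schmidt M s 0 = {}"
| "gram_schmidt M s (Suc n) =
     (let r = residual M (gram_schmidt M s n) (s n) in
      if L2_norm M r = 0 then gram_schmidt M s n
      else insert (\<lambda>x. inverse (L2_norm M r) * r x) (gram_schmidt M s n))"

text \<open>Enlarging an orthonormal system by the normalised residual of \<open>u\<close> absorbs \<open>u\<close> into the span.\<close>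

lemma gram_schmidt_step:
  assumes F: "orthonormal M F" "finite F" and u: "u \<in> L2_fun M"
    and nz: "L2_norm M (residual M F u) \<noteq> 0"
  defines "w \<equiv> (\<lambda>x. inverse (L2_norm M (residual M F u)) * residual M F u x)"
  shows "orthonormal M (insert w F)" "L2_norm M (residual M (insert w F) u) = 0"
proof -
  let ?r = "residual M F u"
  let ?n = "L2_norm M ?r"
  have r: "?r \<in> L2_fun M" by (rule residual_L2[OF F(1) u])
  have w: "w \<in> L2_fun M" unfolding w_def by (rule L2_fun_scale[OF r])
  have rr: "L2_inner M ?r ?r = ?n * ?n"
    by (simp add: L2_norm_sq[symmetric] power2_eq_square)
  have ww: "L2_inner M w w = 1"
    unfolding w_def L2_inner_scale_left L2_inner_scale_right rr using nz by (simp add: field_simps)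
  have ew: "L2_inner M e w = 0" if "e \<in> F" for e
    using residual_orthogonal[OF F u that] by (simp add: w_def L2_inner_scale_right)
  have we: "L2_inner M w e = 0" if "e \<in> F" for e
    using ew[OF that] by (simp add: L2_inner_commute)
  have wF: "w \<notin> F" using ew ww by force
  show o: "orthonormal M (insert w F)"
    using F(1) w ww ew we wF unfolding orthonormal_def by auto
  have ru: "L2_inner M ?r u = ?n * ?n"
  proof -
    let ?p = "\<lambda>x. \<Sum>e\<in>F. L2_inner M e u * e x"
    have p: "?p \<in> L2_fun M" by (intro L2_fun_lincomb orthonormalD[OF F(1)])
    have "L2_inner M ?r ?p = (\<Sum>e\<in>F. L2_inner M e u * L2_inner M ?r e)"
      by (rule L2_inner_lincomb_right[OF orthonormalD[OF F(1)] r])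
    also have "\<dots> = 0"
      using residual_orthogonal[OF F u] by (intro sum.neutral) (simp add: L2_inner_commute[of M ?r])
    finally have "L2_inner M ?r ?p = 0" .
    moreover have "L2_inner M ?r ?r = L2_inner M ?r u - L2_inner M ?r ?p"
      using L2_inner_diff_right[OF u p r] unfolding residual_def .
    ultimately show ?thesis using rr by simp
  qed
  have "L2_inner M w u = ?n"
    using nz by (simp add: w_def L2_inner_scale_left ru)
  then have "residual M (insert w F) u = (\<lambda>x. ?r x - ?n * w x)"
    using F(2) wF by (auto simp: residual_def fun_eq_iff)
  also have "\<dots> = (\<lambda>x. 0)"
    using nz by (auto simp: w_def fun_eq_iff)
  finally show "L2_norm M (residual M (insert w F) u) = 0"
    by (simp add: L2_norm_def)
qed

lemma gram_schmidt_orthonormal: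
  assumes "\<And>n. s n \<in> L2_fun M"
  shows "orthonormal M (gram_schmidt M s n) \<and> finite (gram_schmidt M s n)"
proof (induction n)
  case 0
  show ?case by (simp add: orthonormal_def)
next
  case (Suc n)
  then show ?case
    using gram_schmidt_step(1)[OF _ _ assms[of n], of "gram_schmidt M s n"] by (simp add: Let_def)
qed

lemma orthonormal_system_spanning_sequence:
  fixes s :: "nat \<Rightarrow> 'b \<Rightarrow> real"
  assumes s: "\<And>n. s n \<in> L2_fun M"
  obtains E where "orthonormal M E" "\<And>n. s n \<in> closed_span M E"
proof
  let ?F = "gram_schmidt M s"
  have F: "orthonormal M (?F n)" "finite (?F n)" for n
    using gram_schmidt_orthonormal[OF s] by auto
  have mono: "?F m \<subseteq> ?F n" if "m \<le> n" for m n
    by (rule lift_Suc_mono_le[OF _ that, of ?F]) (auto simp: Let_def)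
  show "orthonormal M (\<Union>n. ?F n)"
    unfolding orthonormal_def
  proof (intro conjI ballI)
    show "(\<Union>n. ?F n) \<subseteq> L2_fun M"
      using F(1) by (auto dest: orthonormalD)
    fix e f assume "e \<in> (\<Union>n. ?F n)" "f \<in> (\<Union>n. ?F n)"
    then obtain m n where "e \<in> ?F m" "f \<in> ?F n" by blast
    then have "e \<in> ?F (max m n)" "f \<in> ?F (max m n)"
      using mono[of m "max m n"] mono[of n "max m n"] by auto
    then show "L2_inner M e f = (if e = f then 1 else 0)"
      using F(1)[of "max m n"] unfolding orthonormal_def by blast
  qed
  fix n
  have "L2_norm M (residual M (?F (Suc n)) (s n)) = 0"
    using gram_schmidt_step(2)[OF F s, of n n] by (simp add: Let_def)
  then have "\<exists>F. finite F \<and> F \<subseteq> (\<Union>n. ?F n) \<and> L2_norm M (residual M F (s n)) < r" if "r > 0" for r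
    using F(2)[of "Suc n"] that by (intro exI[of _ "?F (Suc n)"]) (auto simp del: gram_schmidt.simps)
  then show "s n \<in> closed_span M (\<Union>n. ?F n)"
    using s by (simp add: closed_span_def)
qed

text \<open>Finite intersections of a countable topological basis form a countable generator that is suitable for
  Dynkin's argument.\<close>

lemma countable_Int_stable_generator_borel:
  obtains G :: "'a::second_countable_topology set set"
  where "countable G" "Int_stable G" "UNIV \<in> G" "sigma_sets UNIV G = sets borel"
proof -
  obtain B :: "'a set set" where B: "countable B" "topological_basis B"
    using ex_countable_basis by blast
  define G where "G = Inter ` {S. S \<subseteq> B \<and> finite S}"
  have "countable G"
    unfolding G_def using countable_Collect_finite_subset[OF B(1)]
    by (intro countable_image) (simp add: conj_commute)
  moreover have "Int_stable G"
  proof (rule Int_stableI)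
    fix a b assume "a \<in> G" "b \<in> G"
    then obtain S T where "S \<subseteq> B" "finite S" "a = \<Inter>S" "T \<subseteq> B" "finite T" "b = \<Inter>T"
      by (auto simp: G_def)
    then show "a \<inter> b \<in> G"
      unfolding G_def by (intro image_eqI[where x = "S \<union> T"]) auto
  qed
  moreover have "UNIV \<in> G"
    unfolding G_def by (intro image_eqI[where x = "{}"]) auto
  moreover have "sigma_sets UNIV G = sets borel"
  proof
    have "open U" if "U \<in> G" for U
      using that topological_basis_open[OF B(2)] by (auto simp: G_def intro!: open_Inter)
    then have "G \<subseteq> sets borel" by auto
    then show "sigma_sets UNIV G \<subseteq> sets borel"
      using sets.sigma_sets_subset[of G borel] by (simp only: space_borel)
    have "B \<subseteq> G"
    proof
      fix U assume "U \<in> B"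
      then show "U \<in> G" unfolding G_def by (intro image_eqI[where x = "{U}"]) auto
    qed
    then have "sigma_sets UNIV B \<subseteq> sigma_sets UNIV G"
      by (intro sigma_sets_mono') auto
    then show "sets borel \<subseteq> sigma_sets UNIV G"
      by (simp add: borel_eq_countable_basis[OF B])
  qed
  ultimately show ?thesis by (rule that)
qed

text \<open>A closed span containing the indicators of an intersection stable generator contains the
  indicators of the generated Dynkin system, hence of all Borel sets, hence all simple functions,
  hence everything.\<close>

lemma closed_span_total_if_generator:
  fixes M :: "'a::topological_space measure"
  assumes M: "finite_measure M" "sets M = sets borel"
    and G: "Int_stable G" "UNIV \<in> G" "sigma_sets UNIV G = sets borel"
    and E: "orthonormal M E" and ind: "\<And>A. A \<in> G \<Longrightarrow> (indicator A :: 'a \<Rightarrow> real) \<in> closed_span M E"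
  shows "L2_fun M \<subseteq> closed_span M E"
proof -
  interpret finite_measure M by fact
  have sp: "space M = UNIV" using sets_eq_imp_space_eq[OF M(2)] by simp
  have L: "(indicator A :: 'a \<Rightarrow> real) \<in> L2_fun M" if "A \<in> sets borel" for A
    using that M by (intro L2_fun_bounded[where B = 1]) (auto simp: indicator_def)
  have bor: "(indicator A :: 'a \<Rightarrow> real) \<in> closed_span M E" if A: "A \<in> sigma_sets UNIV G" for A
    using G(1) subset_UNIV[of G, folded Pow_UNIV] A
  proof (induction rule: sigma_sets_induct_disjoint)
    case (basic A)
    then show ?case by (rule ind)
  next
    case empty
    have "(indicator {} :: 'a \<Rightarrow> real) = (\<lambda>x. 0)" by (auto simp: fun_eq_iff)
    then show ?case using closed_span_zero by simp
  next
    case (compl A)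
    have "(indicator (UNIV - A) :: 'a \<Rightarrow> real) = (\<lambda>x. indicator UNIV x + (- 1) * indicator A x)"
      by (auto simp: fun_eq_iff indicator_def)
    then show ?case
      using closed_span_add[OF E ind[OF G(2)] closed_span_scale[OF compl(2), of "-1"]] by simp
  next
    case (union A)
    have A: "A i \<in> sets borel" for i using union(2) G(3) by auto
    have sum: "(indicator (\<Union>i<n. A i) :: 'a \<Rightarrow> real) = (\<lambda>x. \<Sum>i<n. 1 * indicator (A i) x)" for n
    proof -
      have "disjoint_family_on A {..<n}"
        using union(1) by (rule disjoint_family_on_mono[OF subset_UNIV])
      then show ?thesis by (simp add: fun_eq_iff indicator_UN_disjoint)
    qed
    show ?case
    proof (rule closed_span_limit[OF E])
      show "(indicator (\<Union> (range A)) :: 'a \<Rightarrow> real) \<in> L2_fun M"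
        using A by (intro L) auto
      show "(indicator (\<Union>i<n. A i) :: 'a \<Rightarrow> real) \<in> closed_span M E" for n
        unfolding sum using union(3) by (intro closed_span_lincomb[OF E]) auto
      show "(\<lambda>n. L2_norm M (\<lambda>x. indicator (\<Union> (range A)) x - indicator (\<Union>i<n. A i) x)) \<longlonglongrightarrow> 0"
      proof (rule L2_norm_dominated_convergence[where w = "indicator UNIV"])
        show "(indicator UNIV :: 'a \<Rightarrow> real) \<in> L2_fun M" by (rule L) simp
        show "(\<lambda>n. indicator (\<Union>i<n. A i) x :: real) \<longlonglongrightarrow> indicator (\<Union> (range A)) x" for x
          by (rule LIMSEQ_indicator_UN)
        show "\<bar>indicator (\<Union> (range A)) x - indicator (\<Union>i<n. A i) x\<bar> \<le> (indicator UNIV x :: real)" for n x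
          by (auto split: split_indicator)
      qed (use A in \<open>simp_all add: measurable_cong_sets[OF M(2) refl]\<close>)
    qed
  qed
  have simple: "f \<in> closed_span M E" if f: "simple_function M f" for f :: "'a \<Rightarrow> real"
  proof -
    have "f = (\<lambda>x. \<Sum>y\<in>f ` space M. y * indicator (f -` {y} \<inter> space M) x)"
      by (rule ext, rule trans[OF simple_function_indicator_representation_banach[OF f]])
         (simp_all add: sp mult.commute)
    moreover have "(\<lambda>x. \<Sum>y\<in>f ` space M. y * indicator (f -` {y} \<inter> space M) x) \<in> closed_span M E"
      using simple_functionD(2)[OF f] M(2) G(3) by (intro closed_span_lincomb[OF E] bor) auto
    ultimately show ?thesis by simp
  qed
  show ?thesis
  proof
    fix u assume u: "u \<in> L2_fun M"
    then have um: "u \<in> borel_measurable M" by (rule L2_funD)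
    obtain s where s: "\<And>i. simple_function M (s i)"
      and lim: "\<And>x. x \<in> space M \<Longrightarrow> (\<lambda>i. s i x) \<longlonglongrightarrow> u x"
      and bd: "\<And>i x. x \<in> space M \<Longrightarrow> dist (s i x) 0 \<le> 2 * dist (u x) 0"
      using borel_measurable_implies_sequence_metric[OF um, of 0] by blast
    show "u \<in> closed_span M E"
    proof (rule closed_span_limit[OF E u simple[OF s]])
      show "(\<lambda>n. L2_norm M (\<lambda>x. u x - s n x)) \<longlonglongrightarrow> 0"
      proof (rule L2_norm_dominated_convergence[OF _ borel_measurable_simple_function[OF s] um lim])
        show "(\<lambda>x. 3 * \<bar>u x\<bar>) \<in> L2_fun M"
          using L2_funD[OF u] unfolding L2_fun_def by (simp add: power_mult_distrib)
        show "\<bar>u x - s n x\<bar> \<le> 3 * \<bar>u x\<bar>" if "x \<in> space M" for n x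
          using bd[OF that, of n] by simp
      qed
    qed
  qed
qed

text \<open>Gram--Schmidt runs over the indicators of a countable generator; their closed span is all of
  \<open>L\<^sup>2\<close>, so the resulting system is a basis.\<close>

lemma orthonormal_basis_exists:
  fixes M :: "'a::second_countable_topology measure"
  assumes M: "finite_measure M" "sets M = sets borel"
  shows "\<exists>E. orthonormal_basis M E"
proof -
  obtain G :: "'a set set" where G: "countable G" "Int_stable G" "UNIV \<in> G" "sigma_sets UNIV G = sets borel"
    by (rule countable_Int_stable_generator_borel)
  define s :: "nat \<Rightarrow> 'a \<Rightarrow> real" where "s n = indicator (from_nat_into G n)" for n
  have GB: "A \<in> sets borel" if "A \<in> G" for A
    unfolding G(4)[symmetric] using that by (rule sigma_sets.Basic)
  have "from_nat_into G n \<in> sets M" for n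
    unfolding M(2) using from_nat_into[of G n] G(3) by (intro GB) auto
  then have "s n \<in> L2_fun M" for n
    unfolding s_def by (intro L2_fun_bounded[OF M(1), where B = 1]) (auto simp: indicator_def)
  then obtain E where E: "orthonormal M E" "\<And>n. s n \<in> closed_span M E"
    using orthonormal_system_spanning_sequence[of s M] by blast
  have "(indicator A :: 'a \<Rightarrow> real) \<in> closed_span M E" if "A \<in> G" for A
    using E(2)[of "to_nat_on G A"] that G(1) by (simp add: s_def)
  then have "L2_fun M \<subseteq> closed_span M E"
    using G E(1) M by (intro closed_span_total_if_generator) auto
  then show ?thesis using E(1) by (auto simp: orthonormal_basis_iff)
qed

section \<open>Finite rank operators and their Hilbert--Schmidt norm\<close>

lemma has_sum_finite_sum:
  fixes f :: "'i \<Rightarrow> 'e \<Rightarrow> real"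
  assumes "\<And>i. i \<in> I \<Longrightarrow> (f i has_sum s i) E"
  shows "((\<lambda>e. \<Sum>i\<in>I. f i e) has_sum (\<Sum>i\<in>I. s i)) E"
  using assms by (induction I rule: infinite_finite_induct) (simp_all add: has_sum_add)

lemma (in pair_sigma_finite) integrable_tensor:
  fixes a b :: "_ \<Rightarrow> real"
  assumes a: "integrable M1 a" and b: "integrable M2 b"
  shows "integrable (M1 \<Otimes>\<^sub>M M2) (\<lambda>(x, y). a x * b y)"
proof (rule Fubini_integrable)
  have [measurable]: "a \<in> borel_measurable M1" "b \<in> borel_measurable M2"
    using a b by auto
  show "(\<lambda>(x, y). a x * b y) \<in> borel_measurable (M1 \<Otimes>\<^sub>M M2)"
    by measurable
  show "integrable M1 (\<lambda>x. \<integral>y. norm (case (x, y) of (x, y) \<Rightarrow> a x * b y) \<partial>M2)"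
    using a by (simp add: abs_mult)
  show "AE x in M1. integrable M2 (\<lambda>y. case (x, y) of (x, y) \<Rightarrow> a x * b y)"
    using b by simp
qed

lemma (in pair_sigma_finite) integral_tensor:
  fixes a b :: "_ \<Rightarrow> real"
  assumes a: "integrable M1 a" and b: "integrable M2 b"
  shows "(\<integral>(x, y). a x * b y \<partial>(M1 \<Otimes>\<^sub>M M2)) = (\<integral>x. a x \<partial>M1) * (\<integral>y. b y \<partial>M2)"
  using integral_fst'[OF integrable_tensor[OF a b]] by simp

context
  fixes M :: "'a measure" and K :: "'b measure"
  assumes M: "finite_measure M" and K: "finite_measure K"
begin

interpretation M: finite_measure M by (rule M)
interpretation K: finite_measure K by (rule K)
interpretation MK: pair_sigma_finite M K ..

lemma L2_fun_tensor:
  assumes "f \<in> L2_fun M" "g \<in> L2_fun K"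
  shows "(\<lambda>(x, y). f x * g y) \<in> L2_fun (M \<Otimes>\<^sub>M K)"
proof -
  note [measurable] = L2_funD(1)[OF assms(1)] L2_funD(1)[OF assms(2)]
  have "integrable (M \<Otimes>\<^sub>M K) (\<lambda>(x, y). (f x)\<^sup>2 * (g y)\<^sup>2)"
    using assms by (intro MK.integrable_tensor L2_funD(2))
  then show ?thesis
    unfolding L2_fun_def by (auto simp: case_prod_beta' power_mult_distrib)
qed

lemma L2_inner_tensor:
  assumes "f \<in> L2_fun M" "g \<in> L2_fun K" "f' \<in> L2_fun M" "g' \<in> L2_fun K"
  shows "L2_inner (M \<Otimes>\<^sub>M K) (\<lambda>(x, y). f x * g y) (\<lambda>(x, y). f' x * g' y)
    = L2_inner M f f' * L2_inner K g g'"
proof -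
  have "L2_inner (M \<Otimes>\<^sub>M K) (\<lambda>(x, y). f x * g y) (\<lambda>(x, y). f' x * g' y)
      = (\<integral>(x, y). (f x * f' x) * (g y * g' y) \<partial>(M \<Otimes>\<^sub>M K))"
    unfolding L2_inner_def by (rule Bochner_Integration.integral_cong) (auto simp: mult_ac)
  also have "\<dots> = L2_inner M f f' * L2_inner K g g'"
    unfolding L2_inner_def using assms by (intro MK.integral_tensor integrable_L2_mult)
  finally show ?thesis .
qed

text \<open>Expanding squares reduces both sides to Gram matrices: Parseval turns
  \<open>\<Sum>\<^sub>e \<langle>e, f\<^sub>i\<rangle> \<langle>e, f\<^sub>j\<rangle>\<close> into \<open>\<langle>f\<^sub>i, f\<^sub>j\<rangle>\<close> for every orthonormal basis, and Fubini
  produces the same matrix entries from the kernel.\<close>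

theorem finite_rank_hilbert_schmidt:
  fixes J :: "'i set"
  assumes ex: "\<exists>E. orthonormal_basis M E" and J: "finite J"
    and f: "\<And>j. j \<in> J \<Longrightarrow> f j \<in> L2_fun M" and g: "\<And>j. j \<in> J \<Longrightarrow> g j \<in> L2_fun K"
    and Tm: "\<And>u. u \<in> L2_fun M \<Longrightarrow> T u \<in> borel_measurable K"
    and T: "\<And>u. u \<in> L2_fun M \<Longrightarrow> AE y in K. T u y = (\<Sum>j\<in>J. L2_inner M u (f j) * g j y)"
  shows "hilbert_schmidt M K T"
    and "(\<lambda>(x, y). \<Sum>j\<in>J. f j x * g j y) \<in> L2_fun (M \<Otimes>\<^sub>M K)"
    and "hs_norm M K T = L2_norm (M \<Otimes>\<^sub>M K) (\<lambda>(x, y). \<Sum>j\<in>J. f j x * g j y)"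
proof -
  define S where "S u y = (\<Sum>j\<in>J. L2_inner M u (f j) * g j y)" for u y
  define k where "k = (\<lambda>(x, y). \<Sum>j\<in>J. f j x * g j y)"
  have S_L2: "S u \<in> L2_fun K" for u
    unfolding S_def by (intro L2_fun_lincomb g)
  have T_L2: "T u \<in> L2_fun K" if "u \<in> L2_fun M" for u
    using T[OF that] by (intro L2_fun_cong_AE[OF _ S_L2[of u] Tm[OF that]]) (auto simp: S_def)
  have norm_TS: "L2_norm K (T u) = L2_norm K (S u)" if "u \<in> L2_fun M" for u
    using T[OF that] Tm[OF that] L2_funD(1)[OF S_L2] by (intro L2_norm_cong_AE) (auto simp: S_def)
  have "L2_operator M K T"
    unfolding L2_operator_def
  proof (intro conjI ballI allI exI)
    show "T u \<in> L2_fun K" if "u \<in> L2_fun M" for u by (rule T_L2[OF that])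
  next
    fix u v and a b :: real
    assume u: "u \<in> L2_fun M" and v: "v \<in> L2_fun M"
    have "S (\<lambda>x. a * u x + b * v x) y = a * S u y + b * S v y" for y
      using u v f
      by (simp add: S_def L2_inner_add_left L2_inner_scale_left L2_fun_scale distrib_right
          sum.distrib sum_distrib_left mult.assoc)
    moreover have "(\<lambda>x. a * u x + b * v x) \<in> L2_fun M"
      by (intro L2_fun_add L2_fun_scale u v)
    ultimately show "AE y in K. T (\<lambda>x. a * u x + b * v x) y = a * T u y + b * T v y"
      using T[OF u] T[OF v] T[of "\<lambda>x. a * u x + b * v x"] unfolding S_def by auto
  next
    fix u assume u: "u \<in> L2_fun M"
    have "L2_norm K (S u) \<le> (\<Sum>j\<in>J. \<bar>L2_inner M u (f j)\<bar> * L2_norm K (g j))"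
      unfolding S_def by (rule L2_norm_lincomb_le[OF J g])
    also have "\<dots> \<le> (\<Sum>j\<in>J. (L2_norm M u * L2_norm M (f j)) * L2_norm K (g j))"
      by (intro sum_mono mult_right_mono L2_Cauchy_Schwarz u f) auto
    finally show "L2_norm K (T u) \<le> (\<Sum>j\<in>J. L2_norm M (f j) * L2_norm K (g j)) * L2_norm M u"
      by (simp add: norm_TS[OF u] sum_distrib_left mult_ac)
  qed
  moreover
  define w where "w = (\<Sum>i\<in>J. \<Sum>j\<in>J. L2_inner K (g i) (g j) * L2_inner M (f i) (f j))"
  have hs: "((\<lambda>e. (L2_norm K (T e))\<^sup>2) has_sum w) E" if E: "orthonormal_basis M E" for E
  proof -
    have "(L2_norm K (T e))\<^sup>2
        = (\<Sum>i\<in>J. \<Sum>j\<in>J. L2_inner K (g i) (g j) * (L2_inner M e (f i) * L2_inner M e (f j)))"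
      if e: "e \<in> E" for e
    proof -
      have eL: "e \<in> L2_fun M" using E e by (auto simp: orthonormal_basis_def)
      have "(L2_norm K (T e))\<^sup>2 = L2_inner K (S e) (S e)"
        by (simp add: norm_TS[OF eL] L2_norm_sq)
      also have "\<dots> = (\<Sum>i\<in>J. L2_inner M e (f i) * L2_inner K (g i) (S e))"
        unfolding S_def[of e, abs_def] using g
        by (intro L2_inner_lincomb_left L2_fun_lincomb)
      also have "\<dots> = (\<Sum>i\<in>J. L2_inner M e (f i) * (\<Sum>j\<in>J. L2_inner M e (f j) * L2_inner K (g i) (g j)))"
        unfolding S_def[of e, abs_def] using g
        by (intro sum.cong refl arg_cong2[where f = "(*)"] L2_inner_lincomb_right)
      finally show ?thesis by (simp add: sum_distrib_left mult_ac)
    qed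
    moreover have "((\<lambda>e. \<Sum>i\<in>J. \<Sum>j\<in>J. L2_inner K (g i) (g j) * (L2_inner M e (f i) * L2_inner M e (f j)))
        has_sum w) E"
      unfolding w_def using f by (intro has_sum_finite_sum has_sum_cmult_right Parseval_inner[OF E])
    ultimately show ?thesis by (simp cong: has_sum_cong)
  qed
  ultimately show "hilbert_schmidt M K T"
    using ex unfolding hilbert_schmidt_def summable_on_def by blast
  have t: "(\<lambda>(x, y). f j x * g j y) \<in> L2_fun (M \<Otimes>\<^sub>M K)" if "j \<in> J" for j
    by (rule L2_fun_tensor[OF f g]) fact+
  have k: "k = (\<lambda>p. \<Sum>j\<in>J. 1 * (\<lambda>(x, y). f j x * g j y) p)"
    by (auto simp: k_def fun_eq_iff)
  show k_L2: "(\<lambda>(x, y). \<Sum>j\<in>J. f j x * g j y) \<in> L2_fun (M \<Otimes>\<^sub>M K)"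
    unfolding k_def[symmetric] k by (rule L2_fun_lincomb[OF t])
  have "L2_inner (M \<Otimes>\<^sub>M K) k k = (\<Sum>i\<in>J. 1 * L2_inner (M \<Otimes>\<^sub>M K) (\<lambda>(x, y). f i x * g i y) k)"
    using t k_L2 unfolding k_def[symmetric] by (subst (1) k) (rule L2_inner_lincomb_left)
  also have "\<dots> = (\<Sum>i\<in>J. 1 * (\<Sum>j\<in>J. 1 * L2_inner (M \<Otimes>\<^sub>M K) (\<lambda>(x, y). f i x * g i y) (\<lambda>(x, y). f j x * g j y)))"
    unfolding k using t by (intro sum.cong refl arg_cong2[where f = "(*)"] L2_inner_lincomb_right)
  also have "\<dots> = w"
    unfolding w_def using f g by (intro sum.cong refl) (simp add: L2_inner_tensor mult.commute)
  finally have "(L2_norm (M \<Otimes>\<^sub>M K) k)\<^sup>2 = w"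
    by (simp add: L2_norm_sq)
  then have kw: "L2_norm (M \<Otimes>\<^sub>M K) k = sqrt w"
    by (metis L2_norm_nonneg real_sqrt_unique)
  have "orthonormal_basis M (SOME E. orthonormal_basis M E)"
    using ex by (rule someI_ex)
  then show "hs_norm M K T = L2_norm (M \<Otimes>\<^sub>M K) (\<lambda>(x, y). \<Sum>j\<in>J. f j x * g j y)"
    unfolding hs_norm_def k_def[symmetric] kw using hs infsumI by (intro arg_cong[where f = sqrt]) blast
qed

end

section \<open>Regularity of entropic transport kernels\<close>

text \<open>The Schroedinger equations carry the regularity of the kernel. For a symmetric cost they are
  symmetric under exchange of the two marginals, so every estimate in the first variable has a counterpart in the
  second one.\<close>

definition schroedinger_potentials ::
  "('a::topological_space \<Rightarrow> 'a \<Rightarrow> real) \<Rightarrow> real \<Rightarrow> 'a measure \<Rightarrow> 'a measure \<Rightarrow>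
   ('a \<Rightarrow> real) \<Rightarrow> ('a \<Rightarrow> real) \<Rightarrow> bool" where
  "schroedinger_potentials c \<epsilon> \<rho> \<sigma> \<alpha> \<beta> \<longleftrightarrow>
     continuous_on UNIV \<alpha> \<and> continuous_on UNIV \<beta> \<and>
     (\<forall>x. \<alpha> x = - \<epsilon> * ln (\<integral>y. exp ((\<beta> y - c x y) / \<epsilon>) \<partial>\<sigma>)) \<and>
     (\<forall>y. \<beta> y = - \<epsilon> * ln (\<integral>x. exp ((\<alpha> x - c x y) / \<epsilon>) \<partial>\<rho>))"

lemma schroedinger_potentials_swap:
  assumes "schroedinger_potentials c \<epsilon> \<rho> \<sigma> \<alpha> \<beta>" and sym: "\<And>x y. c x y = c y x"
  shows "schroedinger_potentials c \<epsilon> \<sigma> \<rho> \<beta> \<alpha>"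
proof -
  have "c = (\<lambda>x y. c y x)" by (intro ext sym)
  then show ?thesis
    using assms(1) unfolding schroedinger_potentials_def by (elim ssubst) blast
qed

lemma entropic_kernel_potentials:
  assumes "entropic_kernel c \<epsilon> \<rho> \<sigma> k"
  obtains \<alpha> \<beta> where "schroedinger_potentials c \<epsilon> \<rho> \<sigma> \<alpha> \<beta>"
    "k = (\<lambda>x y. exp ((\<alpha> x + \<beta> y - c x y) / \<epsilon>))"
  using assms unfolding entropic_kernel_def entropic_potentials_def schroedinger_potentials_def
  by blast

lemma continuous_integrable:
  fixes f :: "'a::metric_space \<Rightarrow> real"
  assumes "compact (UNIV :: 'a set)" "continuous_on UNIV f" "borel_prob \<rho>"
  shows "integrable \<rho> f"
proof -
  interpret prob_space \<rho> using assms(3) by (simp add: borel_prob_def)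
  have m: "f \<in> borel_measurable \<rho>"
    using borel_measurable_continuous_onI[OF assms(2)] assms(3)
    by (simp add: borel_prob_def cong: measurable_cong_sets)
  have "bounded (range f)"
    by (intro compact_imp_bounded compact_continuous_image assms)
  then obtain B where "\<And>x. norm (f x) \<le> B"
    unfolding bounded_iff by blast
  then show ?thesis
    using m by (intro integrable_const_bound[where B = B]) auto
qed

locale schroedinger =
  fixes c :: "'a::metric_space \<Rightarrow> 'a \<Rightarrow> real" and \<epsilon> L :: real and \<rho> \<sigma> :: "'a measure"
    and \<alpha> \<beta> :: "'a \<Rightarrow> real"
  assumes compact_UNIV: "compact (UNIV :: 'a set)"
    and c_cont: "continuous_on UNIV (\<lambda>(x, y). c x y)"
    and c_sym: "c x y = c y x"
    and c_lip: "\<bar>c x y - c x' y\<bar> \<le> L * dist x x'"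
    and eps: "0 < \<epsilon>"
    and \<rho>: "borel_prob \<rho>" and \<sigma>: "borel_prob \<sigma>"
    and potentials: "schroedinger_potentials c \<epsilon> \<rho> \<sigma> \<alpha> \<beta>"
begin

definition k :: "'a \<Rightarrow> 'a \<Rightarrow> real" where
  "k x y = exp ((\<alpha> x + \<beta> y - c x y) / \<epsilon>)"

lemma k_pos: "0 < k x y"
  by (simp add: k_def)

lemma cont_c: "continuous_on UNIV (\<lambda>y. c x y)" "continuous_on UNIV (\<lambda>x. c x y)"
proof -
  have "continuous_on UNIV (\<lambda>y. case (x, y) of (x, y) \<Rightarrow> c x y)"
    by (rule continuous_on_compose2[OF c_cont]) (intro continuous_intros subset_UNIV)+
  then show "continuous_on UNIV (\<lambda>y. c x y)" by simp
  have "continuous_on UNIV (\<lambda>x. case (x, y) of (x, y) \<Rightarrow> c x y)"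
    by (rule continuous_on_compose2[OF c_cont]) (intro continuous_intros subset_UNIV)+
  then show "continuous_on UNIV (\<lambda>x. c x y)" by simp
qed

lemma cont_potentials: "continuous_on UNIV \<alpha>" "continuous_on UNIV \<beta>"
  using potentials unfolding schroedinger_potentials_def by blast+

lemma potential_eq: "\<alpha> x = - \<epsilon> * ln (\<integral>y. exp ((\<beta> y - c x y) / \<epsilon>) \<partial>\<sigma>)"
  using potentials unfolding schroedinger_potentials_def by blast

lemma cont_k: "continuous_on UNIV (\<lambda>x. k x y)" "continuous_on UNIV (\<lambda>y. k x y)"
  unfolding k_def using eps by (intro continuous_intros cont_c cont_potentials; simp)+

lemma partition_integrable: "integrable \<sigma> (\<lambda>y. exp ((\<beta> y - c x y) / \<epsilon>))"
  using eps
  by (intro continuous_integrable[OF compact_UNIV] \<sigma> continuous_intros cont_c cont_potentials) simp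

lemma partition_pos: "0 < (\<integral>y. exp ((\<beta> y - c x y) / \<epsilon>) \<partial>\<sigma>)"
proof -
  interpret prob_space \<sigma> using \<sigma> by (simp add: borel_prob_def)
  let ?g = "\<lambda>y. exp ((\<beta> y - c x y) / \<epsilon>)"
  have "(\<integral>y. ?g y \<partial>\<sigma>) \<noteq> 0"
  proof
    assume "(\<integral>y. ?g y \<partial>\<sigma>) = 0"
    then have "AE y in \<sigma>. ?g y = 0"
      by (subst (asm) integral_nonneg_eq_0_iff_AE[OF partition_integrable]) auto
    then have "AE y in \<sigma>. False" by simp
    then show False by simp
  qed
  moreover have "0 \<le> (\<integral>y. ?g y \<partial>\<sigma>)" by (rule integral_nonneg_AE) simp
  ultimately show ?thesis by linarith
qed

text \<open>The first Schroedinger equation is the normalisation that makes the kernel integrate to one.\<close>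

lemma exp_potential: "exp (\<alpha> x / \<epsilon>) = inverse (\<integral>y. exp ((\<beta> y - c x y) / \<epsilon>) \<partial>\<sigma>)"
proof -
  let ?I = "\<integral>y. exp ((\<beta> y - c x y) / \<epsilon>) \<partial>\<sigma>"
  have "\<alpha> x / \<epsilon> = - ln ?I"
    by (subst potential_eq) (use eps in simp)
  then show ?thesis using partition_pos[of x] by (simp add: exp_minus)
qed

lemma k_integral: "(\<integral>y. k x y \<partial>\<sigma>) = 1"
proof -
  have "k x y = exp (\<alpha> x / \<epsilon>) * exp ((\<beta> y - c x y) / \<epsilon>)" for y
    by (simp add: k_def exp_add[symmetric] add_divide_distrib[symmetric] algebra_simps)
  then show ?thesis
    using partition_pos[of x] by (simp add: exp_potential)
qed

text \<open>The potential inherits the Lipschitz constant of the cost, being a soft minimum of the functions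
  \<open>c(\<cdot>, y) - \<beta>(y)\<close>.\<close>

lemma potential_lipschitz: "\<alpha> x - \<alpha> x' \<le> L * dist x x'"
proof -
  let ?I = "\<lambda>x. \<integral>y. exp ((\<beta> y - c x y) / \<epsilon>) \<partial>\<sigma>"
  have "?I x' \<le> (\<integral>y. exp (L * dist x x' / \<epsilon>) * exp ((\<beta> y - c x y) / \<epsilon>) \<partial>\<sigma>)"
  proof (rule integral_mono)
    fix y
    have "(\<beta> y - c x' y) / \<epsilon> \<le> (L * dist x x' + (\<beta> y - c x y)) / \<epsilon>"
      using c_lip[of x y x'] eps by (intro divide_right_mono) auto
    then show "exp ((\<beta> y - c x' y) / \<epsilon>) \<le> exp (L * dist x x' / \<epsilon>) * exp ((\<beta> y - c x y) / \<epsilon>)"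
      by (simp add: exp_add[symmetric] add_divide_distrib)
  qed (use partition_integrable in auto)
  then have "?I x' \<le> exp (L * dist x x' / \<epsilon>) * ?I x" by simp
  then have "ln (?I x') \<le> ln (exp (L * dist x x' / \<epsilon>) * ?I x)"
    using partition_pos by (intro ln_mono) auto
  also have "\<dots> = L * dist x x' / \<epsilon> + ln (?I x)"
    using partition_pos[of x] by (simp add: ln_mult)
  finally have "\<epsilon> * ln (?I x') \<le> \<epsilon> * (L * dist x x' / \<epsilon> + ln (?I x))"
    using eps by (intro mult_left_mono) auto
  then have "- \<epsilon> * ln (?I x) - - \<epsilon> * ln (?I x') \<le> L * dist x x'"
    using eps by (simp add: distrib_left)
  then show ?thesis
    unfolding potential_eq[symmetric] .
qed

lemma k_log_lipschitz: "k x y \<le> exp (2 * L * dist x x' / \<epsilon>) * k x' y"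
proof -
  have "(\<alpha> x + \<beta> y - c x y) / \<epsilon> \<le> (2 * L * dist x x' + (\<alpha> x' + \<beta> y - c x' y)) / \<epsilon>"
    using potential_lipschitz[of x x'] c_lip[of x y x'] eps by (intro divide_right_mono) auto
  then show ?thesis
    by (simp add: k_def exp_add[symmetric] add_divide_distrib)
qed

lemma swap: "schroedinger c \<epsilon> L \<sigma> \<rho> \<beta> \<alpha>"
  using compact_UNIV c_cont c_sym c_lip eps \<rho> \<sigma> schroedinger_potentials_swap[OF potentials c_sym]
  by unfold_locales auto

lemma swap_k: "schroedinger.k c \<epsilon> \<beta> \<alpha> y x = k x y"
  unfolding schroedinger.k_def[OF swap] k_def c_sym[of y x] by (simp add: add.commute)

lemma k_integral_first: "(\<integral>x. k x y \<partial>\<rho>) = 1"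
  using schroedinger.k_integral[OF swap, of y] by (simp add: swap_k)

text \<open>On a ball of radius \<open>\<epsilon>\<close> the kernel varies by a factor at most \<open>exp (2 L)\<close>, and its average over
  the second marginal is one. So the mass of that ball controls the kernel, for all first arguments.\<close>

lemma k_bound:
  assumes m: "0 < m" "m \<le> measure \<sigma> (ball y \<epsilon>)" and L: "0 \<le> L"
  shows "k x y \<le> exp (2 * L) / m"
proof -
  interpret prob_space \<sigma> using \<sigma> by (simp add: borel_prob_def)
  have b: "ball y \<epsilon> \<in> sets \<sigma>" using \<sigma> by (simp add: borel_prob_def)
  have ind: "indicator (ball y \<epsilon>) y' * k x y \<le> exp (2 * L) * k x y'" for y'
  proof (cases "y' \<in> ball y \<epsilon>")
    case True
    have "k x y \<le> exp (2 * L * dist y y' / \<epsilon>) * k x y'"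
      using schroedinger.k_log_lipschitz[OF swap, of y x y'] by (simp add: swap_k)
    also have "\<dots> \<le> exp (2 * L) * k x y'"
    proof (intro mult_right_mono)
      have "2 * L * dist y y' / \<epsilon> \<le> 2 * L * \<epsilon> / \<epsilon>"
        using True eps L by (intro divide_right_mono mult_left_mono) auto
      then show "exp (2 * L * dist y y' / \<epsilon>) \<le> exp (2 * L)" using eps by simp
    qed (simp add: less_imp_le k_pos)
    finally show ?thesis using True by simp
  qed (simp add: less_imp_le k_pos)
  have "m * k x y \<le> measure \<sigma> (ball y \<epsilon>) * k x y"
    using m k_pos[of x y] by (intro mult_right_mono) auto
  also have "\<dots> = (\<integral>y'. indicator (ball y \<epsilon>) y' * k x y \<partial>\<sigma>)"
    using b by simp
  also have "\<dots> \<le> (\<integral>y'. exp (2 * L) * k x y' \<partial>\<sigma>)"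
    using b continuous_integrable[OF compact_UNIV cont_k(2) \<sigma>, of x] ind
    by (intro integral_mono) (auto intro!: integrable_mult_left simp: integrable_indicator_iff emeasure_eq_measure)
  also have "\<dots> = exp (2 * L)" by (simp add: k_integral)
  finally show ?thesis using m(1) by (simp add: field_simps)
qed

text \<open>A function with a Lipschitz logarithm is Lipschitz as long as it is bounded, by
  \<open>1 - e\<^sup>-\<^sup>s \<le> s\<close>.\<close>

lemma k_lipschitz:
  assumes bd: "\<And>x. k x y \<le> B" and L: "0 \<le> L"
  shows "\<bar>k x y - k x' y\<bar> \<le> 2 * L / \<epsilon> * B * dist x x'"
proof -
  have one: "k x y - k x' y \<le> 2 * L / \<epsilon> * B * dist x x'" for x x'
  proof -
    let ?s = "2 * L * dist x x' / \<epsilon>"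
    have s: "0 \<le> ?s" using L eps by simp
    have "exp (- ?s) * k x y \<le> exp (- ?s) * (exp ?s * k x' y)"
      by (intro mult_left_mono k_log_lipschitz) simp
    also have "\<dots> = k x' y" by (simp add: exp_minus)
    finally have "k x y - k x' y \<le> (1 - exp (- ?s)) * k x y"
      by (simp add: algebra_simps)
    also have "\<dots> \<le> ?s * B"
      using exp_ge_add_one_self[of "- ?s"] s bd[of x] k_pos[of x y] by (intro mult_mono) auto
    finally show ?thesis by (simp add: mult_ac)
  qed
  show ?thesis using one[of x x'] one[of x' x] by (simp add: dist_commute abs_le_iff)
qed

end

section \<open>Empirical ball masses\<close>

text \<open>The complement of the support is a union of null basic open sets, and countably many suffice.\<close>

lemma AE_in_spt:
  fixes \<rho> :: "'a::second_countable_topology measure"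
  assumes "sets \<rho> = sets borel"
  shows "AE x in \<rho>. x \<in> spt \<rho>"
proof -
  obtain B :: "'a set set" where B: "countable B" "topological_basis B"
    using ex_countable_basis by blast
  let ?N = "{U \<in> B. emeasure \<rho> U = 0}"
  have open_B: "open U" if "U \<in> B" for U using topological_basis_open[OF B(2) that] .
  have "(\<Union>U\<in>?N. U) \<in> null_sets \<rho>"
    using B(1) open_B assms by (intro null_sets_UN') (auto simp: null_sets_def)
  moreover have "{x \<in> space \<rho>. x \<notin> spt \<rho>} \<subseteq> (\<Union>U\<in>?N. U)"
  proof
    fix x assume "x \<in> {x \<in> space \<rho>. x \<notin> spt \<rho>}"
    then obtain U where U: "open U" "x \<in> U" "emeasure \<rho> U = 0"
      by (auto simp: spt_def)
    then obtain V where V: "V \<in> B" "x \<in> V" "V \<subseteq> U"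
      using topological_basisE[OF B(2) U(1,2)] by blast
    have "emeasure \<rho> V \<le> emeasure \<rho> U"
      using V U assms by (intro emeasure_mono) auto
    then show "x \<in> (\<Union>U\<in>?N. U)" using U V by auto
  qed
  ultimately show ?thesis by (rule AE_I')
qed

definition ball_count :: "real \<Rightarrow> nat set \<Rightarrow> (nat \<Rightarrow> 'a::metric_space) \<Rightarrow> 'a \<Rightarrow> real" where
  "ball_count r J w x = (\<Sum>j\<in>J. indicator (ball x r) (w j))"

context prob_space
begin

text \<open>For a fixed centre the count is a sum of independent indicators and Hoeffding applies. The summand
  one stands for the centre itself, which the ball always contains; it compensates the passage from
  \<open>n\<close> to \<open>n + 1\<close> sample points.\<close>

lemma ball_count_lower_tail_fixed_center:
  fixes X :: "nat \<Rightarrow> 'a \<Rightarrow> 'b::{metric_space, second_countable_topology}"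
  assumes J: "finite J" and ind: "indep_vars (\<lambda>_. borel) X J"
    and distr: "\<And>j. j \<in> J \<Longrightarrow> distr M borel (X j) = \<rho>"
    and p: "p \<le> measure \<rho> (ball x r)" "0 \<le> p" "p \<le> 1"
  shows "prob {\<omega> \<in> space M. 1 + ball_count r J (\<lambda>j. X j \<omega>) x < real (card J + 1) * p / 2}
    \<le> exp (- (real (card J + 1) / 2) * p\<^sup>2)"
proof (cases "J = {}")
  case True
  then have e: "{\<omega> \<in> space M. 1 + ball_count r J (\<lambda>j. X j \<omega>) x < real (card J + 1) * p / 2} = {}"
    using p by (auto simp: ball_count_def)
  show ?thesis unfolding e by simp
next
  case False
  define n where "n = real (card J)"
  have n: "1 \<le> n" using False J by (simp add: n_def card_gt_0_iff Suc_le_eq)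
  have indicator_ball: "(indicator (ball x r) :: 'b \<Rightarrow> real) \<in> borel_measurable borel"
    by (rule borel_measurable_indicator) simp
  define I where "I j \<omega> = (indicator (ball x r) (X j \<omega>) :: real)" for j \<omega>
  have rv[measurable]: "X j \<in> borel_measurable M" if "j \<in> J" for j
    using ind that by (simp add: indep_vars_def)
  have indI: "indep_vars (\<lambda>_. borel) I J"
    unfolding I_def by (rule indep_vars_compose2[OF ind]) (rule indicator_ball)
  interpret indep_interval_bounded_random_variables M J I "\<lambda>_. 0" "\<lambda>_. 1"
    by unfold_locales (use J indI in \<open>auto simp: I_def indicator_def\<close>)
  define q where "q = measure \<rho> (ball x r)"
  have E: "expectation (I j) = q" if "j \<in> J" for j
  proof -
    have "expectation (I j) = (\<integral>y. indicator (ball x r) y \<partial>distr M borel (X j))"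
      unfolding I_def by (rule integral_distr[symmetric, OF rv[OF that] indicator_ball])
    also have "\<dots> = measure (distr M borel (X j)) (ball x r)"
      by simp
    also have "\<dots> = q"
      using that by (simp add: distr q_def)
    finally show ?thesis .
  qed
  interpret Hoeffding_ineq M J I "\<lambda>_. 0" "\<lambda>_. 1" "n * q"
    by unfold_locales (simp add: E n_def)
  define t where "t = n * q - ((n + 1) * p / 2 - 1)"
  have "n * p \<le> n * q" using p n by (simp add: q_def mult_left_mono)
  then have t: "(n + 1) * p / 2 \<le> t"
    using p by (simp add: t_def field_simps)
  have np: "0 \<le> (n + 1) * p / 2" using p n by simp
  have "prob {\<omega> \<in> space M. 1 + ball_count r J (\<lambda>j. X j \<omega>) x < real (card J + 1) * p / 2}
      \<le> prob {\<omega> \<in> space M. (\<Sum>j\<in>J. I j \<omega>) \<le> n * q - t}"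
  proof (rule finite_measure_mono)
    show "{\<omega> \<in> space M. (\<Sum>j\<in>J. I j \<omega>) \<le> n * q - t} \<in> events" by measurable
  qed (auto simp: ball_count_def I_def t_def n_def add.commute)
  also have "\<dots> \<le> exp (-2 * t\<^sup>2 / (\<Sum>j\<in>J. (1 - 0)\<^sup>2))"
    using t np n by (intro Hoeffding_ineq_le) (auto simp: n_def)
  also have "\<dots> = exp (- (2 * t\<^sup>2 / n))" by (simp add: n_def)
  also have "\<dots> \<le> exp (- ((n + 1) / 2 * p\<^sup>2))"
  proof -
    have "(n + 1) / 2 * p\<^sup>2 * n \<le> (n + 1) / 2 * p\<^sup>2 * (n + 1)"
      using n by (intro mult_left_mono) auto
    also have "\<dots> = 2 * ((n + 1) * p / 2)\<^sup>2" by (simp add: power2_eq_square)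
    also have "\<dots> \<le> 2 * t\<^sup>2" using t np by (intro mult_left_mono power_mono) auto
    finally have "(n + 1) / 2 * p\<^sup>2 \<le> 2 * t\<^sup>2 / n" using n by (simp add: field_simps)
    then show ?thesis by simp
  qed
  finally show ?thesis by (simp add: n_def add.commute)
qed

lemma ball_count_measurable_pair:
  fixes J :: "nat set"
  assumes "finite J"
  shows "(\<lambda>(x, w). ball_count r J w x)
    \<in> borel_measurable (borel \<Otimes>\<^sub>M PiM J (\<lambda>_. borel :: 'b::{metric_space, second_countable_topology} measure))"
proof -
  have "(\<lambda>(x, w). if dist x (w j) < r then 1 else 0 :: real)
      \<in> borel_measurable (borel \<Otimes>\<^sub>M PiM J (\<lambda>_. borel :: 'b measure))" if "j \<in> J" for j
    using that by measurable
  then have "(\<lambda>p. \<Sum>j\<in>J. (\<lambda>(x, w). if dist x (w j) < r then 1 else 0 :: real) p)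
      \<in> borel_measurable (borel \<Otimes>\<^sub>M PiM J (\<lambda>_. borel :: 'b measure))"
    by (rule borel_measurable_sum)
  then show ?thesis
    by (simp add: ball_count_def indicator_def case_prod_beta' of_bool_def)
qed

text \<open>Conditioning on the centre: the centre \<open>X i\<close> is independent of the other sample points, so the
  probability of a small count is an average over \<open>\<rho>\<close> of fixed centre probabilities.\<close>

lemma ball_count_lower_tail:
  fixes X :: "nat \<Rightarrow> 'a \<Rightarrow> 'b::{metric_space, second_countable_topology}"
  assumes ind: "indep_vars (\<lambda>_. borel) X {..<N}" and i: "i < N"
    and distr: "\<And>j. j < N \<Longrightarrow> distr M borel (X j) = \<rho>"
    and mass: "AE x in \<rho>. p \<le> measure \<rho> (ball x r)" and p: "0 \<le> p" "p \<le> 1" and r: "0 < r"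
  shows "prob {\<omega> \<in> space M. ball_count r {..<N} (\<lambda>j. X j \<omega>) (X i \<omega>) < real N * p / 2}
    \<le> exp (- (real N / 2) * p\<^sup>2)"
proof -
  define J where "J = {..<N} - {i}"
  have J: "finite J" "J \<subseteq> {..<N}" "card J + 1 = N" "i \<notin> J" "{..<N} = insert i J"
    using i by (auto simp: J_def)
  define W where "W \<omega> = restrict (\<lambda>j. X j \<omega>) J" for \<omega>
  let ?PJ = "PiM J (\<lambda>_. borel :: 'b measure)"
  have rv[measurable]: "X j \<in> borel_measurable M" if "j < N" for j
    using ind that by (simp add: indep_vars_def)
  let ?Pi = "PiM {i} (\<lambda>_. borel :: 'b measure)"
  \<comment> \<open>The centre is kept as a function on \<open>{i}\<close>: independence of two random variables is a statement about
    variables with values in one common type.\<close>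
  define V where "V \<omega> = restrict (\<lambda>j. X j \<omega>) {i}" for \<omega>
  have "indep_var ?Pi V ?PJ W"
    unfolding V_def W_def using J i by (intro indep_var_restrict[OF ind]) auto
  then have V[measurable]: "V \<in> measurable M ?Pi" and W[measurable]: "W \<in> measurable M ?PJ"
    and prod: "distr M ?Pi V \<Otimes>\<^sub>M distr M ?PJ W = distr M (?Pi \<Otimes>\<^sub>M ?PJ) (\<lambda>\<omega>. (V \<omega>, W \<omega>))"
    unfolding indep_var_distribution_eq by auto
  define D where "D = distr M ?PJ W"
  define R where "R = distr M ?Pi V"
  interpret D: prob_space D unfolding D_def by (rule prob_space_distr[OF W])
  interpret R: prob_space R unfolding R_def by (rule prob_space_distr[OF V])
  have [measurable_cong]: "sets R = sets ?Pi" by (simp add: R_def)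
  have [measurable_cong]: "sets D = sets ?PJ" by (simp add: D_def)
  have comp: "(\<lambda>v. v i) \<in> measurable ?Pi borel" by measurable
  have "distr R borel (\<lambda>v. v i) = distr M borel (X i)"
    unfolding R_def using distr_distr[OF comp V] by (simp add: comp_def V_def)
  then have R\<rho>: "distr R borel (\<lambda>v. v i) = \<rho>" using distr i by simp
  have mass_R: "AE v in R. p \<le> measure \<rho> (ball (v i) r)"
  proof (rule AE_distrD[where M' = borel and f = "\<lambda>v. v i"])
    show "(\<lambda>v. v i) \<in> borel_measurable R" using comp by (simp add: R_def)
    show "AE x in distr R borel (\<lambda>v. v i). p \<le> measure \<rho> (ball x r)" unfolding R\<rho> by (rule mass)
  qed
  define bad :: "((nat \<Rightarrow> 'b) \<times> (nat \<Rightarrow> 'b)) set"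
    where "bad = {(v, w). 1 + ball_count r J w (v i) < real N * p / 2}"
  have bad: "bad \<inter> space (?Pi \<Otimes>\<^sub>M ?PJ) \<in> sets (?Pi \<Otimes>\<^sub>M ?PJ)"
  proof -
    have "(\<lambda>q. (fst q i, snd q)) \<in> measurable (?Pi \<Otimes>\<^sub>M ?PJ) (borel \<Otimes>\<^sub>M ?PJ)"
      by measurable
    from measurable_compose[OF this ball_count_measurable_pair[OF J(1), of r]]
    have "(\<lambda>q. ball_count r J (snd q) (fst q i)) \<in> borel_measurable (?Pi \<Otimes>\<^sub>M ?PJ)"
      by simp
    then have "{q \<in> space (?Pi \<Otimes>\<^sub>M ?PJ). 1 + ball_count r J (snd q) (fst q i) < real N * p / 2}
        \<in> sets (?Pi \<Otimes>\<^sub>M ?PJ)"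
      by measurable
    also have "{q \<in> space (?Pi \<Otimes>\<^sub>M ?PJ). 1 + ball_count r J (snd q) (fst q i) < real N * p / 2}
        = bad \<inter> space (?Pi \<Otimes>\<^sub>M ?PJ)"
      by (auto simp: bad_def)
    finally show ?thesis .
  qed
  have cong_W: "ball_count r J (W \<omega>) x = ball_count r J (\<lambda>j. X j \<omega>) x" for \<omega> x
    unfolding ball_count_def W_def by (intro sum.cong) auto
  let ?e = "exp (- (real N / 2) * p\<^sup>2)"
  have self: "ball_count r {..<N} (\<lambda>j. X j \<omega>) (X i \<omega>) = 1 + ball_count r J (\<lambda>j. X j \<omega>) (X i \<omega>)" for \<omega>
    using J r by (simp add: ball_count_def)
  have card_J: "1 + real (card J) = real N" using J(3) by simp
  have XW: "(\<lambda>\<omega>. (V \<omega>, W \<omega>)) \<in> measurable M (?Pi \<Otimes>\<^sub>M ?PJ)"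
    by measurable
  have V_i: "V \<omega> i = X i \<omega>" for \<omega> by (simp add: V_def)
  have "{\<omega> \<in> space M. ball_count r {..<N} (\<lambda>j. X j \<omega>) (X i \<omega>) < real N * p / 2}
      = (\<lambda>\<omega>. (V \<omega>, W \<omega>)) -` (bad \<inter> space (?Pi \<Otimes>\<^sub>M ?PJ)) \<inter> space M"
    using measurable_space[OF XW] by (auto simp: bad_def self cong_W V_i)
  then have "emeasure M {\<omega> \<in> space M. ball_count r {..<N} (\<lambda>j. X j \<omega>) (X i \<omega>) < real N * p / 2}
      = emeasure (R \<Otimes>\<^sub>M D) (bad \<inter> space (?Pi \<Otimes>\<^sub>M ?PJ))"
    using emeasure_distr[OF XW bad] prod by (simp add: D_def R_def)
  also have "\<dots> = (\<integral>\<^sup>+v. emeasure D (Pair v -` (bad \<inter> space (?Pi \<Otimes>\<^sub>M ?PJ))) \<partial>R)"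
    using bad sets_pair_measure_cong[of R ?Pi D ?PJ]
    by (intro D.emeasure_pair_measure_alt) (simp add: R_def D_def)
  also have "\<dots> \<le> (\<integral>\<^sup>+v. ennreal ?e \<partial>R)"
  proof (rule nn_integral_mono_AE)
    show "AE v in R. emeasure D (Pair v -` (bad \<inter> space (?Pi \<Otimes>\<^sub>M ?PJ))) \<le> ennreal ?e"
      using mass_R AE_space
    proof eventually_elim
      case (elim v)
      have s: "Pair v -` (bad \<inter> space (?Pi \<Otimes>\<^sub>M ?PJ)) \<in> sets ?PJ"
        by (rule sets_Pair1[OF bad])
      have "emeasure D (Pair v -` (bad \<inter> space (?Pi \<Otimes>\<^sub>M ?PJ)))
          = emeasure M (W -` (Pair v -` (bad \<inter> space (?Pi \<Otimes>\<^sub>M ?PJ))) \<inter> space M)"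
        unfolding D_def by (rule emeasure_distr[OF W s])
      also have "W -` (Pair v -` (bad \<inter> space (?Pi \<Otimes>\<^sub>M ?PJ))) \<inter> space M
          = {\<omega> \<in> space M. 1 + ball_count r J (\<lambda>j. X j \<omega>) (v i) < real (card J + 1) * p / 2}"
        using measurable_space[OF W] elim(2)
        by (auto simp: bad_def cong_W card_J space_pair_measure R_def)
      also have "emeasure M \<dots> \<le> ennreal ?e"
        using ball_count_lower_tail_fixed_center[OF J(1) indep_vars_subset[OF ind J(2)] _ elim(1) p] J(2) distr
        by (simp add: emeasure_eq_measure subset_eq card_J)
      finally show ?case .
    qed
  qed
  also have "\<dots> = ennreal ?e" by (simp add: R.emeasure_space_1)
  finally show ?thesis by (simp add: emeasure_eq_measure)
qed

lemma ball_count_event: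
  fixes X :: "nat \<Rightarrow> 'a \<Rightarrow> 'b::{metric_space, second_countable_topology}"
  assumes [measurable]: "\<And>j. j < N \<Longrightarrow> X j \<in> borel_measurable M" and i: "i < N"
  shows "{\<omega> \<in> space M. ball_count r {..<N} (\<lambda>j. X j \<omega>) (X i \<omega>) < a} \<in> events"
proof -
  have "(\<lambda>\<omega>. if dist (X i \<omega>) (X j \<omega>) < r then 1 else 0 :: real) \<in> borel_measurable M" if "j < N" for j
    using that i by measurable
  then have "(\<lambda>\<omega>. \<Sum>j<N. if dist (X i \<omega>) (X j \<omega>) < r then 1 else 0 :: real) \<in> borel_measurable M"
    by (intro borel_measurable_sum) auto
  then have "(\<lambda>\<omega>. ball_count r {..<N} (\<lambda>j. X j \<omega>) (X i \<omega>)) \<in> borel_measurable M"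
    by (simp add: ball_count_def indicator_def of_bool_def)
  then show ?thesis by measurable
qed

end

section \<open>Disintegrated plans and the operators they induce\<close>

lemma sets_borel_prod:
  "sets (borel \<Otimes>\<^sub>M borel) = sets (borel :: ('a::second_countable_topology \<times> 'b::second_countable_topology) measure)"
  by (simp only: borel_prod)

lemma couplingsD:
  assumes "\<gamma> \<in> couplings \<rho> \<sigma>"
  shows "prob_space \<gamma>" "sets \<gamma> = sets borel" "distr \<gamma> borel fst = \<rho>" "distr \<gamma> borel snd = \<sigma>"
  using assms by (auto simp: couplings_def borel_prob_def)

lemma couplings_measurable_fst_snd:
  fixes \<gamma> :: "('a::topological_space \<times> 'b::topological_space) measure"
  assumes "\<gamma> \<in> couplings \<rho> \<sigma>"
  shows "fst \<in> measurable \<gamma> borel" "snd \<in> measurable \<gamma> borel"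
  using borel_measurable_continuous_onI[OF continuous_on_fst[OF continuous_on_id, of UNIV]]
    borel_measurable_continuous_onI[OF continuous_on_snd[OF continuous_on_id, of UNIV]]
  by (simp_all add: measurable_cong_sets[OF couplingsD(2)[OF assms] refl])

lemma couplings_marginals:
  fixes \<rho> :: "'a::topological_space measure" and \<sigma> :: "'b::topological_space measure"
  assumes "\<gamma> \<in> couplings \<rho> \<sigma>"
  shows "borel_prob \<rho>" "borel_prob \<sigma>"
  using prob_space.prob_space_distr[OF couplingsD(1)[OF assms]] couplings_measurable_fst_snd[OF assms]
    couplingsD(3,4)[OF assms]
  by (auto simp: borel_prob_def)

locale disintegrated_plan =
  fixes \<gamma> :: "('a::second_countable_topology \<times> 'b::second_countable_topology) measure"
    and \<rho> :: "'a measure" and \<sigma> :: "'b measure" and \<kappa> :: "'a \<Rightarrow> 'b measure"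
  assumes plan: "\<gamma> \<in> couplings \<rho> \<sigma>" and dis: "disintegration \<gamma> \<rho> \<kappa>"
begin

lemma prob_\<rho>: "prob_space \<rho>" and sets_\<rho>: "sets \<rho> = sets borel"
  and prob_\<sigma>: "prob_space \<sigma>" and sets_\<sigma>: "sets \<sigma> = sets borel"
  using couplings_marginals[OF plan] by (auto simp: borel_prob_def)

lemma space_\<rho>: "space \<rho> = UNIV"
  using sets_eq_imp_space_eq[OF sets_\<rho>] by simp

lemma kernel_measurable: "\<kappa> \<in> measurable \<rho> (subprob_algebra borel)"
  using dis unfolding disintegration_def by (auto intro: measurable_prob_algebraD)

lemma kernel_prob: "prob_space (\<kappa> x)" and kernel_sets: "sets (\<kappa> x) = sets borel"
proof -
  have "\<kappa> x \<in> space (prob_algebra borel)"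
    using dis measurable_space[of \<kappa> \<rho> "prob_algebra borel" x]
    unfolding disintegration_def by (simp add: space_\<rho>)
  then show "prob_space (\<kappa> x)" "sets (\<kappa> x) = sets borel"
    by (auto simp: space_prob_algebra)
qed

lemma kernel_borel_measurable:
  "f \<in> borel_measurable borel \<Longrightarrow> f \<in> borel_measurable (\<kappa> x)"
  by (simp add: measurable_cong_sets[OF kernel_sets refl])

lemma pair_measurable: "Pair x \<in> measurable (\<kappa> x) borel"
proof -
  have "Pair x \<in> measurable borel (borel \<Otimes>\<^sub>M borel)" by measurable
  then show ?thesis
    by (simp add: measurable_cong_sets[OF refl sets_borel_prod] measurable_cong_sets[OF kernel_sets refl])
qed

text \<open>The disintegration identity for sets says that the plan arises by first drawing \<open>x\<close> from
  \<open>\<rho>\<close> and then \<open>y\<close> from \<open>\<kappa> x\<close>; as a monadic bind this transfers to integrals.\<close>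

lemma plan_eq_bind: "\<gamma> = \<rho> \<bind> (\<lambda>x. distr (\<kappa> x) borel (Pair x))"
  and pair_kernel_measurable: "(\<lambda>x. distr (\<kappa> x) borel (Pair x)) \<in> measurable \<rho> (subprob_algebra borel)"
proof -
  note [measurable] = kernel_measurable
  have [measurable_cong]: "sets \<rho> = sets borel" by (rule sets_\<rho>)
  have "(\<lambda>(x, y). (x, y)) \<in> measurable (\<rho> \<Otimes>\<^sub>M borel) (borel \<Otimes>\<^sub>M (borel :: 'b measure))"
    by measurable
  then show m: "(\<lambda>x. distr (\<kappa> x) borel (Pair x)) \<in> measurable \<rho> (subprob_algebra borel)"
    unfolding measurable_cong_sets[OF refl sets_borel_prod] by (rule measurable_distr2[OF _ kernel_measurable])
  have ne: "space \<rho> \<noteq> {}" by (simp add: space_\<rho>)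
  show "\<gamma> = \<rho> \<bind> (\<lambda>x. distr (\<kappa> x) borel (Pair x))"
  proof (rule measure_eqI)
    show "sets \<gamma> = sets (\<rho> \<bind> (\<lambda>x. distr (\<kappa> x) borel (Pair x)))"
      using couplingsD(2)[OF plan] by (simp add: sets_bind[OF _ ne])
    fix S assume S: "S \<in> sets \<gamma>"
    have Sb: "S \<in> sets borel" using S couplingsD(2)[OF plan] by simp
    have sp: "space (\<kappa> x) = UNIV" for x
      using sets_eq_imp_space_eq[OF kernel_sets] by simp
    have "emeasure \<gamma> S = (\<integral>\<^sup>+x. emeasure (\<kappa> x) (Pair x -` S) \<partial>\<rho>)"
      using dis S unfolding disintegration_def by blast
    also have "\<dots> = (\<integral>\<^sup>+x. emeasure (distr (\<kappa> x) borel (Pair x)) S \<partial>\<rho>)"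
      by (simp add: emeasure_distr[OF pair_measurable Sb] sp)
    also have "\<dots> = emeasure (\<rho> \<bind> (\<lambda>x. distr (\<kappa> x) borel (Pair x))) S"
      using emeasure_bind[OF ne m Sb] by simp
    finally show "emeasure \<gamma> S = emeasure (\<rho> \<bind> (\<lambda>x. distr (\<kappa> x) borel (Pair x))) S" .
  qed
qed

lemma nn_integral_plan:
  assumes f: "f \<in> borel_measurable borel"
  shows "(\<integral>\<^sup>+p. f p \<partial>\<gamma>) = (\<integral>\<^sup>+x. (\<integral>\<^sup>+y. f (x, y) \<partial>\<kappa> x) \<partial>\<rho>)"
proof -
  have "(\<integral>\<^sup>+p. f p \<partial>\<gamma>) = (\<integral>\<^sup>+x. (\<integral>\<^sup>+p. f p \<partial>distr (\<kappa> x) borel (Pair x)) \<partial>\<rho>)"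
    by (subst plan_eq_bind) (rule nn_integral_bind[OF f pair_kernel_measurable])
  then show ?thesis
    using f by (simp add: nn_integral_distr[OF pair_measurable])
qed

lemma nn_integral_kernel_measurable:
  assumes f: "f \<in> borel_measurable borel"
  shows "(\<lambda>x. \<integral>\<^sup>+y. f (x, y) \<partial>\<kappa> x) \<in> borel_measurable \<rho>"
proof -
  have [measurable_cong]: "sets \<rho> = sets borel" by (rule sets_\<rho>)
  have "(\<lambda>(x, y). f (x, y)) \<in> borel_measurable (\<rho> \<Otimes>\<^sub>M borel)"
    using f
    by (simp add: measurable_cong_sets[OF sets_pair_measure_cong[OF sets_\<rho> refl] refl]
        measurable_cong_sets[OF sets_borel_prod refl])
  then show ?thesis
    by (rule nn_integral_measurable_subprob_algebra2[OF _ kernel_measurable])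
qed

text \<open>Splitting into positive and negative parts reduces Fubini's theorem for a disintegration to the
  nonnegative case. The inner integrals of the parts are finite only almost everywhere.\<close>

theorem integral_plan:
  fixes f :: "'a \<times> 'b \<Rightarrow> real"
  assumes f: "f \<in> borel_measurable borel" and int: "integrable \<gamma> f"
  shows "integrable \<rho> (\<lambda>x. \<integral>y. f (x, y) \<partial>\<kappa> x)"
    and "(\<integral>p. f p \<partial>\<gamma>) = (\<integral>x. (\<integral>y. f (x, y) \<partial>\<kappa> x) \<partial>\<rho>)"
proof -
  have part: "integrable \<rho> (\<lambda>x. enn2real (\<integral>\<^sup>+y. ennreal (g (x, y)) \<partial>\<kappa> x))"
    "(\<integral>x. enn2real (\<integral>\<^sup>+y. ennreal (g (x, y)) \<partial>\<kappa> x) \<partial>\<rho>) = enn2real (\<integral>\<^sup>+p. ennreal (g p) \<partial>\<gamma>)"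
    "AE x in \<rho>. (\<integral>\<^sup>+y. ennreal (g (x, y)) \<partial>\<kappa> x) < \<infinity>"
    if g: "g \<in> borel_measurable borel" and fin: "(\<integral>\<^sup>+p. ennreal (g p) \<partial>\<gamma>) < \<infinity>"
    for g :: "'a \<times> 'b \<Rightarrow> real"
  proof -
    let ?G = "\<lambda>x. \<integral>\<^sup>+y. ennreal (g (x, y)) \<partial>\<kappa> x"
    have eg: "(\<lambda>p. ennreal (g p)) \<in> borel_measurable borel" using g by simp
    have G: "?G \<in> borel_measurable \<rho>" by (rule nn_integral_kernel_measurable[OF eg])
    have eq: "(\<integral>\<^sup>+p. ennreal (g p) \<partial>\<gamma>) = (\<integral>\<^sup>+x. ?G x \<partial>\<rho>)" by (rule nn_integral_plan[OF eg])
    show AE: "AE x in \<rho>. ?G x < \<infinity>"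
      using nn_integral_PInf_AE[OF G] fin eq by (auto simp: less_top)
    have "(\<integral>\<^sup>+x. ennreal (enn2real (?G x)) \<partial>\<rho>) = (\<integral>\<^sup>+x. ?G x \<partial>\<rho>)"
      using AE by (intro nn_integral_cong_AE) (auto simp: less_top)
    then have e: "(\<integral>\<^sup>+x. ennreal (enn2real (?G x)) \<partial>\<rho>) = (\<integral>\<^sup>+p. ennreal (g p) \<partial>\<gamma>)" using eq by simp
    show "integrable \<rho> (\<lambda>x. enn2real (?G x))"
      using G e fin by (intro integrableI_nonneg) auto
    show "(\<integral>x. enn2real (?G x) \<partial>\<rho>) = enn2real (\<integral>\<^sup>+p. ennreal (g p) \<partial>\<gamma>)"
      using G e by (subst integral_eq_nn_integral) auto
  qed
  have fin: "(\<integral>\<^sup>+p. ennreal (f p) \<partial>\<gamma>) < \<infinity>" "(\<integral>\<^sup>+p. ennreal (- f p) \<partial>\<gamma>) < \<infinity>"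
    using int unfolding real_integrable_def by (auto simp: less_top)
  have nf: "(\<lambda>p. - f p) \<in> borel_measurable borel" using f by simp
  note P = part[OF f fin(1)] and N = part[OF nf fin(2)]
  have sec: "(\<lambda>y. f (x, y)) \<in> borel_measurable (\<kappa> x)" for x
  proof -
    have "f \<in> borel_measurable (borel \<Otimes>\<^sub>M borel)" using f by (simp add: measurable_cong_sets[OF sets_borel_prod refl])
    then have "(\<lambda>y. f (x, y)) \<in> borel_measurable borel" by measurable
    then show ?thesis by (rule kernel_borel_measurable)
  qed
  have "AE x in \<rho>. enn2real (\<integral>\<^sup>+y. ennreal (f (x, y)) \<partial>\<kappa> x) - enn2real (\<integral>\<^sup>+y. ennreal (- f (x, y)) \<partial>\<kappa> x)
      = (\<integral>y. f (x, y) \<partial>\<kappa> x)"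
    using P(3) N(3)
  proof eventually_elim
    case (elim x)
    then have "integrable (\<kappa> x) (\<lambda>y. f (x, y))"
      unfolding real_integrable_def using sec by (auto simp: less_top)
    then show ?case by (simp add: real_lebesgue_integral_def)
  qed
  moreover have d: "integrable \<rho> (\<lambda>x. enn2real (\<integral>\<^sup>+y. ennreal (f (x, y)) \<partial>\<kappa> x)
      - enn2real (\<integral>\<^sup>+y. ennreal (- f (x, y)) \<partial>\<kappa> x))"
    using P(1) N(1) by (rule Bochner_Integration.integrable_diff)
  moreover have m: "(\<lambda>x. \<integral>y. f (x, y) \<partial>\<kappa> x) \<in> borel_measurable \<rho>"
  proof -
    have "(\<lambda>x. \<integral>p. f p \<partial>distr (\<kappa> x) borel (Pair x)) \<in> borel_measurable \<rho>"
      by (rule measurable_compose[OF pair_kernel_measurable integral_measurable_subprob_algebra[OF f]])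
    then show ?thesis by (simp add: integral_distr[OF pair_measurable f])
  qed
  ultimately show "integrable \<rho> (\<lambda>x. \<integral>y. f (x, y) \<partial>\<kappa> x)"
    using integrable_cong_AE_imp[OF d m] by (simp add: eq_commute)
  have "(\<integral>x. (\<integral>y. f (x, y) \<partial>\<kappa> x) \<partial>\<rho>)
      = (\<integral>x. enn2real (\<integral>\<^sup>+y. ennreal (f (x, y)) \<partial>\<kappa> x) - enn2real (\<integral>\<^sup>+y. ennreal (- f (x, y)) \<partial>\<kappa> x) \<partial>\<rho>)"
    using \<open>AE x in \<rho>. _ x - _ x = _ x\<close> m d by (intro integral_cong_AE) auto
  also have "\<dots> = (\<integral>p. f p \<partial>\<gamma>)"
    using P(1,2) N(1,2) by (simp add: real_lebesgue_integral_def[OF int])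
  finally show "(\<integral>p. f p \<partial>\<gamma>) = (\<integral>x. (\<integral>y. f (x, y) \<partial>\<kappa> x) \<partial>\<rho>)" by simp
qed

definition average :: "('b \<Rightarrow> real) \<Rightarrow> 'a \<Rightarrow> real" where
  "average h x = (\<integral>y. h y \<partial>\<kappa> x)"

lemma average_L2:
  assumes h: "h \<in> borel_measurable borel" and bd: "\<And>y. \<bar>h y\<bar> \<le> B"
  shows "average h \<in> L2_fun \<rho>"
proof (rule L2_fun_bounded)
  show "finite_measure \<rho>" using prob_\<rho> by (simp add: prob_space_def)
  show "average h \<in> borel_measurable \<rho>"
    unfolding average_def
    by (rule measurable_compose[OF kernel_measurable integral_measurable_subprob_algebra[OF h]])
  show "\<bar>average h x\<bar> \<le> B" for x
  proof -
    interpret k: prob_space "\<kappa> x" by (rule kernel_prob)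
    have "\<bar>average h x\<bar> \<le> (\<integral>y. \<bar>h y\<bar> \<partial>\<kappa> x)"
      unfolding average_def by (rule integral_abs_bound)
    also have "\<dots> \<le> (\<integral>y. B \<partial>\<kappa> x)"
      using bd kernel_borel_measurable[OF h]
      by (intro integral_mono) (auto intro!: k.integrable_const_bound[where B = B])
    finally show ?thesis by (simp add: k.prob_space)
  qed
qed

text \<open>A plan operator and its adjoint act on a bounded function by averaging against the conditional
  laws; this is where the abstract characterisation of the operators becomes a formula.\<close>

lemma plan_operator_inner:
  assumes T: "plan_operator \<rho> \<sigma> \<gamma> T" and u: "u \<in> L2_fun \<rho>"
    and h: "h \<in> borel_measurable borel" and bd: "\<And>y. \<bar>h y\<bar> \<le> B"
  shows "L2_inner \<sigma> (T u) h = L2_inner \<rho> u (average h)"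
proof -
  have hL: "h \<in> L2_fun \<sigma>"
    using h bd prob_\<sigma> sets_\<sigma>
    by (intro L2_fun_bounded[where B = B]) (auto simp: prob_space_def measurable_cong_sets[OF sets_\<sigma> refl])
  have ub: "u \<in> borel_measurable borel"
    using L2_funD(1)[OF u] by (simp add: measurable_cong_sets[OF sets_\<rho> refl])
  interpret \<rho>: prob_space \<rho> by (rule prob_\<rho>)
  have fm: "(\<lambda>(x, y). u x * h y) \<in> borel_measurable borel"
  proof -
    have "(\<lambda>(x, y). u x * h y) \<in> borel_measurable (borel \<Otimes>\<^sub>M borel)" using ub h by measurable
    then show ?thesis by (simp add: measurable_cong_sets[OF sets_borel_prod refl])
  qed
  have "integrable \<rho> (\<lambda>x. u x * 1)"
    by (rule integrable_L2_mult[OF u L2_fun_bounded[where B = 1]])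
       (auto intro: \<rho>.finite_measure_axioms)
  then have "integrable \<gamma> (\<lambda>p. u (fst p))"
    using couplings_measurable_fst_snd(1)[OF plan] couplingsD(3)[OF plan] ub
    by (subst integrable_distr_eq[symmetric]) auto
  then have "integrable \<gamma> (\<lambda>p. B * \<bar>u (fst p)\<bar>)"
    by (intro integrable_mult_right integrable_abs)
  then have int: "integrable \<gamma> (\<lambda>(x, y). u x * h y)"
  proof (rule Bochner_Integration.integrable_bound)
    show "(\<lambda>(x, y). u x * h y) \<in> borel_measurable \<gamma>"
      using fm by (simp add: measurable_cong_sets[OF couplingsD(2)[OF plan] refl])
    have "\<bar>u x * h y\<bar> \<le> \<bar>B * \<bar>u x\<bar>\<bar>" for x y
    proof -
      have "\<bar>u x\<bar> * \<bar>h y\<bar> \<le> \<bar>u x\<bar> * B" by (intro mult_left_mono bd) simp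
      also have "\<bar>u x\<bar> * B \<le> \<bar>B * \<bar>u x\<bar>\<bar>" using abs_ge_self[of "\<bar>u x\<bar> * B"] by (simp add: mult.commute)
      finally show ?thesis by (simp add: abs_mult)
    qed
    then show "AE p in \<gamma>. norm (case p of (x, y) \<Rightarrow> u x * h y) \<le> norm (B * \<bar>u (fst p)\<bar>)"
      by (auto split: prod.split)
  qed
  have "L2_inner \<sigma> (T u) h = (\<integral>(x, y). u x * h y \<partial>\<gamma>)"
    using T u hL unfolding plan_operator_def L2_inner_def by blast
  also have "\<dots> = L2_inner \<rho> u (average h)"
    by (simp add: integral_plan(2)[OF fm int] L2_inner_def average_def)
  finally show ?thesis .
qed

lemma plan_operator_adjoint:
  assumes T: "plan_operator \<rho> \<sigma> \<gamma> T" and S: "L2_adjoint \<rho> \<sigma> T S"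
    and h: "h \<in> borel_measurable borel" and bd: "\<And>y. \<bar>h y\<bar> \<le> B"
  shows "AE x in \<rho>. S h x = average h x" "S h \<in> L2_fun \<rho>"
proof -
  have hL: "h \<in> L2_fun \<sigma>"
    using h bd prob_\<sigma> sets_\<sigma>
    by (intro L2_fun_bounded[where B = B]) (auto simp: prob_space_def measurable_cong_sets[OF sets_\<sigma> refl])
  show Sh: "S h \<in> L2_fun \<rho>" using S hL unfolding L2_adjoint_def by blast
  show "AE x in \<rho>. S h x = average h x"
  proof (rule L2_eq_AE_if_inner_eq[OF Sh average_L2[OF h bd]])
    fix w assume w: "w \<in> L2_fun \<rho>"
    have "L2_inner \<rho> w (S h) = L2_inner \<sigma> (T w) h"
      using S hL w unfolding L2_adjoint_def by blast
    also have "\<dots> = L2_inner \<rho> w (average h)"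
      by (rule plan_operator_inner[OF T w h bd])
    finally show "L2_inner \<rho> w (S h) = L2_inner \<rho> w (average h)" .
  qed
qed

end

section \<open>Empirical measures\<close>

lemma empirical_measure_prob:
  assumes "1 \<le> N"
  shows "borel_prob (empirical_measure N z)"
proof -
  have "prob_space (uniform_count_measure {..<N})"
    using assms by (intro prob_space_uniform_count_measure) (auto simp: lessThan_empty_iff)
  then have "prob_space (empirical_measure N z)"
    unfolding empirical_measure_def
    by (rule prob_space.prob_space_distr) (simp add: measurable_def sets_uniform_count_measure space_uniform_count_measure)
  then show ?thesis by (simp add: borel_prob_def empirical_measure_def)
qed

lemma measurable_uniform_count: "z \<in> measurable (uniform_count_measure A) borel"
  by (simp add: measurable_def sets_uniform_count_measure space_uniform_count_measure)

lemma integral_empirical: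
  fixes f :: "'a::topological_space \<Rightarrow> real"
  assumes "f \<in> borel_measurable borel"
  shows "(\<integral>x. f x \<partial>empirical_measure N z) = (\<Sum>i<N. f (z i)) / real N"
  unfolding empirical_measure_def
  by (simp add: integral_distr[OF measurable_uniform_count assms] integral_uniform_count_measure)

lemma distr_empirical:
  assumes "f \<in> borel_measurable borel"
  shows "distr (empirical_measure N z) borel f = empirical_measure N (\<lambda>i. f (z i))"
  unfolding empirical_measure_def
  using distr_distr[OF assms measurable_uniform_count] by (simp add: comp_def)

lemma measure_empirical_ball:
  assumes "1 \<le> N"
  shows "measure (empirical_measure N x) (ball a r) = ball_count r {..<N} x a / real N"
proof -
  have i: "(indicator (ball a r) :: _ \<Rightarrow> real) \<in> borel_measurable borel"
    by (rule borel_measurable_indicator) simp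
  have "space (empirical_measure N x) = UNIV" by (simp add: empirical_measure_def)
  then have eq: "measure (empirical_measure N x) (ball a r) = (\<integral>y. indicator (ball a r) y \<partial>empirical_measure N x)"
    by simp
  show ?thesis unfolding eq integral_empirical[OF i] ball_count_def ..
qed

text \<open>The two directions of every estimate come from one argument, applied to the potentials and to their
  exchange.\<close>

lemma entropic_kernel_empirical:
  fixes c :: "'a::metric_space \<Rightarrow> 'a \<Rightarrow> real"
  assumes comp: "compact (UNIV :: 'a set)" and N: "1 \<le> N"
    and c: "continuous_on UNIV (\<lambda>(x, y). c x y)" "\<And>x y. c x y = c y x"
      "\<And>x x' y. \<bar>c x y - c x' y\<bar> \<le> L * dist x x'" and L: "0 \<le> L"
    and eps: "0 < \<epsilon>" and k: "entropic_kernel c \<epsilon> \<rho> \<rho> k" and \<rho>: "\<rho> = empirical_measure N x"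
    and m: "0 < m" and mass: "\<forall>i<N. m \<le> measure \<rho> (ball (x i) \<epsilon>)"
  defines "K \<equiv> exp (2 * L) / m"
  shows "0 < k a b" "continuous_on UNIV (\<lambda>a. k a b)" "continuous_on UNIV (\<lambda>b. k a b)"
    and "(\<Sum>i<N. k a (x i)) / real N = 1" "(\<Sum>i<N. k (x i) b) / real N = 1"
    and "i < N \<Longrightarrow> k a (x i) \<le> K" "i < N \<Longrightarrow> k (x i) b \<le> K"
    and "i < N \<Longrightarrow> \<bar>k a (x i) - k a' (x i)\<bar> \<le> 2 * L / \<epsilon> * K * dist a a'"
    and "i < N \<Longrightarrow> \<bar>k (x i) b - k (x i) b'\<bar> \<le> 2 * L / \<epsilon> * K * dist b b'"
proof -
  obtain \<alpha> \<beta> where p: "schroedinger_potentials c \<epsilon> \<rho> \<rho> \<alpha> \<beta>"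
    and kd: "k = (\<lambda>x y. exp ((\<alpha> x + \<beta> y - c x y) / \<epsilon>))"
    using entropic_kernel_potentials[OF k] by blast
  have bp: "borel_prob \<rho>" unfolding \<rho> by (rule empirical_measure_prob[OF N])
  interpret S: schroedinger c \<epsilon> L \<rho> \<rho> \<alpha> \<beta>
    using comp c eps bp p by unfold_locales auto
  interpret S': schroedinger c \<epsilon> L \<rho> \<rho> \<beta> \<alpha>
    by (rule S.swap)
  have kS: "k = S.k" by (simp add: kd S.k_def fun_eq_iff)
  have kS': "k a b = S'.k b a" for a b by (simp add: S.swap_k kS)
  show "0 < k a b" "continuous_on UNIV (\<lambda>a. k a b)" "continuous_on UNIV (\<lambda>b. k a b)"
    by (simp_all add: kS S.k_pos S.cont_k)
  have "(\<lambda>b. k a b) \<in> borel_measurable borel" "(\<lambda>a. k a b) \<in> borel_measurable borel"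
    by (simp_all add: kS S.cont_k borel_measurable_continuous_onI)
  note m' = this[unfolded kS]
  show "(\<Sum>i<N. k a (x i)) / real N = 1"
    using S.k_integral[of a] integral_empirical[OF m'(1), of N x] by (simp add: kS \<rho>)
  show "(\<Sum>i<N. k (x i) b) / real N = 1"
    using S.k_integral_first[of b] integral_empirical[OF m'(2), of N x] by (simp add: kS \<rho>)
  show b1: "k a (x i) \<le> K" if "i < N" for a i
    unfolding K_def kS by (rule S.k_bound[OF m mass[rule_format, OF that] L])
  show b2: "k (x i) b \<le> K" if "i < N" for b i
    unfolding K_def kS' by (rule S'.k_bound[OF m mass[rule_format, OF that] L])
  show "\<bar>k a (x i) - k a' (x i)\<bar> \<le> 2 * L / \<epsilon> * K * dist a a'" if "i < N"
    using S.k_lipschitz[OF _ L, of "x i" K a a'] b1[OF that] by (simp add: kS)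
  show "\<bar>k (x i) b - k (x i) b'\<bar> \<le> 2 * L / \<epsilon> * K * dist b b'" if "i < N"
    using S'.k_lipschitz[OF _ L, of "x i" K b b'] b2[OF that] by (simp add: kS')
qed

section \<open>Averaging along an optimal plan\<close>

lemma couplings_swap:
  fixes \<rho> \<sigma> :: "'a::second_countable_topology measure"
  assumes "\<gamma> \<in> couplings \<rho> \<sigma>"
  shows "distr \<gamma> borel prod.swap \<in> couplings \<sigma> \<rho>"
proof -
  have m: "prod.swap \<in> measurable \<gamma> borel"
    using borel_measurable_continuous_onI[OF continuous_on_swap[of UNIV]]
    by (simp add: measurable_cong_sets[OF couplingsD(2)[OF assms] refl])
  have fs: "fst \<in> measurable borel borel" "snd \<in> measurable borel borel"
    by (auto intro!: borel_measurable_continuous_onI continuous_intros)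
  show ?thesis
    using couplingsD[OF assms] prob_space.prob_space_distr[OF couplingsD(1)[OF assms] m]
    by (simp add: couplings_def borel_prob_def distr_distr[OF fs(1) m] distr_distr[OF fs(2) m] comp_def)
qed

lemma sq_cost_swap:
  fixes \<rho> \<sigma> :: "'a::{metric_space, second_countable_topology} measure"
  assumes "\<gamma> \<in> couplings \<rho> \<sigma>"
  shows "sq_cost (distr \<gamma> borel prod.swap) = sq_cost \<gamma>"
proof -
  have m: "prod.swap \<in> measurable \<gamma> borel"
    using borel_measurable_continuous_onI[OF continuous_on_swap[of UNIV]]
    by (simp add: measurable_cong_sets[OF couplingsD(2)[OF assms] refl])
  have d: "(\<lambda>p. (dist (fst p) (snd p))\<^sup>2) \<in> borel_measurable (borel :: ('a \<times> 'a) measure)"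
    by (intro borel_measurable_continuous_onI continuous_intros)
  show ?thesis
    unfolding sq_cost_def by (simp add: integral_distr[OF m d] dist_commute)
qed

lemma sq_cost_nonneg: "0 \<le> sq_cost \<gamma>"
  by (simp add: sq_cost_def)

text \<open>The plan runs from \<open>\<rho>\<close> to \<open>\<sigma>\<close> and the distance in the other direction; swapping coordinates
  reconciles them.\<close>

lemma optimal_plan_cost_le_W2:
  fixes \<rho> \<sigma> :: "'a::{metric_space, second_countable_topology} measure"
  assumes "optimal_plan \<rho> \<sigma> \<gamma>"
  shows "sq_cost \<gamma> \<le> (W2 \<sigma> \<rho>)\<^sup>2"
proof -
  have \<gamma>: "\<gamma> \<in> couplings \<rho> \<sigma>" and opt: "\<And>\<gamma>'. \<gamma>' \<in> couplings \<rho> \<sigma> \<Longrightarrow> sq_cost \<gamma> \<le> sq_cost \<gamma>'"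
    using assms by (auto simp: optimal_plan_def)
  have le: "sq_cost \<gamma> \<le> (INF \<gamma>'\<in>couplings \<sigma> \<rho>. sq_cost \<gamma>')"
  proof (rule cINF_greatest)
    show "couplings \<sigma> \<rho> \<noteq> {}" using couplings_swap[OF \<gamma>] by blast
    show "sq_cost \<gamma> \<le> sq_cost \<gamma>'" if "\<gamma>' \<in> couplings \<sigma> \<rho>" for \<gamma>'
      using opt[OF couplings_swap[OF that]] sq_cost_swap[OF that] by simp
  qed
  then have "0 \<le> (INF \<gamma>'\<in>couplings \<sigma> \<rho>. sq_cost \<gamma>')"
    using sq_cost_nonneg[of \<gamma>] by linarith
  then show ?thesis using le by (simp add: W2_def)
qed

locale disintegrated_self_plan = disintegrated_plan \<gamma> \<rho> \<sigma> \<kappa>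
  for \<gamma> :: "('a::{metric_space, second_countable_topology} \<times> 'a) measure" and \<rho> \<sigma> \<kappa> +
  assumes compact_UNIV: "compact (UNIV :: 'a set)"
begin

definition mean_sq_dist :: "'a \<Rightarrow> real" where
  "mean_sq_dist x = (\<integral>y. (dist x y)\<^sup>2 \<partial>\<kappa> x)"

lemma mean_sq_dist_integral:
  "integrable \<rho> mean_sq_dist" "(\<integral>x. mean_sq_dist x \<partial>\<rho>) = sq_cost \<gamma>"
proof -
  have cont: "continuous_on UNIV (\<lambda>p::'a \<times> 'a. (dist (fst p) (snd p))\<^sup>2)"
    by (intro continuous_intros)
  have "compact (UNIV :: ('a \<times> 'a) set)"
    using compact_Times[OF compact_UNIV compact_UNIV] by simp
  then have int: "integrable \<gamma> (\<lambda>p. (dist (fst p) (snd p))\<^sup>2)"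
    using plan by (intro continuous_integrable cont) (auto simp: couplings_def)
  show "integrable \<rho> mean_sq_dist" "(\<integral>x. mean_sq_dist x \<partial>\<rho>) = sq_cost \<gamma>"
    using integral_plan[OF borel_measurable_continuous_onI[OF cont] int]
    by (simp_all add: mean_sq_dist_def[abs_def] sq_cost_def)
qed

text \<open>Jensen's inequality in the form of Cauchy--Schwarz against the constant one, for the conditional law at
  \<open>x\<close>.\<close>

lemma average_deviation:
  assumes h: "\<And>y y'. \<bar>h y - h y'\<bar> \<le> A * dist y y'" and A: "0 \<le> A"
  shows "\<bar>average h x - h x\<bar> \<le> A * sqrt (mean_sq_dist x)"
proof -
  interpret k: prob_space "\<kappa> x" by (rule kernel_prob)
  have bp: "borel_prob (\<kappa> x)" using kernel_prob kernel_sets by (simp add: borel_prob_def)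
  have "A-lipschitz_on UNIV h"
    using h A by (intro lipschitz_onI) (auto simp: dist_real_def)
  then have ch: "continuous_on UNIV h" by (rule lipschitz_on_continuous_on)
  have int: "integrable (\<kappa> x) f" if "continuous_on UNIV f" for f :: "'a \<Rightarrow> real"
    by (rule continuous_integrable[OF compact_UNIV that bp])
  have dL: "(\<lambda>y. dist x y) \<in> L2_fun (\<kappa> x)"
    unfolding L2_fun_def
    by (auto intro!: int borel_measurable_integrable continuous_intros)
  have oL: "(\<lambda>y. 1) \<in> L2_fun (\<kappa> x)"
    by (auto simp: L2_fun_def)
  have "average h x - h x = (\<integral>y. h y - h x \<partial>\<kappa> x)"
    using int[OF ch] by (simp add: average_def k.prob_space)
  then have "\<bar>average h x - h x\<bar> \<le> (\<integral>y. \<bar>h y - h x\<bar> \<partial>\<kappa> x)"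
    using integral_abs_bound[of "\<kappa> x" "\<lambda>y. h y - h x"] by simp
  also have "\<dots> \<le> (\<integral>y. A * dist x y \<partial>\<kappa> x)"
    using h[of _ x] ch by (intro integral_mono int continuous_intros) (auto simp: dist_commute)
  also have "\<dots> = A * L2_inner (\<kappa> x) (\<lambda>y. dist x y) (\<lambda>y. 1)"
    by (simp add: L2_inner_def)
  also have "\<dots> \<le> A * (L2_norm (\<kappa> x) (\<lambda>y. dist x y) * L2_norm (\<kappa> x) (\<lambda>y. 1))"
    using L2_Cauchy_Schwarz[OF dL oL] A by (intro mult_left_mono) auto
  also have "\<dots> = A * sqrt (mean_sq_dist x)"
    by (simp add: L2_norm_def mean_sq_dist_def k.prob_space)
  finally show ?thesis .
qed

lemma mean_sq_dist_nonneg: "0 \<le> mean_sq_dist x"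
  by (simp add: mean_sq_dist_def)

end

section \<open>Comparison of the two operators\<close>

lemma continuous_L2_fun:
  fixes f :: "'a::metric_space \<Rightarrow> real"
  assumes "compact (UNIV :: 'a set)" "continuous_on UNIV f" "borel_prob \<rho>"
  shows "f \<in> L2_fun \<rho>"
  unfolding L2_fun_def using assms
  by (auto intro!: continuous_integrable borel_measurable_integrable continuous_intros)

text \<open>The deterministic part: a fixed sample whose empirical marginals give mass at least \<open>m\<mu>\<close> and
  \<open>m\<nu>\<close> to the balls of radius \<open>\<epsilon>\<close> around the sample points.\<close>

locale operator_comparison =
  fixes c :: "'a::{metric_space, second_countable_topology} \<Rightarrow> 'a \<Rightarrow> real" and \<epsilon> L :: real
    and N :: nat and z :: "nat \<Rightarrow> 'a \<times> 'a" and \<mu> \<nu> :: "'a measure"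
    and m\<mu> m\<nu> :: real and k\<mu> k\<nu> :: "'a \<Rightarrow> 'a \<Rightarrow> real"
    and \<gamma>\<mu> \<gamma>\<nu> :: "('a \<times> 'a) measure" and \<kappa>\<mu> \<kappa>\<nu> :: "'a \<Rightarrow> 'a measure"
    and \<mu>N \<nu>N :: "'a measure"
  assumes compact_UNIV: "compact (UNIV :: 'a set)" and N: "1 \<le> N"
    and c: "continuous_on UNIV (\<lambda>(x, y). c x y)" "\<And>x y. c x y = c y x"
      "\<And>x x' y. \<bar>c x y - c x' y\<bar> \<le> L * dist x x'" and L: "0 \<le> L" and eps: "0 < \<epsilon>"
    and \<mu>N: "\<mu>N = distr (empirical_measure N z) borel fst"
    and \<nu>N: "\<nu>N = distr (empirical_measure N z) borel snd"
    and mass_\<mu>: "0 < m\<mu>" "\<forall>i<N. m\<mu> \<le> measure \<mu>N (ball (fst (z i)) \<epsilon>)"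
    and mass_\<nu>: "0 < m\<nu>" "\<forall>i<N. m\<nu> \<le> measure \<nu>N (ball (snd (z i)) \<epsilon>)"
    and k\<mu>: "entropic_kernel c \<epsilon> \<mu>N \<mu>N k\<mu>" and k\<nu>: "entropic_kernel c \<epsilon> \<nu>N \<nu>N k\<nu>"
    and opt_\<mu>: "optimal_plan \<mu> \<mu>N \<gamma>\<mu>" and opt_\<nu>: "optimal_plan \<nu> \<nu>N \<gamma>\<nu>"
    and dis_\<mu>: "disintegration \<gamma>\<mu> \<mu> \<kappa>\<mu>" and dis_\<nu>: "disintegration \<gamma>\<nu> \<nu> \<kappa>\<nu>"
begin

sublocale P\<mu>: disintegrated_self_plan \<gamma>\<mu> \<mu> \<mu>N \<kappa>\<mu>
  using opt_\<mu> dis_\<mu> compact_UNIV by unfold_locales (auto simp: optimal_plan_def)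

sublocale P\<nu>: disintegrated_self_plan \<gamma>\<nu> \<nu> \<nu>N \<kappa>\<nu>
  using opt_\<nu> dis_\<nu> compact_UNIV by unfold_locales (auto simp: optimal_plan_def)

lemma \<mu>N_empirical: "\<mu>N = empirical_measure N (\<lambda>i. fst (z i))"
  and \<nu>N_empirical: "\<nu>N = empirical_measure N (\<lambda>i. snd (z i))"
proof -
  have "(fst :: 'a \<times> 'a \<Rightarrow> 'a) \<in> measurable borel borel" "(snd :: 'a \<times> 'a \<Rightarrow> 'a) \<in> measurable borel borel"
    by (auto intro!: borel_measurable_continuous_onI continuous_intros)
  then show "\<mu>N = empirical_measure N (\<lambda>i. fst (z i))" "\<nu>N = empirical_measure N (\<lambda>i. snd (z i))"
    unfolding \<mu>N \<nu>N by (simp_all add: distr_empirical)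
qed

lemmas k\<mu>_facts = entropic_kernel_empirical[OF compact_UNIV N c L eps k\<mu> \<mu>N_empirical mass_\<mu>]
lemmas k\<nu>_facts = entropic_kernel_empirical[OF compact_UNIV N c L eps k\<nu> \<nu>N_empirical mass_\<nu>]

text \<open>The \<open>i\<close>-th sample point contributes the rank one term \<open>f\<^sub>i(x) g\<^sub>i(y) / N\<close> to the kernel.\<close>

definition f :: "nat \<Rightarrow> 'a \<Rightarrow> real" where "f i x = k\<mu> x (fst (z i))"
definition g :: "nat \<Rightarrow> 'a \<Rightarrow> real" where "g i y = k\<nu> (snd (z i)) y"
abbreviation F :: "nat \<Rightarrow> 'a \<Rightarrow> real" where "F i \<equiv> P\<mu>.average (f i)"
abbreviation G :: "nat \<Rightarrow> 'a \<Rightarrow> real" where "G i \<equiv> P\<nu>.average (g i)"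

lemma fg_continuous: "continuous_on UNIV (f i)" "continuous_on UNIV (g i)"
  unfolding f_def g_def by (rule k\<mu>_facts k\<nu>_facts)+

lemma fg_measurable: "f i \<in> borel_measurable borel" "g i \<in> borel_measurable borel"
  by (intro borel_measurable_continuous_onI fg_continuous)+

lemma fg_pos: "0 < f i x" "0 < g i y"
  unfolding f_def g_def by (rule k\<mu>_facts k\<nu>_facts)+

lemma fg_sum: "(\<Sum>i<N. f i x) / real N = 1" "(\<Sum>i<N. g i y) / real N = 1"
  unfolding f_def g_def by (rule k\<mu>_facts k\<nu>_facts)+

lemma fg_bounded:
  assumes "i < N"
  shows "\<bar>f i x\<bar> \<le> exp (2 * L) / m\<mu>" "\<bar>g i y\<bar> \<le> exp (2 * L) / m\<nu>"
  using k\<mu>_facts(6)[OF assms] k\<nu>_facts(7)[OF assms] fg_pos[of i]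
  by (simp_all add: f_def g_def abs_of_pos)

lemma marginal_probs: "borel_prob \<mu>" "borel_prob \<mu>N" "borel_prob \<nu>" "borel_prob \<nu>N"
  using couplings_marginals[OF P\<mu>.plan] couplings_marginals[OF P\<nu>.plan] by auto

lemma fg_L2: "f i \<in> L2_fun \<mu>" "f i \<in> L2_fun \<mu>N" "g i \<in> L2_fun \<nu>" "g i \<in> L2_fun \<nu>N"
  by (intro continuous_L2_fun compact_UNIV fg_continuous marginal_probs)+

lemma FG_L2: assumes "i < N" shows "F i \<in> L2_fun \<mu>" "G i \<in> L2_fun \<nu>"
  by (rule P\<mu>.average_L2[OF fg_measurable(1) fg_bounded(1)[OF assms]]
      P\<nu>.average_L2[OF fg_measurable(2) fg_bounded(2)[OF assms]])+

text \<open>Since \<open>\<pi>\<^sub>N\<close> is a finite sum of point masses, both kernels have finite rank.\<close>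

lemma t_kernel_eq:
  "t_kernel k\<mu> k\<nu> (empirical_measure N z) x y = (\<Sum>i<N. f i x * g i y) / real N"
proof -
  have "continuous_on UNIV (\<lambda>p::'a \<times> 'a. k\<mu> x (fst p) * k\<nu> (snd p) y)"
    by (intro continuous_intros continuous_on_compose2[OF k\<mu>_facts(3)]
        continuous_on_compose2[OF k\<nu>_facts(2)]) auto
  from integral_empirical[OF borel_measurable_continuous_onI[OF this], of N z]
  show ?thesis
    by (simp add: t_kernel_def f_def g_def case_prod_beta')
qed

lemma integrable_kernel:
  assumes "continuous_on UNIV h"
  shows "integrable (\<kappa>\<mu> x) (h :: 'a \<Rightarrow> real)" "integrable (\<kappa>\<nu> x) h"
  using P\<mu>.kernel_prob P\<mu>.kernel_sets P\<nu>.kernel_prob P\<nu>.kernel_sets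
  by (auto intro!: continuous_integrable[OF compact_UNIV assms] simp: borel_prob_def)

lemma tA_kernel_eq:
  "tA_kernel \<kappa>\<mu> \<kappa>\<nu> (t_kernel k\<mu> k\<nu> (empirical_measure N z)) x y = (\<Sum>i<N. F i x * G i y) / real N"
proof -
  have "(\<integral>y'. t_kernel k\<mu> k\<nu> (empirical_measure N z) x' y' \<partial>\<kappa>\<nu> y) = (\<Sum>i<N. f i x' * G i y) / real N" for x'
    by (simp add: t_kernel_eq P\<nu>.average_def Bochner_Integration.integral_sum integrable_kernel fg_continuous)
  then show ?thesis
    by (simp add: tA_kernel_def P\<mu>.average_def Bochner_Integration.integral_sum integrable_kernel fg_continuous)
qed

lemma G_sum: "(\<Sum>i<N. G i y) / real N = 1"
proof -
  interpret prob_space "\<kappa>\<nu> y" by (rule P\<nu>.kernel_prob)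
  have "(\<Sum>i<N. G i y) / real N = (\<integral>y'. (\<Sum>i<N. g i y') / real N \<partial>\<kappa>\<nu> y)"
    by (simp add: P\<nu>.average_def Bochner_Integration.integral_sum integrable_kernel fg_continuous)
  then show ?thesis by (simp add: fg_sum prob_space)
qed

lemma lipschitz_const_nonneg: "0 \<le> 2 * L / \<epsilon> * (exp (2 * L) / m\<mu>)"
  using L eps mass_\<mu>(1) by (intro mult_nonneg_nonneg divide_nonneg_pos) auto

lemma G_nonneg: "0 \<le> G i y"
  unfolding P\<nu>.average_def using fg_pos(2) by (intro integral_nonneg_AE) (auto intro: less_imp_le)

text \<open>Telescoping through \<open>\<Sum> f\<^sub>i G\<^sub>i\<close>, each difference costs one Lipschitz constant only, since the
  accompanying factors average to one.\<close>

lemma kernel_deviation: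
  assumes A: "2 * L / \<epsilon> * (exp (2 * L) / m\<mu>) \<le> A" "2 * L / \<epsilon> * (exp (2 * L) / m\<nu>) \<le> A"
  shows "\<bar>(\<Sum>i<N. F i x * G i y) / real N - (\<Sum>i<N. f i x * g i y) / real N\<bar>
    \<le> A * sqrt (P\<mu>.mean_sq_dist x) + A * sqrt (P\<nu>.mean_sq_dist y)"
proof -
  let ?a = "sqrt (P\<mu>.mean_sq_dist x)" and ?b = "sqrt (P\<nu>.mean_sq_dist y)"
  have ab: "0 \<le> ?a" "0 \<le> ?b"
    by (simp_all add: P\<mu>.mean_sq_dist_nonneg P\<nu>.mean_sq_dist_nonneg)
  have A0: "0 \<le> A" by (rule order.trans[OF lipschitz_const_nonneg A(1)])
  have lip_f: "\<bar>f i u - f i v\<bar> \<le> A * dist u v" if "i < N" for i u v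
    unfolding f_def
    by (rule order.trans[OF k\<mu>_facts(8)[OF that] mult_right_mono[OF A(1) zero_le_dist]])
  have lip_g: "\<bar>g i u - g i v\<bar> \<le> A * dist u v" if "i < N" for i u v
    unfolding g_def
    by (rule order.trans[OF k\<nu>_facts(9)[OF that] mult_right_mono[OF A(2) zero_le_dist]])
  have dF: "\<bar>F i x - f i x\<bar> \<le> A * ?a" if "i < N" for i
    by (rule P\<mu>.average_deviation[OF lip_f[OF that] A0])
  have dG: "\<bar>G i y - g i y\<bar> \<le> A * ?b" if "i < N" for i
    by (rule P\<nu>.average_deviation[OF lip_g[OF that] A0])
  have "F i x * G i y - f i x * g i y = (F i x - f i x) * G i y + f i x * (G i y - g i y)" for i
    by (simp add: algebra_simps)
  then have telescope: "(\<Sum>i<N. F i x * G i y) / real N - (\<Sum>i<N. f i x * g i y) / real N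
      = (\<Sum>i<N. (F i x - f i x) * G i y + f i x * (G i y - g i y)) / real N"
    by (simp only: diff_divide_distrib[symmetric] sum_subtractf[symmetric])
  have "\<bar>(\<Sum>i<N. (F i x - f i x) * G i y + f i x * (G i y - g i y)) / real N\<bar>
      = \<bar>\<Sum>i<N. (F i x - f i x) * G i y + f i x * (G i y - g i y)\<bar> / real N"
    by (simp only: abs_divide abs_of_nat)
  also have "\<dots> \<le> (\<Sum>i<N. \<bar>(F i x - f i x) * G i y + f i x * (G i y - g i y)\<bar>) / real N"
    by (rule divide_right_mono[OF sum_abs]) simp
  also have "\<dots> \<le> (\<Sum>i<N. A * ?a * G i y + f i x * (A * ?b)) / real N"
  proof (rule divide_right_mono[OF sum_mono])
    fix i assume "i \<in> {..<N}"
    then have i: "i < N" by simp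
    have "\<bar>(F i x - f i x) * G i y\<bar> \<le> A * ?a * G i y"
      using dF[OF i] G_nonneg[of i y] by (simp add: abs_mult mult_right_mono)
    moreover have "\<bar>f i x * (G i y - g i y)\<bar> \<le> f i x * (A * ?b)"
      using dG[OF i] fg_pos(1)[of i x] by (simp add: abs_mult mult_left_mono)
    ultimately show "\<bar>(F i x - f i x) * G i y + f i x * (G i y - g i y)\<bar> \<le> A * ?a * G i y + f i x * (A * ?b)"
      by linarith
  qed simp
  also have "\<dots> = A * ?a * ((\<Sum>i<N. G i y) / real N) + ((\<Sum>i<N. f i x) / real N) * (A * ?b)"
    by (simp only: sum.distrib sum_distrib_left[symmetric] sum_distrib_right[symmetric]
        add_divide_distrib times_divide_eq_right times_divide_eq_left)
  finally show ?thesis unfolding telescope G_sum fg_sum by simp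
qed

text \<open>The cross term of the squared pointwise bound is absorbed by \<open>(a + b)\<^sup>2 \<le> 2 (a\<^sup>2 + b\<^sup>2)\<close>; the
  factor 2 in the conclusion rounds up the resulting \<open>\<surd>2\<close>.\<close>

lemma kernel_deviation_L2:
  assumes A: "2 * L / \<epsilon> * (exp (2 * L) / m\<mu>) \<le> A" "2 * L / \<epsilon> * (exp (2 * L) / m\<nu>) \<le> A"
  defines "d \<equiv> \<lambda>(x, y). (\<Sum>i<N. F i x * G i y) / real N - (\<Sum>i<N. f i x * g i y) / real N"
  assumes d: "d \<in> L2_fun (\<mu> \<Otimes>\<^sub>M \<nu>)"
  shows "L2_norm (\<mu> \<Otimes>\<^sub>M \<nu>) d \<le> 2 * A * sqrt ((W2 \<mu>N \<mu>)\<^sup>2 + (W2 \<nu>N \<nu>)\<^sup>2)"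
proof -
  interpret \<mu>: prob_space \<mu> by (rule P\<mu>.prob_\<rho>)
  interpret \<nu>: prob_space \<nu> by (rule P\<nu>.prob_\<rho>)
  interpret PP: pair_prob_space \<mu> \<nu> ..
  let ?S = "(W2 \<mu>N \<mu>)\<^sup>2 + (W2 \<nu>N \<nu>)\<^sup>2"
  have A0: "0 \<le> A" by (rule order.trans[OF lipschitz_const_nonneg A(1)])
  have one: "integrable \<mu> (\<lambda>x. 1::real)" "integrable \<nu> (\<lambda>y. 1::real)" by simp_all
  have i1: "integrable (\<mu> \<Otimes>\<^sub>M \<nu>) (\<lambda>(x, y). P\<mu>.mean_sq_dist x * 1)"
    and e1: "(\<integral>(x, y). P\<mu>.mean_sq_dist x * 1 \<partial>(\<mu> \<Otimes>\<^sub>M \<nu>)) = sq_cost \<gamma>\<mu>"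
    using PP.integrable_tensor[OF P\<mu>.mean_sq_dist_integral(1) one(2)]
      PP.integral_tensor[OF P\<mu>.mean_sq_dist_integral(1) one(2)] P\<mu>.mean_sq_dist_integral(2)
    by (simp_all add: \<nu>.prob_space)
  have i2: "integrable (\<mu> \<Otimes>\<^sub>M \<nu>) (\<lambda>(x, y). 1 * P\<nu>.mean_sq_dist y)"
    and e2: "(\<integral>(x, y). 1 * P\<nu>.mean_sq_dist y \<partial>(\<mu> \<Otimes>\<^sub>M \<nu>)) = sq_cost \<gamma>\<nu>"
    using PP.integrable_tensor[OF one(1) P\<nu>.mean_sq_dist_integral(1)]
      PP.integral_tensor[OF one(1) P\<nu>.mean_sq_dist_integral(1)] P\<nu>.mean_sq_dist_integral(2)
    by (simp_all add: \<mu>.prob_space)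
  let ?r = "\<lambda>p. 2 * A\<^sup>2 * ((\<lambda>(x, y). P\<mu>.mean_sq_dist x * 1) p + (\<lambda>(x, y). 1 * P\<nu>.mean_sq_dist y) p)"
  have "(\<integral>p. (d p)\<^sup>2 \<partial>(\<mu> \<Otimes>\<^sub>M \<nu>)) \<le> (\<integral>p. ?r p \<partial>(\<mu> \<Otimes>\<^sub>M \<nu>))"
  proof (rule integral_mono)
    show "integrable (\<mu> \<Otimes>\<^sub>M \<nu>) (\<lambda>p. (d p)\<^sup>2)" by (rule L2_funD(2)[OF d])
    show "integrable (\<mu> \<Otimes>\<^sub>M \<nu>) ?r"
      by (intro integrable_mult_right Bochner_Integration.integrable_add i1 i2)
    fix p :: "'a \<times> 'a"
    obtain x y where p: "p = (x, y)" by fastforce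
    let ?a = "sqrt (P\<mu>.mean_sq_dist x)" and ?b = "sqrt (P\<nu>.mean_sq_dist y)"
    have "\<bar>d p\<bar> \<le> A * ?a + A * ?b"
      using kernel_deviation[OF A, of x y] by (simp add: p d_def)
    then have "\<bar>d p\<bar>\<^sup>2 \<le> (A * ?a + A * ?b)\<^sup>2"
      by (intro power_mono) auto
    also have "\<dots> \<le> 2 * ((A * ?a)\<^sup>2 + (A * ?b)\<^sup>2)"
      using sum_squares_bound[of "A * ?a" "A * ?b"] by (simp add: power2_sum)
    also have "\<dots> = ?r p"
      using P\<mu>.mean_sq_dist_nonneg[of x] P\<nu>.mean_sq_dist_nonneg[of y]
      by (simp add: p power_mult_distrib algebra_simps)
    finally show "(d p)\<^sup>2 \<le> ?r p" by simp
  qed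
  also have "\<dots> = 2 * A\<^sup>2 * (sq_cost \<gamma>\<mu> + sq_cost \<gamma>\<nu>)"
    using i1 i2 e1 e2 by (simp add: Bochner_Integration.integral_add)
  also have "\<dots> \<le> 2 * A\<^sup>2 * ?S"
    by (intro mult_left_mono add_mono optimal_plan_cost_le_W2 opt_\<mu> opt_\<nu>) simp
  also have "\<dots> \<le> (2 * A)\<^sup>2 * ?S"
    by (intro mult_right_mono) (auto simp: power_mult_distrib)
  finally have "L2_norm (\<mu> \<Otimes>\<^sub>M \<nu>) d \<le> sqrt ((2 * A)\<^sup>2 * ?S)"
    unfolding L2_norm_def by (rule real_sqrt_le_mono)
  then show ?thesis using A0 by (simp add: real_sqrt_mult)
qed

text \<open>The inner product of \<open>T\<mu> u\<close> with \<open>f\<^sub>i\<close> is that of \<open>u\<close> with \<open>F\<^sub>i\<close>, and the adjoint of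
  \<open>T\<nu>\<close> turns \<open>g\<^sub>i\<close> into \<open>G\<^sub>i\<close>.\<close>

lemma composed_operator_AE:
  assumes T\<mu>: "plan_operator \<mu> \<mu>N \<gamma>\<mu> T\<mu>" and T\<nu>: "plan_operator \<nu> \<nu>N \<gamma>\<nu> T\<nu>"
    and adj: "L2_adjoint \<nu> \<nu>N T\<nu> T\<nu>_adj" and u: "u \<in> L2_fun \<mu>"
  defines "TA \<equiv> T\<nu>_adj \<circ> integral_operator \<mu>N (t_kernel k\<mu> k\<nu> (empirical_measure N z)) \<circ> T\<mu>"
  shows "TA u \<in> L2_fun \<nu>" "AE y in \<nu>. TA u y = (\<Sum>i<N. L2_inner \<mu> u (F i) * (G i y / real N))"
proof -
  define b where "b i = L2_inner \<mu> u (F i) / real N" for i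
  define h where "h y = (\<Sum>i<N. b i * g i y)" for y
  have Tu: "T\<mu> u \<in> L2_fun \<mu>N" using T\<mu> u by (auto simp: plan_operator_def)
  have TN: "integral_operator \<mu>N (t_kernel k\<mu> k\<nu> (empirical_measure N z)) (T\<mu> u) = h"
  proof
    fix y
    have "integral_operator \<mu>N (t_kernel k\<mu> k\<nu> (empirical_measure N z)) (T\<mu> u) y
        = (\<integral>x. (\<Sum>i<N. (g i y / real N) * (T\<mu> u x * f i x)) \<partial>\<mu>N)"
      unfolding integral_operator_def t_kernel_eq
      by (simp add: sum_divide_distrib sum_distrib_left mult_ac)
    also have "\<dots> = (\<Sum>i<N. (g i y / real N) * L2_inner \<mu>N (T\<mu> u) (f i))"
      unfolding L2_inner_def
      by (subst Bochner_Integration.integral_sum)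
         (auto intro!: integrable_mult_right integrable_L2_mult[OF Tu fg_L2(2)])
    also have "\<dots> = (\<Sum>i<N. (g i y / real N) * L2_inner \<mu> u (F i))"
      using P\<mu>.plan_operator_inner[OF T\<mu> u fg_measurable(1) fg_bounded(1)] by simp
    finally show "integral_operator \<mu>N (t_kernel k\<mu> k\<nu> (empirical_measure N z)) (T\<mu> u) y = h y"
      by (simp add: h_def b_def mult_ac)
  qed
  have TA: "TA u = T\<nu>_adj h"
    by (simp only: TA_def comp_def TN)
  have hm: "h \<in> borel_measurable borel"
    unfolding h_def using fg_measurable(2) by (intro borel_measurable_sum borel_measurable_times) auto
  have hb: "\<bar>h y\<bar> \<le> (\<Sum>i<N. \<bar>b i\<bar> * (exp (2 * L) / m\<nu>))" for y
  proof -
    have "\<bar>h y\<bar> \<le> (\<Sum>i<N. \<bar>b i * g i y\<bar>)" unfolding h_def by (rule sum_abs)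
    also have "\<dots> \<le> (\<Sum>i<N. \<bar>b i\<bar> * (exp (2 * L) / m\<nu>))"
      unfolding abs_mult using fg_bounded(2) by (intro sum_mono mult_left_mono) auto
    finally show ?thesis .
  qed
  have avg: "P\<nu>.average h y = (\<Sum>i<N. L2_inner \<mu> u (F i) * (G i y / real N))" for y
    unfolding P\<nu>.average_def h_def
    by (simp add: Bochner_Integration.integral_sum integrable_kernel fg_continuous b_def mult_ac)
  show "TA u \<in> L2_fun \<nu>" unfolding TA by (rule P\<nu>.plan_operator_adjoint(2)[OF T\<nu> adj hm hb])
  show "AE y in \<nu>. TA u y = (\<Sum>i<N. L2_inner \<mu> u (F i) * (G i y / real N))"
    using P\<nu>.plan_operator_adjoint(1)[OF T\<nu> adj hm hb] unfolding TA avg .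
qed

lemma integral_operator_t_kernel:
  assumes u: "u \<in> L2_fun \<mu>"
  shows "integral_operator \<mu> (t_kernel k\<mu> k\<nu> (empirical_measure N z)) u y
    = (\<Sum>i<N. L2_inner \<mu> u (f i) * (g i y / real N))"
proof -
  have "integral_operator \<mu> (t_kernel k\<mu> k\<nu> (empirical_measure N z)) u y
      = (\<integral>x. (\<Sum>i<N. (g i y / real N) * (u x * f i x)) \<partial>\<mu>)"
    unfolding integral_operator_def t_kernel_eq
    by (simp add: sum_divide_distrib sum_distrib_left mult_ac)
  also have "\<dots> = (\<Sum>i<N. (g i y / real N) * L2_inner \<mu> u (f i))"
    unfolding L2_inner_def
    by (subst Bochner_Integration.integral_sum)
       (auto intro!: integrable_mult_right integrable_L2_mult[OF u fg_L2(1)])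
  finally show ?thesis by (simp add: mult_ac)
qed

theorem operator_difference:
  fixes T\<mu> T\<nu> T\<nu>_adj
  assumes T\<mu>: "plan_operator \<mu> \<mu>N \<gamma>\<mu> T\<mu>" and T\<nu>: "plan_operator \<nu> \<nu>N \<gamma>\<nu> T\<nu>"
    and adj: "L2_adjoint \<nu> \<nu>N T\<nu> T\<nu>_adj"
  defines "t \<equiv> t_kernel k\<mu> k\<nu> (empirical_measure N z)"
  defines "D \<equiv> \<lambda>u y. (T\<nu>_adj \<circ> integral_operator \<mu>N t \<circ> T\<mu>) u y - integral_operator \<mu> t u y"
  defines "d \<equiv> \<lambda>(x, y). tA_kernel \<kappa>\<mu> \<kappa>\<nu> t x y - t x y"
  shows "hilbert_schmidt \<mu> \<nu> D" "d \<in> L2_fun (\<mu> \<Otimes>\<^sub>M \<nu>)" "hs_norm \<mu> \<nu> D = L2_norm (\<mu> \<Otimes>\<^sub>M \<nu>) d"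
    and "\<lbrakk>2 * L / \<epsilon> * (exp (2 * L) / m\<mu>) \<le> A; 2 * L / \<epsilon> * (exp (2 * L) / m\<nu>) \<le> A\<rbrakk>
      \<Longrightarrow> L2_norm (\<mu> \<Otimes>\<^sub>M \<nu>) d \<le> 2 * A * sqrt ((W2 \<mu>N \<mu>)\<^sup>2 + (W2 \<nu>N \<nu>)\<^sup>2)"
proof -
  \<comment> \<open>One rank one term for each summand of the first kernel and one, with opposite sign, for each summand of the
    second.\<close>
  define J where "J = {..<N} <+> {..<N}"
  define ff where "ff = case_sum F f"
  define gg where "gg = case_sum (\<lambda>i y. G i y / real N) (\<lambda>i y. - (g i y / real N))"
  have fin: "finite_measure \<mu>" "finite_measure \<nu>"
    using P\<mu>.prob_\<rho> P\<nu>.prob_\<rho> by (auto simp: prob_space_def)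
  have J: "finite J" by (simp add: J_def)
  have split: "(\<Sum>j\<in>J. \<phi> j) = (\<Sum>i<N. \<phi> (Inl i)) + (\<Sum>i<N. \<phi> (Inr i))" for \<phi> :: "nat + nat \<Rightarrow> real"
    unfolding J_def by (simp add: sum.Plus)
  have ff: "ff j \<in> L2_fun \<mu>" if "j \<in> J" for j
    using that FG_L2(1) fg_L2(1) by (auto simp: J_def ff_def)
  have gg: "gg j \<in> L2_fun \<nu>" if "j \<in> J" for j
    using that L2_fun_scale[OF FG_L2(2), of _ "1 / real N"] L2_fun_scale[OF fg_L2(3), of "- 1 / real N"]
    by (auto simp: J_def gg_def)
  have d_eq: "d = (\<lambda>(x, y). \<Sum>j\<in>J. ff j x * gg j y)"
    by (auto simp: d_def t_def tA_kernel_eq split ff_def gg_def t_kernel_eq fun_eq_iff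
        sum_divide_distrib sum_negf)
  have TA: "(T\<nu>_adj \<circ> integral_operator \<mu>N t \<circ> T\<mu>) u \<in> L2_fun \<nu>"
    "AE y in \<nu>. (T\<nu>_adj \<circ> integral_operator \<mu>N t \<circ> T\<mu>) u y = (\<Sum>i<N. L2_inner \<mu> u (F i) * (G i y / real N))"
    if "u \<in> L2_fun \<mu>" for u
    using composed_operator_AE[OF T\<mu> T\<nu> adj that] unfolding t_def by auto
  have TB: "integral_operator \<mu> t u = (\<lambda>y. \<Sum>i<N. L2_inner \<mu> u (f i) * (g i y / real N))"
    if "u \<in> L2_fun \<mu>" for u
    unfolding t_def by (rule ext) (rule integral_operator_t_kernel[OF that])
  have D_m: "D u \<in> borel_measurable \<nu>" if u: "u \<in> L2_fun \<mu>" for u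
  proof -
    have "(\<lambda>y. \<Sum>i<N. L2_inner \<mu> u (f i) * (g i y / real N)) \<in> borel_measurable \<nu>"
      using L2_funD(1)[OF fg_L2(3)] by (intro borel_measurable_sum) auto
    then show ?thesis
      unfolding D_def TB[OF u] using L2_funD(1)[OF TA(1)[OF u]] by (intro borel_measurable_diff)
  qed
  have D_AE: "AE y in \<nu>. D u y = (\<Sum>j\<in>J. L2_inner \<mu> u (ff j) * gg j y)" if u: "u \<in> L2_fun \<mu>" for u
    using TA(2)[OF u] unfolding D_def TB[OF u]
    by eventually_elim (simp add: split ff_def gg_def sum_negf)
  note finite_rank = finite_rank_hilbert_schmidt[where T = D and f = ff and g = gg, OF fin
      orthonormal_basis_exists[OF fin(1) P\<mu>.sets_\<rho>] J ff gg D_m D_AE]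
  show "hilbert_schmidt \<mu> \<nu> D" "hs_norm \<mu> \<nu> D = L2_norm (\<mu> \<Otimes>\<^sub>M \<nu>) d"
    using finite_rank(1,3) unfolding d_eq by auto
  show dL: "d \<in> L2_fun (\<mu> \<Otimes>\<^sub>M \<nu>)"
    using finite_rank(2) unfolding d_eq by auto
  have "d = (\<lambda>(x, y). (\<Sum>i<N. F i x * G i y) / real N - (\<Sum>i<N. f i x * g i y) / real N)"
    by (simp add: d_def t_def tA_kernel_eq t_kernel_eq)
  then show "L2_norm (\<mu> \<Otimes>\<^sub>M \<nu>) d \<le> 2 * A * sqrt ((W2 \<mu>N \<mu>)\<^sup>2 + (W2 \<nu>N \<nu>)\<^sup>2)"
    if "2 * L / \<epsilon> * (exp (2 * L) / m\<mu>) \<le> A" "2 * L / \<epsilon> * (exp (2 * L) / m\<nu>) \<le> A"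
    using kernel_deviation_L2[OF that] dL by simp
qed

end

section \<open>The good event and the conclusion\<close>

text \<open>The conditions \<open>C \<le> 1\<close> and \<open>r \<le> 1\<close> make \<open>p\<close> at most one, as the tail bound for a single
  centre demands; the union bound costs the factor \<open>N\<close>.\<close>

lemma (in prob_space) ball_counts_lower_tail:
  fixes X :: "nat \<Rightarrow> 'a \<Rightarrow> 'b::{metric_space, second_countable_topology}"
  assumes ind: "indep_vars (\<lambda>_. borel) X {..<N}"
    and distr: "\<forall>j<N. distr M borel (X j) = \<rho>" and \<rho>: "borel_prob \<rho>"
    and mass: "ball_mass \<rho> C D \<delta>" and r: "0 < r" "r \<le> \<delta>" "r \<le> 1"
  defines "p \<equiv> C * r powr D"
  defines "bad \<equiv> {\<omega> \<in> space M. \<exists>i<N. ball_count r {..<N} (\<lambda>j. X j \<omega>) (X i \<omega>) < real N * p / 2}"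
  shows "bad \<in> events" "prob bad \<le> real N * exp (- (real N / 2) * p\<^sup>2)"
proof -
  define B where "B i = {\<omega> \<in> space M. ball_count r {..<N} (\<lambda>j. X j \<omega>) (X i \<omega>) < real N * p / 2}" for i
  have rv: "X j \<in> borel_measurable M" if "j < N" for j
    using ind that by (simp add: indep_vars_def)
  have B: "B i \<in> events" if "i < N" for i
    unfolding B_def by (rule ball_count_event[OF rv that])
  have bad: "bad = (\<Union>i\<in>{..<N}. B i)" by (auto simp: bad_def B_def)
  show "bad \<in> events" unfolding bad using B by auto
  have C: "0 < C" "C \<le> 1" "0 < D" using mass by (auto simp: ball_mass_def)
  have "r powr D \<le> 1" using r C powr_mono2[of D r 1] by simp
  then have p: "0 \<le> p" "p \<le> 1"
    using C mult_mono[of C 1 "r powr D" 1] by (auto simp: p_def)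
  have m: "AE x in \<rho>. p \<le> measure \<rho> (ball x r)"
    using AE_in_spt[of \<rho>] \<rho> mass r unfolding ball_mass_def borel_prob_def p_def by auto
  have "prob bad \<le> (\<Sum>i<N. prob (B i))"
    unfolding bad using B by (intro finite_measure_subadditive_finite) auto
  also have "\<dots> \<le> (\<Sum>i<N. exp (- (real N / 2) * p\<^sup>2))"
    unfolding B_def using p r by (intro sum_mono ball_count_lower_tail[OF ind _ _ m]) (auto simp: distr)
  finally show "prob bad \<le> real N * exp (- (real N / 2) * p\<^sup>2)" by simp
qed

theorem theorem2p18:
  fixes c :: "'a::{metric_space, second_countable_topology} \<Rightarrow> 'a \<Rightarrow> real"
    and \<mu> \<nu> :: "'a measure"
    and \<pi> :: "('a \<times> 'a) measure"
    and C\<mu> D\<mu> \<delta>\<mu> C\<nu> D\<nu> \<delta>\<nu> :: real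
  assumes compact_space: "compact (UNIV :: 'a set)"
    and cost: "lipschitz_cost c"
    and prob_\<mu>: "borel_prob \<mu>"
    and prob_\<nu>: "borel_prob \<nu>"
    and mass_\<mu>: "ball_mass \<mu> C\<mu> D\<mu> \<delta>\<mu>"
    and mass_\<nu>: "ball_mass \<nu> C\<nu> D\<nu> \<delta>\<nu>"
    and joint: "\<pi> \<in> couplings \<mu> \<nu>"
  shows "\<exists>M>0. \<forall>(N::nat) (\<epsilon>::real) (\<tau>::real) (P :: 'w measure) (Z :: nat \<Rightarrow> 'w \<Rightarrow> 'a \<times> 'a).
    1 \<le> N \<and> 0 < \<epsilon> \<and> \<epsilon> \<le> Min {\<delta>\<mu>, \<delta>\<nu>, 1} \<and> \<tau> < 1 \<and>
    2 * real N * exp (- (real N / 2) * min ((C\<mu> * \<epsilon> powr D\<mu>)\<^sup>2) ((C\<nu> * \<epsilon> powr D\<nu>)\<^sup>2)) \<le> \<tau> \<and>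
    iid_sample P N Z \<pi> \<longrightarrow>
    (\<exists>A\<in>sets P. 1 - \<tau> \<le> measure P A \<and>
      (\<forall>\<omega>\<in>A. \<forall>k\<mu> k\<nu> \<gamma>\<mu> \<gamma>\<nu> \<kappa>\<mu> \<kappa>\<nu> T\<mu> T\<nu> T\<nu>_adj.
        let \<pi>N = empirical_measure N (\<lambda>i. Z i \<omega>);
            \<mu>N = distr \<pi>N borel fst;
            \<nu>N = distr \<pi>N borel snd;
            t = t_kernel k\<mu> k\<nu> \<pi>N;
            tA = tA_kernel \<kappa>\<mu> \<kappa>\<nu> t;
            TN = integral_operator \<mu>N t;
            TA = T\<nu>_adj \<circ> TN \<circ> T\<mu>;
            TB = integral_operator \<mu> t;
            Tdiff = (\<lambda>u y. TA u y - TB u y);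
            tdiff = (\<lambda>(x, y). tA x y - t x y)
        in
          entropic_kernel c \<epsilon> \<mu>N \<mu>N k\<mu> \<and> entropic_kernel c \<epsilon> \<nu>N \<nu>N k\<nu> \<and>
          optimal_plan \<mu> \<mu>N \<gamma>\<mu> \<and> optimal_plan \<nu> \<nu>N \<gamma>\<nu> \<and>
          disintegration \<gamma>\<mu> \<mu> \<kappa>\<mu> \<and> disintegration \<gamma>\<nu> \<nu> \<kappa>\<nu> \<and>
          plan_operator \<mu> \<mu>N \<gamma>\<mu> T\<mu> \<and> plan_operator \<nu> \<nu>N \<gamma>\<nu> T\<nu> \<and>
          L2_adjoint \<nu> \<nu>N T\<nu> T\<nu>_adj \<longrightarrow>
          hilbert_schmidt \<mu> \<nu> Tdiff \<and> tdiff \<in> L2_fun (\<mu> \<Otimes>\<^sub>M \<nu>) \<and>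
          hs_norm \<mu> \<nu> Tdiff = L2_norm (\<mu> \<Otimes>\<^sub>M \<nu>) tdiff \<and>
          L2_norm (\<mu> \<Otimes>\<^sub>M \<nu>) tdiff
            \<le> M * \<epsilon> powr (- 1 - max D\<mu> D\<nu>) * sqrt ((W2 \<mu>N \<mu>)\<^sup>2 + (W2 \<nu>N \<nu>)\<^sup>2)))"
proof -
  obtain L where L: "0 < L" and c_lip: "\<And>x x' y. \<bar>c x y - c x' y\<bar> \<le> L * dist x x'"
    using cost unfolding lipschitz_cost_def by blast
  have c: "continuous_on UNIV (\<lambda>(x, y). c x y)" "\<And>x y. c x y = c y x"
    using cost unfolding lipschitz_cost_def by blast+
  have C: "0 < C\<mu>" "0 < C\<nu>" using mass_\<mu> mass_\<nu> by (auto simp: ball_mass_def)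
  \<comment> \<open>A factor 2 comes from \<open>kernel_deviation_L2\<close>. The remaining 4 combines the constant \<open>2 L\<close> of the
    logarithm of the kernel with the loss of half of the ball mass; summing \<open>1 / C\<mu>\<close> and \<open>1 / C\<nu>\<close> serves
    both marginals at once.\<close>
  define M where "M = 8 * L * exp (2 * L) * (1 / C\<mu> + 1 / C\<nu>)"
  have M: "0 < M" using L C by (simp add: M_def add_pos_pos)
  show ?thesis
  proof (intro exI[of _ M] conjI allI impI M, goal_cases)
    case (1 N \<epsilon> \<tau> P Z)
    then have N: "1 \<le> N" and \<epsilon>: "0 < \<epsilon>" "\<epsilon> \<le> Min {\<delta>\<mu>, \<delta>\<nu>, 1}"
      and \<tau>: "2 * real N * exp (- (real N / 2) * min ((C\<mu> * \<epsilon> powr D\<mu>)\<^sup>2) ((C\<nu> * \<epsilon> powr D\<nu>)\<^sup>2)) \<le> \<tau>"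
      and iid: "iid_sample P N Z \<pi>"
      by blast+
    have \<epsilon>': "\<epsilon> \<le> \<delta>\<mu>" "\<epsilon> \<le> \<delta>\<nu>" "\<epsilon> \<le> 1" using \<epsilon>(2) by auto
    interpret P: prob_space P using iid by (simp add: iid_sample_def)
    have ind: "P.indep_vars (\<lambda>_. borel) Z {..<N}" and dZ: "\<And>i. i < N \<Longrightarrow> distr P borel (Z i) = \<pi>"
      using iid by (auto simp: iid_sample_def)
    have Zm: "Z i \<in> borel_measurable P" if "i < N" for i
      using ind that by (simp add: P.indep_vars_def)
    have fs: "(fst :: 'a \<times> 'a \<Rightarrow> 'a) \<in> borel_measurable borel" "(snd :: 'a \<times> 'a \<Rightarrow> 'a) \<in> borel_measurable borel"
      by (auto intro!: borel_measurable_continuous_onI continuous_intros)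
    have "distr P borel (\<lambda>\<omega>. fst (Z i \<omega>)) = \<mu>" if "i < N" for i
      using distr_distr[OF fs(1) Zm[OF that]] dZ[OF that] couplingsD(3)[OF joint] by (simp add: comp_def)
    then have d_fst: "\<forall>i<N. distr P borel (\<lambda>\<omega>. fst (Z i \<omega>)) = \<mu>" by blast
    have "distr P borel (\<lambda>\<omega>. snd (Z i \<omega>)) = \<nu>" if "i < N" for i
      using distr_distr[OF fs(2) Zm[OF that]] dZ[OF that] couplingsD(4)[OF joint] by (simp add: comp_def)
    then have d_snd: "\<forall>i<N. distr P borel (\<lambda>\<omega>. snd (Z i \<omega>)) = \<nu>" by blast
    define p\<mu> p\<nu> where "p\<mu> = C\<mu> * \<epsilon> powr D\<mu>" and "p\<nu> = C\<nu> * \<epsilon> powr D\<nu>"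
    have half_pos: "0 < q / 2" if "0 < q" for q :: real using that by simp
    have p: "0 < p\<mu>" "0 < p\<nu>" using C \<epsilon> by (simp_all add: p\<mu>_def p\<nu>_def)
    define B\<mu> where "B\<mu> = {\<omega> \<in> space P. \<exists>i<N. ball_count \<epsilon> {..<N} (\<lambda>j. fst (Z j \<omega>)) (fst (Z i \<omega>)) < real N * p\<mu> / 2}"
    define B\<nu> where "B\<nu> = {\<omega> \<in> space P. \<exists>i<N. ball_count \<epsilon> {..<N} (\<lambda>j. snd (Z j \<omega>)) (snd (Z i \<omega>)) < real N * p\<nu> / 2}"
    note tail_\<mu> = P.ball_counts_lower_tail[OF P.indep_vars_compose2[OF ind fs(1)] d_fst prob_\<mu> mass_\<mu> \<epsilon>(1) \<epsilon>'(1,3),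
        folded p\<mu>_def, folded B\<mu>_def]
    note tail_\<nu> = P.ball_counts_lower_tail[OF P.indep_vars_compose2[OF ind fs(2)] d_snd prob_\<nu> mass_\<nu> \<epsilon>(1) \<epsilon>'(2,3),
        folded p\<nu>_def, folded B\<nu>_def]
    let ?A = "space P - (B\<mu> \<union> B\<nu>)"
    have A: "?A \<in> sets P" using tail_\<mu>(1) tail_\<nu>(1) by auto
    have "P.prob (B\<mu> \<union> B\<nu>) \<le> P.prob B\<mu> + P.prob B\<nu>"
      using tail_\<mu>(1) tail_\<nu>(1) by (rule measure_Un_le)
    also have "\<dots> \<le> real N * exp (- (real N / 2) * min (p\<mu>\<^sup>2) (p\<nu>\<^sup>2))
        + real N * exp (- (real N / 2) * min (p\<mu>\<^sup>2) (p\<nu>\<^sup>2))"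
    proof (rule add_mono)
      have weaken: "real N * exp (- (real N / 2) * q) \<le> real N * exp (- (real N / 2) * min (p\<mu>\<^sup>2) (p\<nu>\<^sup>2))"
        if "min (p\<mu>\<^sup>2) (p\<nu>\<^sup>2) \<le> q" for q
      proof -
        have "- (real N / 2) * q \<le> - (real N / 2) * min (p\<mu>\<^sup>2) (p\<nu>\<^sup>2)"
          by (rule mult_left_mono_neg[OF that]) simp
        then show ?thesis by (intro mult_left_mono) simp_all
      qed
      show "P.prob B\<mu> \<le> real N * exp (- (real N / 2) * min (p\<mu>\<^sup>2) (p\<nu>\<^sup>2))"
        by (rule order.trans[OF tail_\<mu>(2) weaken]) simp
      show "P.prob B\<nu> \<le> real N * exp (- (real N / 2) * min (p\<mu>\<^sup>2) (p\<nu>\<^sup>2))"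
        by (rule order.trans[OF tail_\<nu>(2) weaken]) simp
    qed
    also have "\<dots> \<le> \<tau>" using \<tau> by (simp add: p\<mu>_def p\<nu>_def)
    finally have prob_A: "1 - \<tau> \<le> P.prob ?A"
      using P.prob_compl[of "B\<mu> \<union> B\<nu>"] tail_\<mu>(1) tail_\<nu>(1) by simp
    define E where "E = \<epsilon> powr (- 1 - max D\<mu> D\<nu>)"
    define a where "a = 4 * L * exp (2 * L) * (1 / C\<mu> + 1 / C\<nu>) * E"
    \<comment> \<open>Since \<open>\<epsilon> \<le> 1\<close>, the larger of the two exponents dominates.\<close>
    have lip_bound: "2 * L / \<epsilon> * (exp (2 * L) / (C * \<epsilon> powr D / 2)) \<le> a"
      if C': "0 < C" "1 / C \<le> 1 / C\<mu> + 1 / C\<nu>" and D: "D \<le> max D\<mu> D\<nu>" for C D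
    proof -
      have "2 * L / \<epsilon> * (exp (2 * L) / (C * \<epsilon> powr D / 2)) = 4 * L * exp (2 * L) * (1 / C) * \<epsilon> powr (- 1 - D)"
        using \<epsilon>(1) by (simp add: powr_diff powr_minus divide_simps)
      also have "\<dots> \<le> 4 * L * exp (2 * L) * (1 / C\<mu> + 1 / C\<nu>) * E"
        unfolding E_def using L C C' D \<epsilon>(1) \<epsilon>'(3)
        by (intro mult_mono powr_mono') (auto intro!: mult_nonneg_nonneg add_nonneg_nonneg)
      finally show ?thesis by (simp add: a_def)
    qed
    have a\<mu>: "2 * L / \<epsilon> * (exp (2 * L) / (p\<mu> / 2)) \<le> a"
      unfolding p\<mu>_def by (rule lip_bound) (use C in auto)
    have a\<nu>: "2 * L / \<epsilon> * (exp (2 * L) / (p\<nu> / 2)) \<le> a"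
      unfolding p\<nu>_def by (rule lip_bound) (use C in auto)
    have a_M: "2 * a = M * E" by (simp add: a_def M_def)
    show ?case
    proof (rule bexI[OF _ A], rule conjI[OF prob_A], intro ballI allI, unfold Let_def, intro impI, goal_cases)
      case (1 \<omega> k\<mu> k\<nu> \<gamma>\<mu> \<gamma>\<nu> \<kappa>\<mu> \<kappa>\<nu> T\<mu> T\<nu> T\<nu>_adj)
      let ?z = "\<lambda>i. Z i \<omega>"
      let ?\<mu>N = "distr (empirical_measure N ?z) borel fst" and ?\<nu>N = "distr (empirical_measure N ?z) borel snd"
      have \<omega>: "\<omega> \<in> space P" "\<omega> \<notin> B\<mu>" "\<omega> \<notin> B\<nu>" using 1(1) by auto
      have half: "p / 2 \<le> measure (empirical_measure N x) (ball (x i) \<epsilon>)"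
        if "\<not> ball_count \<epsilon> {..<N} x (x i) < real N * p / 2" for p i and x :: "nat \<Rightarrow> 'a"
        using that N by (simp add: measure_empirical_ball[OF N] field_simps)
      have half_\<mu>: "\<forall>i<N. p\<mu> / 2 \<le> measure ?\<mu>N (ball (fst (Z i \<omega>)) \<epsilon>)"
      proof (intro allI impI)
        fix i assume i: "i < N"
        show "p\<mu> / 2 \<le> measure ?\<mu>N (ball (fst (Z i \<omega>)) \<epsilon>)"
          unfolding distr_empirical[OF fs(1)]
          by (rule half) (use \<omega>(1,2) i in \<open>auto simp: B\<mu>_def\<close>)
      qed
      have half_\<nu>: "\<forall>i<N. p\<nu> / 2 \<le> measure ?\<nu>N (ball (snd (Z i \<omega>)) \<epsilon>)"
      proof (intro allI impI)
        fix i assume i: "i < N"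
        show "p\<nu> / 2 \<le> measure ?\<nu>N (ball (snd (Z i \<omega>)) \<epsilon>)"
          unfolding distr_empirical[OF fs(2)]
          by (rule half) (use \<omega>(1,3) i in \<open>auto simp: B\<nu>_def\<close>)
      qed
      have kernels: "entropic_kernel c \<epsilon> ?\<mu>N ?\<mu>N k\<mu>" "entropic_kernel c \<epsilon> ?\<nu>N ?\<nu>N k\<nu>"
        and plans: "optimal_plan \<mu> ?\<mu>N \<gamma>\<mu>" "optimal_plan \<nu> ?\<nu>N \<gamma>\<nu>"
        "disintegration \<gamma>\<mu> \<mu> \<kappa>\<mu>" "disintegration \<gamma>\<nu> \<nu> \<kappa>\<nu>"
        and T: "plan_operator \<mu> ?\<mu>N \<gamma>\<mu> T\<mu>" "plan_operator \<nu> ?\<nu>N \<gamma>\<nu> T\<nu>" "L2_adjoint \<nu> ?\<nu>N T\<nu> T\<nu>_adj"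
        using 1(2) by blast+
      interpret operator_comparison c \<epsilon> L N ?z \<mu> \<nu> "p\<mu> / 2" "p\<nu> / 2" k\<mu> k\<nu> \<gamma>\<mu> \<gamma>\<nu> \<kappa>\<mu> \<kappa>\<nu> ?\<mu>N ?\<nu>N
        by (rule operator_comparison.intro)
           (rule compact_space N c c_lip less_imp_le[OF L] \<epsilon>(1) refl half_pos[OF p(1)] half_pos[OF p(2)]
              half_\<mu> half_\<nu> kernels plans)+
      note bounds = operator_difference(1,2,3)[OF T] operator_difference(4)[OF T a\<mu> a\<nu>]
      show ?case
        using bounds unfolding a_M E_def by (intro conjI)
    qed
  qed
qed

end
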